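(* Let $\{P(t)\}_{t\ge0}$ be a stochastically continuous Markovian semigroup on $\mathbb{X}$ with a periodic measure $\{\rho_s\}_{s\in\mathbb{R}}$ of period $\tau$, and let $\bar\rho=\frac1\tau\int_0^\tau\rho_s\,ds$. Then the invariant measure $\bar\rho$ is ergodic if and only if for any $\Gamma\in\mathcal B(\mathbb{X})$, as $N\to\infty$, $$\int_{\mathbb{X}}\Big|\int_0^\tau\Big(\frac1N\sum_{k=0}^{N-1}P(s+k\tau,y,\Gamma)-\rho_s(\Gamma)\Big)ds\Big|\,\bar\rho(dy)\to0 .$$ Moreover, in this case $L=\bigcup\{L_s:s\in[0,\tau)\}$, where $L_s=\mathrm{supp}(\rho_s)$, is the unique set (up to a $\bar\rho$-measure $0$ set) with positive $\bar\rho$-measure satisfying $P(t,x,L)=I_L(x)$ for all $t\ge0$, for $\bar\rho$-a.e. $x$.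
   Context: $\mathbb{X}$ is a Polish space with Borel $\sigma$-algebra $\mathcal B(\mathbb{X})$. $\{P(t)\}_{t\ge0}$ is given by transition probabilities $P(t,x,\cdot)$ satisfying the Chapman–Kolmogorov equation (the transition semigroup of a Markovian random dynamical system). It is stochastically continuous if $\lim_{t\to0}P(t,x,B(x,\gamma))=1$ for all $x\in\mathbb{X}$, $\gamma>0$. $I_\Gamma$ is the indicator function. A map $\rho:\mathbb{R}\to\mathcal P(\mathbb{X})$ (Borel probability measures) is a periodic measure of period $\tau$ if $\rho_{s+\tau}=\rho_s$ and $\rho_{t+s}(B)=\int_{\mathbb{X}}P(t,x,B)\rho_s(dx)$ for all $s\in\mathbb{R}$, $t\ge0$. Then $\bar\rho$ is an invariant measure of $\{P(t)\}$. Ergodicity of an invariant measure $\bar\rho$: let $P^{\bar\rho}$ be the unique probability measure on $(\Omega^*,\mathcal F^* )=(\mathbb{X}^{\mathbb{R}},\mathcal B(\mathbb{X}^{\mathbb{R}}))$ under which the canonical process $\omega^*\mapsto\omega^*(t)$ is the stationary Markov process with transition probabilities $P(t,x,\cdot)$ and one-dimensional marginals $\bar\rho$, and let $(\theta_t^*\omega^* )(s)=\omega^*(t+s)$. $\bar\rho$ is ergodic if $\lim_{T\to\infty}\frac1T\int_0^TP^{\bar\rho}(\theta_{-t}^*A\cap B)dt=P^{\bar\rho}(A)P^{\bar\rho}(B)$ for all $A,B\in\mathcal F^*$. *)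

theory Defs
  imports "HOL-Probability.Probability"
begin

text \<open>
  Joint measurability in time and state, and \<open>P 0 x = return borel x\<close>, are not required:
  both follow once stochastic continuity is assumed as well.
\<close>

definition markov_semigroup :: "(real \<Rightarrow> 'a \<Rightarrow> 'a::polish_space measure) \<Rightarrow> bool" where
  "markov_semigroup P \<longleftrightarrow>
     (\<forall>t\<ge>0. P t \<in> borel \<rightarrow>\<^sub>M prob_algebra borel) \<and>
     (\<forall>s\<ge>0. \<forall>t\<ge>0. \<forall>x. \<forall>B\<in>sets borel.
        measure (P (s + t) x) B = (\<integral>y. measure (P t y) B \<partial>P s x))"

definition stochastically_continuous :: "(real \<Rightarrow> 'a \<Rightarrow> 'a::polish_space measure) \<Rightarrow> bool" where
  "stochastically_continuous P \<longleftrightarrow>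
     (\<forall>x. \<forall>\<gamma>>0. ((\<lambda>t. measure (P t x) (ball x \<gamma>)) \<longlongrightarrow> 1) (at_right 0))"

definition periodic_measure ::
  "(real \<Rightarrow> 'a \<Rightarrow> 'a::polish_space measure) \<Rightarrow> real \<Rightarrow> (real \<Rightarrow> 'a measure) \<Rightarrow> bool" where
  "periodic_measure P \<tau> \<rho> \<longleftrightarrow>
     0 < \<tau> \<and>
     (\<forall>s. \<rho> s \<in> space (prob_algebra borel)) \<and>
     (\<forall>s. \<rho> (s + \<tau>) = \<rho> s) \<and>
     (\<forall>s. \<forall>t\<ge>0. \<forall>B\<in>sets borel. measure (\<rho> (t + s)) B = (\<integral>x. measure (P t x) B \<partial>\<rho> s))"

definition period_average :: "real \<Rightarrow> (real \<Rightarrow> 'a::polish_space measure) \<Rightarrow> 'a measure" where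
  "period_average \<tau> \<rho> =
     measure_of UNIV (sets borel)
       (\<lambda>B. ennreal (1 / \<tau>) * (\<integral>\<^sup>+s\<in>{0..\<tau>}. emeasure (\<rho> s) B \<partial>lborel))"

definition invariant_measure ::
  "(real \<Rightarrow> 'a \<Rightarrow> 'a::polish_space measure) \<Rightarrow> 'a measure \<Rightarrow> bool" where
  "invariant_measure P \<mu> \<longleftrightarrow>
     \<mu> \<in> space (prob_algebra borel) \<and>
     (\<forall>t\<ge>0. \<forall>B\<in>sets borel. measure \<mu> B = (\<integral>x. measure (P t x) B \<partial>\<mu>))"

text \<open>
  The path space carries the product \<open>\<sigma>\<close>-algebra generated by the coordinates, the one on which
  the Kolmogorov extension theorem yields a unique measure.
\<close>

abbreviation path_space :: "(real \<Rightarrow> 'a::polish_space) measure" where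
  "path_space \<equiv> Pi\<^sub>M UNIV (\<lambda>_. borel)"

definition path_shift :: "real \<Rightarrow> (real \<Rightarrow> 'a) \<Rightarrow> real \<Rightarrow> 'a" where
  "path_shift t \<omega> = (\<lambda>s. \<omega> (t + s))"

definition past :: "real \<Rightarrow> (real \<Rightarrow> 'a::polish_space) measure" where
  "past s = sigma UNIV {{\<omega>. \<omega> r \<in> \<Gamma>} | r \<Gamma>. r \<le> s \<and> \<Gamma> \<in> sets borel}"

text \<open>
  The coordinate process is Markov with transition probabilities \<open>P\<close>: given its past up to
  time \<open>s\<close>, it lies in \<open>\<Gamma>\<close> at time \<open>t \<ge> s\<close> with probability \<open>P (t - s) (\<omega> s) \<Gamma>\<close>.
\<close>

definition stationary_markov_law ::
  "(real \<Rightarrow> 'a \<Rightarrow> 'a::polish_space measure) \<Rightarrow> 'a measure \<Rightarrow> (real \<Rightarrow> 'a) measure \<Rightarrow> bool" where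
  "stationary_markov_law P \<mu> M \<longleftrightarrow>
     M \<in> space (prob_algebra path_space) \<and>
     (\<forall>t. distr M path_space (path_shift t) = M) \<and>
     (\<forall>t. distr M borel (\<lambda>\<omega>. \<omega> t) = \<mu>) \<and>
     (\<forall>s t. s \<le> t \<longrightarrow> (\<forall>\<Gamma>\<in>sets borel. AE \<omega> in M.
        real_cond_exp M (past s) (indicator {\<omega>. \<omega> t \<in> \<Gamma>}) \<omega> = measure (P (t - s) (\<omega> s)) \<Gamma>))"

definition canonical_law ::
  "(real \<Rightarrow> 'a \<Rightarrow> 'a::polish_space measure) \<Rightarrow> 'a measure \<Rightarrow> (real \<Rightarrow> 'a) measure" where
  "canonical_law P \<mu> = (THE M. stationary_markov_law P \<mu> M)"

definition ergodic_measure ::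
  "(real \<Rightarrow> 'a \<Rightarrow> 'a::polish_space measure) \<Rightarrow> 'a measure \<Rightarrow> bool" where
  "ergodic_measure P \<mu> \<longleftrightarrow>
     invariant_measure P \<mu> \<and>
     (\<forall>A\<in>sets path_space. \<forall>B\<in>sets path_space.
        ((\<lambda>T. (1 / T) *
            (LBINT t:{0..T}. measure (canonical_law P \<mu>) (path_shift (- t) ` A \<inter> B)))
          \<longlongrightarrow> measure (canonical_law P \<mu>) A * measure (canonical_law P \<mu>) B) at_top)"

definition measure_support :: "'a::topological_space measure \<Rightarrow> 'a set" where
  "measure_support M = {x. \<forall>U. open U \<longrightarrow> x \<in> U \<longrightarrow> 0 < emeasure M U}"

text \<open>
  The union of the supports of a periodic measure is an uncountable union of closed sets, whose
  Borel measurability is not guaranteed, so \<open>A\<close> ranges over \<open>\<mu>\<close>-measurable sets, and \<open>P(t,x,A)\<close> is evaluated in the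
  completion of \<open>P t x\<close>; for Borel \<open>A\<close> the completions change nothing.
\<close>

definition ae_invariant_set ::
  "(real \<Rightarrow> 'a \<Rightarrow> 'a::polish_space measure) \<Rightarrow> 'a measure \<Rightarrow> 'a set \<Rightarrow> bool" where
  "ae_invariant_set P \<mu> A \<longleftrightarrow>
     A \<in> sets (completion \<mu>) \<and>
     (\<forall>t\<ge>0. AE x in \<mu>. A \<in> sets (completion (P t x)) \<and>
        measure (completion (P t x)) A = indicator A x)"

end

theory Submission
  imports Defs
begin

text \<open>
  Integrating over one period and summing turns the condition on the periodic measure into
  convergence in \<open>L\<^sup>1(\<rho>bar)\<close> of the time averages of \<open>P t x \<Gamma>\<close> to \<open>\<rho>bar \<Gamma>\<close>. Stochastic
  continuity makes \<open>P t x\<close> jointly measurable, and Kolmogorov's extension theorem together with the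
  Markov property shows that the canonical law exists and is unique.

  If \<open>\<rho>bar\<close> is ergodic, events depending on a single coordinate give weak convergence of the
  averages, and an elementary \<open>L\<^sup>2\<close> recursion for the contraction \<open>P \<tau>\<close> upgrades it to strong
  convergence. Conversely, the Markov property reduces the mixing of open cylinder events to the
  convergence of averages of bounded functions, and a Dynkin argument in each of the two events
  extends it to the whole path space.

  The union \<open>L\<close> of the supports has full measure, which makes it invariant almost everywhere; if \<open>A\<close>
  is another invariant set, then ergodicity forces \<open>\<rho>bar A = (\<rho>bar A)\<^sup>2\<close>.
\<close>

section \<open>Markov kernels\<close>

text \<open>Paths carry no regularity, so the probability of a shifted event is not evidently
  measurable in time. The kernels only run forward; measurability in time is therefore always drawn
  from right limits. This also explains the open cylinders: their indicators are limits of
  continuous functions of the coordinates, which stochastic continuity controls. The Dynkin argument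
  must pass countable unions through a limit in time. This works because, for every \<open>t\<close>
  and in either slot, the set function is dominated by the law itself (for the shifted event by
  stationarity), so tails of disjoint unions are small uniformly in time. Weak convergence suffices
  for the recursion because the growth of the squared norm is tested against one fixed bounded
  function, the time integral over the first period. As for \<open>L\<close>, a projection of a
  Borel set need not be Borel, whereas compact sets have compact projections; hence the inner
  regularity and the completions. Invariance of the measure makes a null set null for almost every
  kernel, so any set containing a Borel set of full measure is invariant almost everywhere.\<close>

lemma prob_algebra_borelD:
  assumes "\<mu> \<in> space (prob_algebra borel)"
  shows "prob_space \<mu>" "sets \<mu> = sets borel" "space \<mu> = UNIV"
  using assms sets_eq_imp_space_eq[of \<mu> borel] by (auto simp: space_prob_algebra)

lemma prob_measure_eqI:
  assumes "prob_space M" "prob_space N" "sets M = sets N"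
    and "\<And>A. A \<in> sets M \<Longrightarrow> measure M A = measure N A"
  shows "M = N"
proof -
  interpret M: prob_space M by fact
  interpret N: prob_space N by fact
  show ?thesis
    using assms(3,4) by (intro measure_eqI) (auto simp: M.emeasure_eq_measure N.emeasure_eq_measure)
qed

lemma measure_bind_prob_algebra:
  assumes "M \<in> space (prob_algebra N)" "K \<in> N \<rightarrow>\<^sub>M prob_algebra R" "A \<in> sets R"
  shows "measure (M \<bind> K) A = (\<integral>x. measure (K x) A \<partial>M)"
proof -
  have sets: "sets M = sets N" and "prob_space M"
    using assms(1) by (auto simp: space_prob_algebra)
  then interpret prob_space M by simp
  interpret subprob_space M
    by (rule prob_space_imp_subprob_space) unfold_locales
  have "K \<in> M \<rightarrow>\<^sub>M subprob_algebra R"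
    using measurable_prob_algebraD[OF assms(2)] sets by (simp cong: measurable_cong_sets)
  then show ?thesis
    by (rule measure_bind) fact
qed

lemma nn_integral_bind_prob_algebra:
  assumes "M \<in> space (prob_algebra N)" "K \<in> N \<rightarrow>\<^sub>M prob_algebra R" "f \<in> borel_measurable R"
  shows "(\<integral>\<^sup>+y. f y \<partial>(M \<bind> K)) = (\<integral>\<^sup>+x. \<integral>\<^sup>+y. f y \<partial>K x \<partial>M)"
  using assms measurable_prob_algebraD[OF assms(2)]
  by (intro nn_integral_bind) (auto simp: space_prob_algebra cong: measurable_cong_sets)

lemma (in prob_space) integral_abs_le:
  fixes f :: "'a \<Rightarrow> real"
  assumes [measurable]: "f \<in> borel_measurable M" and C: "\<And>x. x \<in> space M \<Longrightarrow> \<bar>f x\<bar> \<le> C"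
  shows "integrable M f" "\<bar>\<integral>x. f x \<partial>M\<bar> \<le> C"
proof -
  show "integrable M f"
    using C by (intro integrable_const_bound[where B=C]) auto
  then have "\<bar>\<integral>x. f x \<partial>M\<bar> \<le> (\<integral>x. \<bar>f x\<bar> \<partial>M)"
    by (intro integral_abs_bound)
  also have "\<dots> \<le> C"
    using C \<open>integrable M f\<close> by (intro integral_le_const) auto
  finally show "\<bar>\<integral>x. f x \<partial>M\<bar> \<le> C" .
qed

text \<open>Adding the bound \<open>C\<close> makes the integrand nonnegative, so the identity for
  nonnegative integrals carries over to signed functions. All measures involved have mass one, so
  the same constant drops out on both sides at the end.\<close>

lemma integral_bind_prob_algebra:
  fixes f :: "_ \<Rightarrow> real"
  assumes M: "M \<in> space (prob_algebra N)" and K: "K \<in> N \<rightarrow>\<^sub>M prob_algebra R"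
    and f: "f \<in> borel_measurable R" and C: "\<And>x. \<bar>f x\<bar> \<le> C"
  shows "(\<integral>y. f y \<partial>(M \<bind> K)) = (\<integral>x. \<integral>y. f y \<partial>K x \<partial>M)"
proof -
  note [measurable] = f measurable_prob_algebraD[OF K]
  have setsM: "sets M = sets N" and pM: "prob_space M" and spM: "space M = space N"
    using M sets_eq_imp_space_eq[of M N] by (auto simp: space_prob_algebra)
  have pK: "prob_space (K x)" "sets (K x) = sets R" if "x \<in> space M" for x
    using measurable_space[OF K, of x] that spM by (auto simp: space_prob_algebra)
  have pB: "prob_space (M \<bind> K)" and sB: "sets (M \<bind> K) = sets R"
    using prob_space_bind'[OF M K] sets_bind'[OF M K] by auto
  interpret M: prob_space M by (rule pM)
  interpret B: prob_space "M \<bind> K" by (rule pB)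
  have KM[measurable]: "K \<in> M \<rightarrow>\<^sub>M subprob_algebra R"
    using measurable_prob_algebraD[OF K] setsM by (simp cong: measurable_cong_sets)
  have fB: "f \<in> borel_measurable (M \<bind> K)" using f sB by (simp cong: measurable_cong_sets)
  have fK: "f \<in> borel_measurable (K x)" if "x \<in> space M" for x
    using f pK(2)[OF that] by (simp cong: measurable_cong_sets)
  have iB: "integrable (M \<bind> K) f"
    by (rule B.integral_abs_le(1)[OF fB C])
  have C0: "0 \<le> f x + C" for x using C[of x] by linarith
  have mK: "(\<lambda>x. \<integral>y. f y \<partial>K x) \<in> borel_measurable M" by measurable
  have bK: "\<bar>\<integral>y. f y \<partial>K x\<bar> \<le> C" and iK: "integrable (K x) f" if "x \<in> space M" for x
    using prob_space.integral_abs_le[OF pK(1)[OF that] fK[OF that] C] by auto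
  have iMK: "integrable M (\<lambda>x. \<integral>y. f y \<partial>K x)"
    by (rule M.integral_abs_le(1)[OF mK]) (rule bK)
  have K1: "measure (K x) (space (K x)) = 1" if "x \<in> space M" for x
    using prob_space.prob_space[OF pK(1)[OF that]] .
  have "ennreal ((\<integral>y. f y \<partial>(M \<bind> K)) + C) = ennreal (\<integral>y. f y + C \<partial>(M \<bind> K))"
    using iB B.prob_space by simp
  also have "\<dots> = (\<integral>\<^sup>+y. ennreal (f y + C) \<partial>(M \<bind> K))"
    using iB C0 by (intro nn_integral_eq_integral[symmetric]) auto
  also have "\<dots> = (\<integral>\<^sup>+x. \<integral>\<^sup>+y. ennreal (f y + C) \<partial>K x \<partial>M)"
    by (rule nn_integral_bind_prob_algebra[OF M K]) measurable
  also have "\<dots> = (\<integral>\<^sup>+x. ennreal ((\<integral>y. f y \<partial>K x) + C) \<partial>M)"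
  proof (rule nn_integral_cong)
    fix x assume x: "x \<in> space M"
    interpret Kx: prob_space "K x" by (rule pK(1)[OF x])
    have "(\<integral>\<^sup>+y. ennreal (f y + C) \<partial>K x) = ennreal (\<integral>y. f y + C \<partial>K x)"
      using iK[OF x] C0 by (intro nn_integral_eq_integral) auto
    then show "(\<integral>\<^sup>+y. ennreal (f y + C) \<partial>K x) = ennreal ((\<integral>y. f y \<partial>K x) + C)"
      using iK[OF x] Kx.prob_space by simp
  qed
  also have "\<dots> = ennreal (\<integral>x. (\<integral>y. f y \<partial>K x) + C \<partial>M)"
  proof (rule nn_integral_eq_integral)
    show "AE x in M. 0 \<le> (\<integral>y. f y \<partial>K x) + C"
    proof (rule AE_I2)
      fix x assume "x \<in> space M"
      from bK[OF this] show "0 \<le> (\<integral>y. f y \<partial>K x) + C" by linarith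
    qed
  qed (use iMK in simp)
  also have "\<dots> = ennreal ((\<integral>x. \<integral>y. f y \<partial>K x \<partial>M) + C)"
    using iMK M.prob_space by simp
  finally have "(\<integral>y. f y \<partial>(M \<bind> K)) + C = (\<integral>x. \<integral>y. f y \<partial>K x \<partial>M) + C"
    using B.integral_abs_le(2)[OF fB C] M.integral_abs_le(2)[OF mK bK]
    by (subst (asm) ennreal_inj) (auto simp: abs_le_iff)
  then show ?thesis by simp
qed

locale markov_transition =
  fixes P :: "real \<Rightarrow> 'a \<Rightarrow> 'a::polish_space measure"
  assumes markov_semigroup: "markov_semigroup P"
begin

lemma kernel_measurable[measurable]: "0 \<le> t \<Longrightarrow> P t \<in> borel \<rightarrow>\<^sub>M prob_algebra borel"
  using markov_semigroup by (auto simp: markov_semigroup_def)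

lemma kernel_in_prob_algebra: "0 \<le> t \<Longrightarrow> P t x \<in> space (prob_algebra borel)"
  using measurable_space[OF kernel_measurable] by auto

lemma
  assumes "0 \<le> t"
  shows prob_space_kernel: "prob_space (P t x)"
    and sets_kernel[measurable_cong]: "sets (P t x) = sets borel"
    and space_kernel: "space (P t x) = UNIV"
  using prob_algebra_borelD[OF kernel_in_prob_algebra[OF assms]] by auto

text \<open>Chapman-Kolmogorov read as composition of kernels; in this form it passes from sets to
  integrals of functions.\<close>

lemma kernel_add:
  assumes st: "0 \<le> s" "0 \<le> t"
  shows "P (s + t) x = P s x \<bind> P t"
proof (rule prob_measure_eqI)
  note K = kernel_in_prob_algebra[OF st(1)] kernel_measurable[OF st(2)]
  show "prob_space (P (s + t) x)" using st by (simp add: prob_space_kernel)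
  show "prob_space (P s x \<bind> P t)" by (rule prob_space_bind'[OF K])
  show "sets (P (s + t) x) = sets (P s x \<bind> P t)"
    using st sets_bind'[OF K] by (simp add: sets_kernel)
  fix B assume "B \<in> sets (P (s + t) x)"
  then have B: "B \<in> sets borel" using st by (simp add: sets_kernel)
  then have "measure (P (s + t) x) B = (\<integral>y. measure (P t y) B \<partial>P s x)"
    using markov_semigroup st by (auto simp: markov_semigroup_def)
  also have "\<dots> = measure (P s x \<bind> P t) B"
    by (rule measure_bind_prob_algebra[OF K B, symmetric])
  finally show "measure (P (s + t) x) B = measure (P s x \<bind> P t) B" .
qed

lemma invariant_measure_bind:
  assumes "invariant_measure P \<mu>" "0 \<le> t"
  shows "\<mu> \<bind> P t = \<mu>"
proof -
  have \<mu>: "\<mu> \<in> space (prob_algebra borel)" using assms by (simp add: invariant_measure_def)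
  note K = \<mu> kernel_measurable[OF assms(2)]
  show ?thesis
  proof (rule prob_measure_eqI)
    show "prob_space (\<mu> \<bind> P t)" by (rule prob_space_bind'[OF K])
    show "prob_space \<mu>" "sets (\<mu> \<bind> P t) = sets \<mu>"
      using prob_algebra_borelD[OF \<mu>] sets_bind'[OF K] by auto
    fix A assume "A \<in> sets (\<mu> \<bind> P t)"
    then have A: "A \<in> sets borel" using sets_bind'[OF K] by simp
    with assms show "measure (\<mu> \<bind> P t) A = measure \<mu> A"
      by (simp add: measure_bind_prob_algebra[OF K A] invariant_measure_def)
  qed
qed

end

section \<open>Measurability in time from right continuity\<close>

lemma borel_measurable_right_continuous:
  fixes F :: "real \<Rightarrow> 'b \<Rightarrow> real"
  assumes meas: "\<And>t. F t \<in> borel_measurable N"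
    and rc: "\<And>t x h. x \<in> space N \<Longrightarrow> (\<And>n. 0 < h n) \<Longrightarrow> h \<longlonglongrightarrow> 0 \<Longrightarrow> (\<lambda>n. F (t + h n) x) \<longlonglongrightarrow> F t x"
  shows "(\<lambda>(t, x). F t x) \<in> borel_measurable (borel \<Otimes>\<^sub>M N)"
proof -
  \<comment> \<open>\<open>d n t\<close> is the first point of the grid with mesh
    \<open>1 / Suc n\<close> strictly to the right of \<open>t\<close>. Strictness matches the
    hypothesis on positive increments, and there are only countably many grid points, so every
    approximant is measurable.\<close>
  define d where "d n t = (of_int \<lfloor>real (Suc n) * t\<rfloor> + 1) / real (Suc n)" for n and t :: real
  show ?thesis
  proof (rule borel_measurable_LIMSEQ_real)
    show "(\<lambda>p. F (d n (fst p)) (snd p)) \<in> borel_measurable (borel \<Otimes>\<^sub>M N)" for n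
    proof -
      have "(\<lambda>p. (\<lambda>i p. F ((of_int i + 1) / real (Suc n)) (snd p)) \<lfloor>real (Suc n) * fst p\<rfloor> p)
        \<in> borel_measurable (borel \<Otimes>\<^sub>M N)"
        by (rule measurable_compose_countable)
           (auto intro!: measurable_compose[OF measurable_snd meas])
      then show ?thesis by (simp add: d_def)
    qed
    fix p :: "real \<times> 'b" assume "p \<in> space (borel \<Otimes>\<^sub>M N)"
    then obtain t x where p: "p = (t, x)" and x: "x \<in> space N" by (auto simp: space_pair_measure)
    have d: "t < d n t" "d n t \<le> t + 1 / real (Suc n)" for n
    proof -
      have "real (Suc n) * t < of_int \<lfloor>real (Suc n) * t\<rfloor> + 1" by linarith
      then show "t < d n t" by (simp add: d_def field_simps)
      have "of_int \<lfloor>real (Suc n) * t\<rfloor> \<le> real (Suc n) * t" by linarith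
      then have "d n t \<le> (real (Suc n) * t + 1) / real (Suc n)"
        unfolding d_def by (intro divide_right_mono) auto
      also have "\<dots> = t + 1 / real (Suc n)" by (simp add: add_divide_distrib)
      finally show "d n t \<le> t + 1 / real (Suc n)" .
    qed
    have "(\<lambda>n. d n t - t) \<longlonglongrightarrow> 0"
    proof (rule tendsto_sandwich[OF _ _ tendsto_const LIMSEQ_Suc[OF lim_inverse_n']])
      show "\<forall>\<^sub>F n in sequentially. 0 \<le> d n t - t" using d(1) by (auto simp: less_imp_le)
      show "\<forall>\<^sub>F n in sequentially. d n t - t \<le> 1 / real (Suc n)"
        using d(2) by (auto simp: diff_le_eq add.commute)
    qed
    from rc[OF x _ this, of t] d(1)
    show "(\<lambda>n. F (d n (fst p)) (snd p)) \<longlonglongrightarrow> (case p of (t, x) \<Rightarrow> F t x)"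
      by (simp add: p)
  qed
qed

text \<open>Lipschitz approximations of the indicator of an open set from below. The whole space is
  a separate case because \<open>infdist\<close> to the empty complement is 0 by convention, which
  would give the zero function.\<close>

definition open_approx :: "'a::metric_space set \<Rightarrow> nat \<Rightarrow> 'a \<Rightarrow> real" where
  "open_approx U n x = (if U = UNIV then 1 else min 1 (real n * infdist x (- U)))"

lemma open_approx_bounds: "0 \<le> open_approx U n x" "open_approx U n x \<le> 1"
  by (auto simp: open_approx_def infdist_nonneg)

lemma continuous_open_approx: "continuous_on UNIV (open_approx U n)"
proof (cases "U = UNIV")
  case True
  then have "open_approx U n = (\<lambda>x. 1)" by (auto simp: open_approx_def)
  then show ?thesis by simp
next
  case False
  then have "open_approx U n = (\<lambda>x. min 1 (real n * infdist x (- U)))"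
    by (intro ext) (simp add: open_approx_def)
  then show ?thesis by (auto intro!: continuous_intros)
qed

lemma open_approx_LIMSEQ:
  assumes "open U"
  shows "(\<lambda>n. open_approx U n x) \<longlonglongrightarrow> indicator U x"
proof (cases "U = UNIV \<or> x \<notin> U")
  case True
  then have "open_approx U n x = indicator U x" for n by (auto simp: open_approx_def)
  then show ?thesis by simp
next
  case False
  then have U: "U \<noteq> UNIV" "- U \<noteq> {}" "x \<in> U" "x \<notin> - U" by auto
  have "infdist x (- U) \<noteq> 0"
    using in_closed_iff_infdist_zero[of "- U" x] U assms by auto
  then have pos: "0 < infdist x (- U)" using infdist_nonneg[of x "- U"] by linarith
  obtain N where N: "1 < real N * infdist x (- U)"
    using pos reals_Archimedean3 by blast
  have "open_approx U n x = 1" if "N \<le> n" for n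
  proof -
    have "real N * infdist x (- U) \<le> real n * infdist x (- U)"
      using that pos by (intro mult_right_mono) auto
    then show ?thesis using N U by (simp add: open_approx_def)
  qed
  then have "\<forall>\<^sub>F n in sequentially. open_approx U n x = 1"
    by (auto simp: eventually_sequentially)
  then show ?thesis using U by (simp add: tendsto_eventually)
qed

lemma measure_open_approx_LIMSEQ:
  assumes "prob_space M" "sets M = sets borel" "open U"
  shows "(\<lambda>n. \<integral>x. open_approx U n x \<partial>M) \<longlonglongrightarrow> measure M U"
proof -
  interpret prob_space M by fact
  have [measurable]: "open_approx U n \<in> borel_measurable M" for n
    using borel_measurable_continuous_onI[OF continuous_open_approx, of U n] assms(2)
    by (simp cong: measurable_cong_sets)
  have U: "U \<in> sets M" using assms by simp
  have "(\<lambda>n. \<integral>x. open_approx U n x \<partial>M) \<longlonglongrightarrow> (\<integral>x. indicator U x \<partial>M)"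
    using U open_approx_LIMSEQ[OF assms(3)]
    by (intro integral_dominated_convergence[where w="\<lambda>_. 1"])
       (auto simp: abs_le_iff open_approx_bounds intro: order_trans[OF _ open_approx_bounds(1)])
  then show ?thesis using U by simp
qed

text \<open>Open sets form an intersection-stable generator, and their measures are limits of
  integrals of continuous functions with values in \<open>[0,1]\<close>. Those integrals are the
  quantities that stochastic continuity controls.\<close>

lemma kernel_measurable_continuousI:
  assumes prob: "\<And>y. y \<in> space N \<Longrightarrow> K y \<in> space (prob_algebra borel)"
    and cont: "\<And>f :: 'a::polish_space \<Rightarrow> real. continuous_on UNIV f \<Longrightarrow> (\<And>x. 0 \<le> f x \<and> f x \<le> 1) \<Longrightarrow>
      (\<lambda>y. \<integral>x. f x \<partial>K y) \<in> borel_measurable N"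
  shows "K \<in> N \<rightarrow>\<^sub>M prob_algebra borel"
proof (rule measurable_prob_algebra_generated[where \<Omega>=UNIV and G="{U. open U}"])
  show "sets borel = sigma_sets UNIV {U::'a set. open U}" by (rule sets_borel)
  show "Int_stable {U::'a set. open U}" by (auto simp: Int_stable_def)
  show "{U::'a set. open U} \<subseteq> Pow UNIV" by auto
  fix y assume "y \<in> space N"
  from prob[OF this] show "prob_space (K y)" "sets (K y) = sets borel"
    by (auto simp: space_prob_algebra)
next
  fix U :: "'a set" assume "U \<in> {U. open U}"
  then have U: "open U" by simp
  have "(\<lambda>y. measure (K y) U) \<in> borel_measurable N"
  proof (rule borel_measurable_LIMSEQ_real)
    show "(\<lambda>y. \<integral>x. open_approx U n x \<partial>K y) \<in> borel_measurable N" for n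
      by (intro cont continuous_open_approx) (auto simp: open_approx_bounds)
    fix y assume "y \<in> space N"
    then show "(\<lambda>n. \<integral>x. open_approx U n x \<partial>K y) \<longlonglongrightarrow> measure (K y) U"
      using prob[of y] U by (intro measure_open_approx_LIMSEQ) (auto simp: space_prob_algebra)
  qed
  then have "(\<lambda>y. ennreal (measure (K y) U)) \<in> borel_measurable N" by measurable
  also have "?this \<longleftrightarrow> (\<lambda>y. emeasure (K y) U) \<in> borel_measurable N"
    using prob by (intro measurable_cong)
      (auto simp: space_prob_algebra prob_space_def finite_measure.emeasure_eq_measure)
  finally show "(\<lambda>y. emeasure (K y) U) \<in> borel_measurable N" .
qed

locale stochastically_continuous_transition = markov_transition P
  for P :: "real \<Rightarrow> 'a \<Rightarrow> 'a::polish_space measure" +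
  assumes stochastically_continuous: "stochastically_continuous P"
begin

text \<open>Split at a ball around \<open>x\<close>: inside, continuity keeps \<open>f\<close>
  within \<open>e / 2\<close> of \<open>f x\<close>; outside, the deviation is at most 1 because
  \<open>f\<close> takes values in the unit interval, and the mass there vanishes by stochastic
  continuity.\<close>

lemma kernel_tendsto_zero:
  fixes f :: "'a \<Rightarrow> real"
  assumes f: "continuous_on UNIV f" "\<And>x. 0 \<le> f x \<and> f x \<le> 1"
    and h: "\<And>n. 0 < h n" "h \<longlonglongrightarrow> 0"
  shows "(\<lambda>n. \<integral>y. f y \<partial>P (h n) x) \<longlonglongrightarrow> f x"
proof (rule LIMSEQ_I)
  fix e :: real assume e: "0 < e"
  have "isCont f x" using f(1) by (simp add: continuous_on_eq_continuous_at)
  then obtain \<gamma> where \<gamma>: "0 < \<gamma>" "\<And>y. dist y x < \<gamma> \<Longrightarrow> dist (f y) (f x) < e / 2"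
    using e unfolding continuous_at_eps_delta by (meson half_gt_zero)
  have "((\<lambda>t. measure (P t x) (ball x \<gamma>)) \<longlongrightarrow> 1) (at_right 0)"
    using stochastically_continuous \<gamma>(1) by (auto simp: stochastically_continuous_def)
  moreover have "filterlim h (at_right 0) sequentially"
    using h by (auto simp: filterlim_at intro!: always_eventually less_imp_neq[symmetric])
  ultimately have "(\<lambda>n. measure (P (h n) x) (ball x \<gamma>)) \<longlonglongrightarrow> 1"
    by (rule filterlim_compose)
  from LIMSEQ_D[OF this, of "e / 2"] e
  obtain N where N: "\<And>n. N \<le> n \<Longrightarrow> norm (measure (P (h n) x) (ball x \<gamma>) - 1) < e / 2" by auto
  have "norm ((\<integral>y. f y \<partial>P (h n) x) - f x) < e" if "N \<le> n" for n
  proof -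
    have hn: "0 \<le> h n" using h(1)[of n] by simp
    interpret Q: prob_space "P (h n) x" by (rule prob_space_kernel[OF hn])
    note [measurable_cong] = sets_kernel[OF hn, of x]
    have [measurable]: "f \<in> borel_measurable borel" by (rule borel_measurable_continuous_onI[OF f(1)])
    have fx: "\<bar>f y - f x\<bar> \<le> 1" for y using f(2)[of x] f(2)[of y] by linarith
    have i: "integrable (P (h n) x) f"
      using f(2) by (intro Q.integrable_const_bound[where B=1]) auto
    have ib: "integrable (P (h n) x) (\<lambda>y. indicator (- ball x \<gamma>) y :: real)"
      by (intro Q.integrable_const_bound[where B=1]) auto
    have "norm ((\<integral>y. f y \<partial>P (h n) x) - f x) = \<bar>\<integral>y. f y - f x \<partial>P (h n) x\<bar>"
      using i Q.prob_space by simp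
    also have "\<dots> \<le> (\<integral>y. \<bar>f y - f x\<bar> \<partial>P (h n) x)"
      using i by (intro integral_abs_bound)
    also have "\<dots> \<le> (\<integral>y. e / 2 + indicator (- ball x \<gamma>) y \<partial>P (h n) x)"
    proof (rule integral_mono)
      show "\<bar>f y - f x\<bar> \<le> e / 2 + indicator (- ball x \<gamma>) y" for y
        using \<gamma>(2)[of y] e fx[of y] by (auto simp: indicator_def dist_real_def dist_commute)
    qed (use i ib in auto)
    also have "\<dots> = e / 2 + measure (P (h n) x) (- ball x \<gamma>)"
      using ib Q.prob_space space_kernel[OF hn, of x] by simp
    also have "measure (P (h n) x) (- ball x \<gamma>) = 1 - measure (P (h n) x) (ball x \<gamma>)"
      using Q.prob_compl[of "ball x \<gamma>"] space_kernel[OF hn, of x]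
      by (simp add: sets_kernel[OF hn] Compl_eq_Diff_UNIV)
    also have "e / 2 + (1 - measure (P (h n) x) (ball x \<gamma>)) < e"
      using N[OF that] by (simp add: abs_real_def split: if_splits)
    finally show ?thesis .
  qed
  then show "\<exists>N. \<forall>n\<ge>N. norm ((\<integral>y. f y \<partial>P (h n) x) - f x) < e" by blast
qed

text \<open>Dominated convergence extends the limit at time 0 to an arbitrary initial law. With
  \<open>P t x\<close> for \<open>\<mu>\<close> this is right continuity of the semigroup at
  \<open>t\<close>, and with \<open>\<rho> s\<close> it is right continuity of a periodic measure at
  \<open>s\<close>.\<close>

lemma bind_kernel_tendsto:
  fixes f :: "'a \<Rightarrow> real"
  assumes f: "continuous_on UNIV f" "\<And>x. 0 \<le> f x \<and> f x \<le> 1"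
    and h: "\<And>n. 0 < h n" "h \<longlonglongrightarrow> 0" and \<mu>: "\<mu> \<in> space (prob_algebra borel)"
  shows "(\<lambda>n. \<integral>y. f y \<partial>(\<mu> \<bind> P (h n))) \<longlonglongrightarrow> (\<integral>y. f y \<partial>\<mu>)"
proof -
  note \<mu>' = prob_algebra_borelD[OF \<mu>]
  interpret prob_space \<mu> by fact
  note [measurable_cong] = \<mu>'(2)
  have [measurable]: "f \<in> borel_measurable borel" by (rule borel_measurable_continuous_onI[OF f(1)])
  have hn: "0 \<le> h n" for n using h(1)[of n] by simp
  have f1: "\<bar>f y\<bar> \<le> 1" for y using f(2)[of y] by simp
  have [measurable]: "P (h n) \<in> borel \<rightarrow>\<^sub>M subprob_algebra borel" for n
    by (rule measurable_prob_algebraD[OF kernel_measurable[OF hn]])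
  have "(\<integral>y. f y \<partial>(\<mu> \<bind> P (h n))) = (\<integral>x. \<integral>y. f y \<partial>P (h n) x \<partial>\<mu>)" for n
    by (rule integral_bind_prob_algebra[OF \<mu> kernel_measurable[OF hn]]) (use f1 in auto)
  moreover have "(\<lambda>n. \<integral>x. \<integral>y. f y \<partial>P (h n) x \<partial>\<mu>) \<longlonglongrightarrow> (\<integral>y. f y \<partial>\<mu>)"
  proof (rule integral_dominated_convergence[where w="\<lambda>_. 1"])
    show "AE x in \<mu>. norm (\<integral>y. f y \<partial>P (h n) x) \<le> 1" for n
      using prob_space.integral_abs_le(2)[OF prob_space_kernel[OF hn[of n]], of f _ 1] f1
      by (auto simp: measurable_cong_sets[OF sets_kernel[OF hn] refl])
  qed (use kernel_tendsto_zero[OF f h] in auto)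
  ultimately show ?thesis by simp
qed

text \<open>
  Nothing is known about \<open>P t\<close> for \<open>t < 0\<close>; replacing \<open>t\<close> by \<open>max 0 t\<close> makes the measurability
  statement meaningful on the whole real line.
\<close>

lemma kernel_pair_measurable:
  "(\<lambda>(t, x). P (max 0 t) x) \<in> borel \<Otimes>\<^sub>M borel \<rightarrow>\<^sub>M prob_algebra borel"
proof (rule kernel_measurable_continuousI)
  show "(case y of (t, x) \<Rightarrow> P (max 0 t) x) \<in> space (prob_algebra borel)" for y
    by (auto split: prod.split intro: kernel_in_prob_algebra)
next
  fix f :: "'a \<Rightarrow> real"
  assume f: "continuous_on UNIV f" "\<And>x. 0 \<le> f x \<and> f x \<le> 1"
  then have [measurable]: "f \<in> borel_measurable borel" by (intro borel_measurable_continuous_onI)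
  have "(\<lambda>(t, x). \<integral>y. f y \<partial>P (max 0 t) x) \<in> borel_measurable (borel \<Otimes>\<^sub>M borel)"
  proof (rule borel_measurable_right_continuous)
    fix t :: real
    have [measurable]: "P (max 0 t) \<in> borel \<rightarrow>\<^sub>M subprob_algebra borel"
      by (rule measurable_prob_algebraD[OF kernel_measurable]) simp
    show "(\<lambda>x. \<integral>y. f y \<partial>P (max 0 t) x) \<in> borel_measurable borel" by measurable
  next
    fix t :: real and x :: 'a and h :: "nat \<Rightarrow> real"
    assume h: "\<And>n. 0 < h n" "h \<longlonglongrightarrow> 0"
    show "(\<lambda>n. \<integral>y. f y \<partial>P (max 0 (t + h n)) x) \<longlonglongrightarrow> (\<integral>y. f y \<partial>P (max 0 t) x)"
    proof (cases "0 \<le> t")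
      case True
      have "P (t + h n) x = P t x \<bind> P (h n)" for n
        using True h(1)[of n] by (intro kernel_add) auto
      moreover have "max 0 (t + h n) = t + h n" for n using True h(1)[of n] by simp
      ultimately show ?thesis
        using bind_kernel_tendsto[OF f h kernel_in_prob_algebra[OF True]] True by simp
    next
      case False
      \<comment> \<open>At negative times the clamped kernel is \<open>P 0\<close> on a whole
        neighbourhood, so the sequence is eventually constant.\<close>
      then have "\<forall>\<^sub>F n in sequentially. h n < - t"
        using h(2) by (intro order_tendstoD) auto
      then have "\<forall>\<^sub>F n in sequentially. (\<integral>y. f y \<partial>P (max 0 (t + h n)) x) = (\<integral>y. f y \<partial>P (max 0 t) x)"
        by eventually_elim (use False in auto)
      then show ?thesis by (rule tendsto_eventually)
    qed
  qed
  then show "(\<lambda>y. \<integral>x. f x \<partial>(case y of (t, x) \<Rightarrow> P (max 0 t) x)) \<in> borel_measurable (borel \<Otimes>\<^sub>M borel)"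
    by (simp add: case_prod_beta')
qed

end

section \<open>Finite-dimensional distributions\<close>

lemma sorted_map_add:
  fixes xs :: "real list"
  shows "sorted xs \<Longrightarrow> sorted (map ((+) r) xs)"
  by (induction xs) auto

context markov_transition
begin

text \<open>
  \<open>cyl_int f s ts x\<close> is the expectation of the product of the \<open>f t (X t)\<close>, \<open>t\<close> in \<open>ts\<close>, for the
  process started in \<open>x\<close> at time \<open>s\<close>; it is meaningful for \<open>s # ts\<close> increasing.
\<close>

primrec cyl_int :: "(real \<Rightarrow> 'a \<Rightarrow> ennreal) \<Rightarrow> real \<Rightarrow> real list \<Rightarrow> 'a \<Rightarrow> ennreal" where
  "cyl_int f s [] x = 1"
| "cyl_int f s (t # ts) x = (\<integral>\<^sup>+y. f t y * cyl_int f t ts y \<partial>P (t - s) x)"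

text \<open>A law on whole paths with the right joint law at the times \<open>ts\<close>: the future
  after \<open>t\<close> is drawn from \<open>path_kernel t ts y\<close>, then coordinate
  \<open>t\<close> is overwritten by \<open>y\<close>. Coordinates outside \<open>ts\<close> keep a
  placeholder from the constant path of the empty list; \<open>fdd\<close> discards them by
  restriction.\<close>

primrec path_kernel :: "real \<Rightarrow> real list \<Rightarrow> 'a \<Rightarrow> (real \<Rightarrow> 'a) measure" where
  "path_kernel s [] x = return path_space (\<lambda>_. x)"
| "path_kernel s (t # ts) x =
     P (t - s) x \<bind> (\<lambda>y. distr (path_kernel t ts y) path_space (\<lambda>\<omega>. fun_upd \<omega> t y))"

lemma nn_integral_kernel_measurable:
  assumes "0 \<le> t" "h \<in> borel_measurable borel"
  shows "(\<lambda>x. \<integral>\<^sup>+y. h y \<partial>P t x) \<in> borel_measurable borel"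
  using measurable_compose[OF measurable_prob_algebraD[OF kernel_measurable[OF assms(1)]]
      nn_integral_measurable_subprob_algebra[OF assms(2)]] .

lemma cyl_int_measurable:
  assumes "\<And>t. f t \<in> borel_measurable borel" "sorted (s # ts)"
  shows "cyl_int f s ts \<in> borel_measurable borel"
  using assms(2)
proof (induction ts arbitrary: s)
  case Nil
  then show ?case by (simp add: measurable_const cong: measurable_cong)
next
  case (Cons t ts)
  have "sorted (t # ts)" "0 \<le> t - s" using Cons.prems by auto
  note Cons.IH[OF this(1)] nn_integral_kernel_measurable[OF this(2)]
  then show ?case using assms(1) by simp
qed

lemma nn_integral_kernel_kernel:
  assumes "0 \<le> s" "0 \<le> t" "h \<in> borel_measurable borel"
  shows "(\<integral>\<^sup>+y. \<integral>\<^sup>+z. h z \<partial>P t y \<partial>P s x) = (\<integral>\<^sup>+z. h z \<partial>P (s + t) x)"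
  unfolding kernel_add[OF assms(1,2)]
  by (rule nn_integral_bind_prob_algebra[symmetric])
     (use assms in \<open>auto intro: kernel_in_prob_algebra\<close>)

lemma nn_integral_kernel_invariant:
  assumes "invariant_measure P \<mu>" "0 \<le> t" "h \<in> borel_measurable borel"
  shows "(\<integral>\<^sup>+y. \<integral>\<^sup>+z. h z \<partial>P t y \<partial>\<mu>) = (\<integral>\<^sup>+z. h z \<partial>\<mu>)"
proof -
  have "(\<integral>\<^sup>+z. h z \<partial>(\<mu> \<bind> P t)) = (\<integral>\<^sup>+y. \<integral>\<^sup>+z. h z \<partial>P t y \<partial>\<mu>)"
    by (rule nn_integral_bind_prob_algebra[OF _ kernel_measurable])
       (use assms in \<open>auto simp: invariant_measure_def\<close>)
  then show ?thesis using invariant_measure_bind[OF assms(1,2)] by simp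
qed

text \<open>The step from \<open>r\<close> to \<open>s\<close> merges with the step from
  \<open>s\<close> to the first time of \<open>ts\<close>; for an empty list only the total mass one
  is left. This is what allows an intermediate time to be skipped.\<close>

lemma cyl_int_kernel:
  assumes f: "\<And>t. f t \<in> borel_measurable borel" and "sorted (s # ts)" "r \<le> s"
  shows "(\<integral>\<^sup>+y. cyl_int f s ts y \<partial>P (s - r) x) = cyl_int f r ts x"
proof (cases ts)
  case Nil
  then show ?thesis using prob_space.emeasure_space_1[OF prob_space_kernel] assms by simp
next
  case (Cons t ts')
  have m: "(\<lambda>z. f t z * cyl_int f t ts' z) \<in> borel_measurable borel"
    using f cyl_int_measurable[OF f, of t ts'] assms Cons by simp
  show ?thesis
    using nn_integral_kernel_kernel[OF _ _ m, of "s - r" "t - s" x] assms Cons by simp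
qed

lemma nn_integral_cyl_int_invariant:
  assumes \<mu>: "invariant_measure P \<mu>" and f: "\<And>t. f t \<in> borel_measurable borel"
    and "sorted (s # t # ts)"
  shows "(\<integral>\<^sup>+x. cyl_int f s (t # ts) x \<partial>\<mu>) = (\<integral>\<^sup>+y. f t y * cyl_int f t ts y \<partial>\<mu>)"
proof -
  have m: "(\<lambda>z. f t z * cyl_int f t ts z) \<in> borel_measurable borel"
    using f cyl_int_measurable[OF f, of t ts] assms by simp
  show ?thesis
    using nn_integral_kernel_invariant[OF \<mu> _ m, of "t - s"] assms by simp
qed

text \<open>The chain starts in equilibrium, so the step from the start to the first time of
  \<open>ts\<close> leaves \<open>\<mu>\<close> unchanged. Sets of times with different earliest
  elements become comparable in this way.\<close>

lemma nn_integral_cyl_int_start: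
  assumes \<mu>: "invariant_measure P \<mu>" and f: "\<And>t. f t \<in> borel_measurable borel"
    and "sorted (s # ts)" "sorted (r # ts)"
  shows "(\<integral>\<^sup>+x. cyl_int f s ts x \<partial>\<mu>) = (\<integral>\<^sup>+x. cyl_int f r ts x \<partial>\<mu>)"
proof (cases ts)
  case (Cons t ts')
  with assms show ?thesis
    by (simp only: nn_integral_cyl_int_invariant[OF \<mu> f])
qed simp

text \<open>At a time with trivial factor the two adjacent kernel steps merge into one. This is the
  consistency of the finite-dimensional laws.\<close>

lemma cyl_int_filter:
  assumes f: "\<And>t. f t \<in> borel_measurable borel"
    and "sorted (s # ts)" "\<And>t. t \<in> set ts \<Longrightarrow> \<not> Q t \<Longrightarrow> f t = (\<lambda>_. 1)"
  shows "cyl_int f s (filter Q ts) x = cyl_int f s ts x"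
  using assms(2,3)
proof (induction ts arbitrary: s x)
  case (Cons t ts)
  have t: "sorted (t # ts)" "s \<le> t" using Cons.prems by auto
  have IH: "cyl_int f t (filter Q ts) y = cyl_int f t ts y" for y
    using Cons.IH[OF t(1), of y] Cons.prems(2) by auto
  show ?case
  proof (cases "Q t")
    case False
    have "sorted (t # filter Q ts)"
      using t(1) by (auto intro: sorted_filter[of "\<lambda>x. x", simplified])
    from cyl_int_kernel[of f, OF f this t(2), of x] show ?thesis
      using False Cons.prems(2)[of t] IH by simp
  qed (simp add: IH)
qed simp

lemma cyl_int_shift:
  "cyl_int (\<lambda>u. f (u - r)) (r + s) (map ((+) r) ts) x = cyl_int f s ts x"
proof (induction ts arbitrary: s x)
  case (Cons t ts)
  then show ?case by simp
qed simp

lemma path_update_measurable: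
  "(\<lambda>(y, \<omega>). fun_upd \<omega> t y) \<in> borel \<Otimes>\<^sub>M path_space \<rightarrow>\<^sub>M path_space"
  unfolding case_prod_beta' by (rule measurable_fun_upd[where J=UNIV]) auto

lemma path_kernel_measurable:
  assumes "sorted (s # ts)"
  shows "path_kernel s ts \<in> borel \<rightarrow>\<^sub>M prob_algebra path_space"
  using assms
proof (induction ts arbitrary: s)
  case Nil
  have "(\<lambda>x. return path_space (\<lambda>_::real. x)) \<in> borel \<rightarrow>\<^sub>M prob_algebra path_space"
    by (rule measurable_compose[OF _ measurable_return_prob_space], rule measurable_PiM_single') auto
  then show ?case by (simp cong: measurable_cong)
next
  case (Cons t ts)
  have t: "sorted (t # ts)" "0 \<le> t - s" using Cons.prems by auto
  have "(\<lambda>y. distr (path_kernel t ts y) path_space (\<lambda>\<omega>. fun_upd \<omega> t y)) \<in> borel \<rightarrow>\<^sub>M prob_algebra path_space"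
    by (rule measurable_distr_prob_space2[OF Cons.IH[OF t(1)]]) (rule path_update_measurable)
  from measurable_bind_prob_space[OF kernel_measurable[OF t(2)] this] show ?case
    by simp
qed

lemma nn_integral_path_kernel:
  assumes f[measurable]: "\<And>t. f t \<in> borel_measurable borel" and "sorted (s # ts)" "distinct ts"
  shows "(\<integral>\<^sup>+\<omega>. (\<Prod>t\<in>set ts. f t (\<omega> t)) \<partial>path_kernel s ts x) = cyl_int f s ts x"
  using assms(2,3)
proof (induction ts arbitrary: s x)
  case Nil
  have "(\<lambda>_. x) \<in> space (path_space :: (real \<Rightarrow> 'a) measure)" by (simp add: space_PiM)
  then show ?case by (simp add: nn_integral_return)
next
  case (Cons t ts)
  have t: "sorted (t # ts)" "0 \<le> t - s" and d: "distinct ts" "t \<notin> set ts" using Cons.prems by auto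
  have K: "(\<lambda>y. distr (path_kernel t ts y) path_space (\<lambda>\<omega>. fun_upd \<omega> t y)) \<in> borel \<rightarrow>\<^sub>M prob_algebra path_space"
    by (rule measurable_distr_prob_space2[OF path_kernel_measurable[OF t(1)]])
       (rule path_update_measurable)
  have "(\<integral>\<^sup>+\<omega>. (\<Prod>u\<in>set (t # ts). f u (\<omega> u)) \<partial>path_kernel s (t # ts) x) =
    (\<integral>\<^sup>+y. \<integral>\<^sup>+\<omega>. (\<Prod>u\<in>set (t # ts). f u (\<omega> u))
      \<partial>distr (path_kernel t ts y) path_space (\<lambda>\<omega>. fun_upd \<omega> t y) \<partial>P (t - s) x)"
    unfolding path_kernel.simps
    by (rule nn_integral_bind_prob_algebra[OF kernel_in_prob_algebra[OF t(2)] K]) measurable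
  also have "\<dots> = (\<integral>\<^sup>+y. f t y * cyl_int f t ts y \<partial>P (t - s) x)"
  proof (rule nn_integral_cong)
    fix y
    have sets: "sets (path_kernel t ts y) = sets path_space"
      using measurable_space[OF path_kernel_measurable[OF t(1)], of y] by (simp add: space_prob_algebra)
    note [measurable_cong] = sets
    have upd: "(\<lambda>\<omega>. fun_upd \<omega> t y) \<in> path_kernel t ts y \<rightarrow>\<^sub>M path_space"
    proof -
      have "(\<lambda>\<omega>. fun_upd \<omega> t y) \<in> path_space \<rightarrow>\<^sub>M path_space"
        by (rule measurable_fun_upd[where J=UNIV]) auto
      then show ?thesis using sets by (simp cong: measurable_cong_sets)
    qed
    have "(\<integral>\<^sup>+\<omega>. (\<Prod>u\<in>set (t # ts). f u (\<omega> u)) \<partial>distr (path_kernel t ts y) path_space (\<lambda>\<omega>. fun_upd \<omega> t y))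
      = (\<integral>\<^sup>+\<omega>. (\<Prod>u\<in>set (t # ts). f u (fun_upd \<omega> t y u)) \<partial>path_kernel t ts y)"
      by (rule nn_integral_distr[OF upd]) measurable
    also have "\<dots> = (\<integral>\<^sup>+\<omega>. f t y * (\<Prod>u\<in>set ts. f u (\<omega> u)) \<partial>path_kernel t ts y)"
    proof (rule nn_integral_cong)
      fix \<omega>
      \<comment> \<open>By distinctness \<open>t\<close> does not occur in \<open>ts\<close>, so
        overwriting coordinate \<open>t\<close> leaves the later factors alone.\<close>
      have "(\<Prod>u\<in>set ts. f u (fun_upd \<omega> t y u)) = (\<Prod>u\<in>set ts. f u (\<omega> u))"
        by (rule prod.cong) (use d in auto)
      then show "(\<Prod>u\<in>set (t # ts). f u (fun_upd \<omega> t y u)) = f t y * (\<Prod>u\<in>set ts. f u (\<omega> u))"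
        using d by simp
    qed
    also have "\<dots> = f t y * (\<integral>\<^sup>+\<omega>. (\<Prod>u\<in>set ts. f u (\<omega> u)) \<partial>path_kernel t ts y)"
      by (rule nn_integral_cmult) measurable
    finally show "(\<integral>\<^sup>+\<omega>. (\<Prod>u\<in>set (t # ts). f u (\<omega> u)) \<partial>distr (path_kernel t ts y) path_space (\<lambda>\<omega>. fun_upd \<omega> t y))
      = f t y * cyl_int f t ts y"
      by (simp only: Cons.IH[OF t(1) d(1)])
  qed
  finally show ?case by simp
qed

text \<open>Since \<open>Min {}\<close> is unspecified, the empty set of times gets the arbitrary
  start 0, so that \<open>sorted_start\<close> holds for every finite set.\<close>

definition start :: "real set \<Rightarrow> real" where
  "start J = (if J = {} then 0 else Min J)"

definition fdd :: "'a measure \<Rightarrow> real set \<Rightarrow> (real \<Rightarrow> 'a) measure" where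
  "fdd \<mu> J = distr (\<mu> \<bind> path_kernel (start J) (sorted_list_of_set J)) (Pi\<^sub>M J (\<lambda>_. borel))
     (\<lambda>\<omega>. restrict \<omega> J)"

lemma sorted_start: "finite J \<Longrightarrow> sorted (start J # sorted_list_of_set J)"
  by (auto simp: start_def)

lemma
  assumes \<mu>: "\<mu> \<in> space (prob_algebra borel)" and J: "finite J"
  shows prob_space_fdd: "prob_space (fdd \<mu> J)"
    and sets_fdd: "sets (fdd \<mu> J) = sets (Pi\<^sub>M J (\<lambda>_. borel))"
    and nn_integral_fdd: "(\<And>t. f t \<in> borel_measurable borel) \<Longrightarrow>
      (\<integral>\<^sup>+\<omega>. (\<Prod>t\<in>J. f t (\<omega> t)) \<partial>fdd \<mu> J)
      = (\<integral>\<^sup>+x. cyl_int f (start J) (sorted_list_of_set J) x \<partial>\<mu>)"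
proof -
  let ?K = "path_kernel (start J) (sorted_list_of_set J)"
  note K = path_kernel_measurable[OF sorted_start[OF J]]
  have [measurable_cong]: "sets (\<mu> \<bind> ?K) = sets path_space" by (rule sets_bind'[OF \<mu> K])
  interpret prob_space "\<mu> \<bind> ?K" by (rule prob_space_bind'[OF \<mu> K])
  have r: "(\<lambda>\<omega>. restrict \<omega> J) \<in> (\<mu> \<bind> ?K) \<rightarrow>\<^sub>M Pi\<^sub>M J (\<lambda>_. borel)"
    by (rule measurable_restrict) measurable
  show "prob_space (fdd \<mu> J)" unfolding fdd_def by (rule prob_space_distr[OF r])
  show "sets (fdd \<mu> J) = sets (Pi\<^sub>M J (\<lambda>_. borel))" by (simp add: fdd_def)
  assume f[measurable]: "\<And>t. f t \<in> borel_measurable borel"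
  have "(\<integral>\<^sup>+\<omega>. (\<Prod>t\<in>J. f t (\<omega> t)) \<partial>fdd \<mu> J)
    = (\<integral>\<^sup>+\<omega>. (\<Prod>t\<in>J. f t (restrict \<omega> J t)) \<partial>(\<mu> \<bind> ?K))"
    unfolding fdd_def by (rule nn_integral_distr[OF r]) measurable
  also have "\<dots> = (\<integral>\<^sup>+\<omega>. (\<Prod>t\<in>set (sorted_list_of_set J). f t (\<omega> t)) \<partial>(\<mu> \<bind> ?K))"
    using J by (intro nn_integral_cong prod.cong) auto
  also have "\<dots> = (\<integral>\<^sup>+x. \<integral>\<^sup>+\<omega>. (\<Prod>t\<in>set (sorted_list_of_set J). f t (\<omega> t)) \<partial>?K x \<partial>\<mu>)"
    by (rule nn_integral_bind_prob_algebra[OF \<mu> K]) measurable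
  also have "\<dots> = (\<integral>\<^sup>+x. cyl_int f (start J) (sorted_list_of_set J) x \<partial>\<mu>)"
    by (intro nn_integral_cong nn_integral_path_kernel sorted_start J f) auto
  finally show "(\<integral>\<^sup>+\<omega>. (\<Prod>t\<in>J. f t (\<omega> t)) \<partial>fdd \<mu> J)
      = (\<integral>\<^sup>+x. cyl_int f (start J) (sorted_list_of_set J) x \<partial>\<mu>)" .
qed

text \<open>Boxes determine both measures. On a box over \<open>J\<close> the factors at the times
  in \<open>H - J\<close> are constantly 1, so \<open>cyl_int_filter\<close> removes them, and
  invariance of \<open>\<mu>\<close> absorbs the possibly earlier start of \<open>H\<close>.\<close>

lemma fdd_projective:
  assumes \<mu>: "invariant_measure P \<mu>" and JH: "J \<subseteq> H" and H: "finite H"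
  shows "fdd \<mu> J = distr (fdd \<mu> H) (Pi\<^sub>M J (\<lambda>_. borel)) (\<lambda>\<omega>. restrict \<omega> J)"
proof (rule measure_eqI_PiM_finite)
  have \<mu>': "\<mu> \<in> space (prob_algebra borel)" using \<mu> by (simp add: invariant_measure_def)
  show J: "finite J" using JH H by (rule finite_subset)
  note [measurable_cong] = sets_fdd[OF \<mu>' H]
  interpret J: prob_space "fdd \<mu> J" by (rule prob_space_fdd[OF \<mu>' J])
  show "sets (fdd \<mu> J) = sets (Pi\<^sub>M J (\<lambda>_. borel))" by (rule sets_fdd[OF \<mu>' J])
  show "sets (distr (fdd \<mu> H) (Pi\<^sub>M J (\<lambda>_. borel)) (\<lambda>\<omega>. restrict \<omega> J)) = sets (Pi\<^sub>M J (\<lambda>_. borel))"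
    by simp
  show "range (\<lambda>_::nat. space (Pi\<^sub>M J (\<lambda>_. borel :: 'a measure))) \<subseteq> prod_algebra J (\<lambda>_. borel)"
    using prod_algebraI_finite[OF J, of "\<lambda>_. UNIV" "\<lambda>_. borel :: 'a measure"]
    by (simp add: space_PiM)
  show "(\<Union>i::nat. space (Pi\<^sub>M J (\<lambda>_. borel))) = space (Pi\<^sub>M J (\<lambda>_. borel :: 'a measure))" by simp
  show "emeasure (fdd \<mu> J) (space (Pi\<^sub>M J (\<lambda>_. borel))) \<noteq> \<infinity>" for i :: nat
    by simp
  fix A :: "real \<Rightarrow> 'a set" assume A: "\<And>i. i \<in> J \<Longrightarrow> A i \<in> sets borel"
  define f where "f t = (if t \<in> J then indicator (A t) else (\<lambda>_. 1 :: ennreal))" for t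
  have f: "f t \<in> borel_measurable borel" for t using A by (auto simp: f_def)
  have r: "(\<lambda>\<omega>. restrict \<omega> J) \<in> fdd \<mu> H \<rightarrow>\<^sub>M Pi\<^sub>M J (\<lambda>_. borel)"
    using JH by (intro measurable_restrict) (auto intro: measurable_component_singleton)
  have AJ: "Pi\<^sub>E J A \<in> sets (Pi\<^sub>M J (\<lambda>_. borel))" using A J by (intro sets_PiM_I_finite) auto
  have f_J: "(\<Prod>t\<in>J. f t (\<omega> t)) = indicator (Pi\<^sub>E J A) \<omega>" if ext: "\<omega> \<in> extensional J" for \<omega>
  proof (cases "\<omega> \<in> Pi\<^sub>E J A")
    case False
    then obtain t where "t \<in> J" "\<omega> t \<notin> A t" using ext by (auto simp: PiE_iff)
    then have "f t (\<omega> t) = 0" by (simp add: f_def)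
    with \<open>t \<in> J\<close> J have "(\<Prod>t\<in>J. f t (\<omega> t)) = 0" by (auto intro: prod_zero)
    with False show ?thesis by simp
  next
    case True
    then have "(\<Prod>t\<in>J. f t (\<omega> t)) = 1" by (intro prod.neutral) (auto simp: f_def PiE_iff)
    with True show ?thesis by simp
  qed
  have "emeasure (fdd \<mu> J) (Pi\<^sub>E J A) = (\<integral>\<^sup>+\<omega>. indicator (Pi\<^sub>E J A) \<omega> \<partial>fdd \<mu> J)"
    using AJ sets_fdd[OF \<mu>' J] by simp
  also have "\<dots> = (\<integral>\<^sup>+\<omega>. (\<Prod>t\<in>J. f t (\<omega> t)) \<partial>fdd \<mu> J)"
    using sets_eq_imp_space_eq[OF sets_fdd[OF \<mu>' J]]
    by (intro nn_integral_cong f_J[symmetric]) (auto simp: space_PiM PiE_def)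
  also have "\<dots> = (\<integral>\<^sup>+x. cyl_int f (start J) (sorted_list_of_set J) x \<partial>\<mu>)"
    by (rule nn_integral_fdd[OF \<mu>' J f])
  also have "\<dots> = (\<integral>\<^sup>+x. cyl_int f (start H) (sorted_list_of_set J) x \<partial>\<mu>)"
  proof (rule nn_integral_cyl_int_start[OF \<mu> f sorted_start[OF J]])
    show "sorted (start H # sorted_list_of_set J)"
      using J H JH by (auto simp: start_def)
  qed
  also have "sorted_list_of_set J = filter (\<lambda>t. t \<in> J) (sorted_list_of_set H)"
    using J H JH by (intro sorted_distinct_set_unique sorted_filter[of "\<lambda>x. x", simplified]) auto
  also have "cyl_int f (start H) (filter (\<lambda>t. t \<in> J) (sorted_list_of_set H)) = cyl_int f (start H) (sorted_list_of_set H)"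
    by (intro ext cyl_int_filter[OF f sorted_start[OF H]]) (simp add: f_def)
  also have "(\<integral>\<^sup>+x. cyl_int f (start H) (sorted_list_of_set H) x \<partial>\<mu>) = (\<integral>\<^sup>+\<omega>. (\<Prod>t\<in>H. f t (\<omega> t)) \<partial>fdd \<mu> H)"
    by (rule nn_integral_fdd[OF \<mu>' H f, symmetric])
  also have "\<dots> = (\<integral>\<^sup>+\<omega>. indicator (Pi\<^sub>E J A) (restrict \<omega> J) \<partial>fdd \<mu> H)"
  proof (rule nn_integral_cong)
    fix \<omega>
    have "(\<Prod>t\<in>H. f t (\<omega> t)) = (\<Prod>t\<in>J. f t (\<omega> t))"
      using H JH by (intro prod.mono_neutral_right) (auto simp: f_def)
    also have "\<dots> = (\<Prod>t\<in>J. f t (restrict \<omega> J t))" by (rule prod.cong) auto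
    also have "\<dots> = indicator (Pi\<^sub>E J A) (restrict \<omega> J)" by (rule f_J) (rule restrict_extensional)
    finally show "(\<Prod>t\<in>H. f t (\<omega> t)) = indicator (Pi\<^sub>E J A) (restrict \<omega> J)" .
  qed
  also have "\<dots> = emeasure (distr (fdd \<mu> H) (Pi\<^sub>M J (\<lambda>_. borel)) (\<lambda>\<omega>. restrict \<omega> J)) (Pi\<^sub>E J A)"
    using AJ r by (subst nn_integral_distr[OF r, symmetric]) auto
  finally show "emeasure (fdd \<mu> J) (Pi\<^sub>E J A)
    = emeasure (distr (fdd \<mu> H) (Pi\<^sub>M J (\<lambda>_. borel)) (\<lambda>\<omega>. restrict \<omega> J)) (Pi\<^sub>E J A)" .
qed

text \<open>Kolmogorov extension for Polish-valued projective families. The identity is recorded for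
  products of functions instead of boxes, so that a kernel can later be inserted as a factor, and
  for every start not after \<open>J\<close>, so that one start serves several sets of
  times.\<close>

lemma ex_path_law:
  assumes \<mu>: "invariant_measure P \<mu>"
  shows "\<exists>M. M \<in> space (prob_algebra path_space) \<and>
    (\<forall>J f s. finite J \<longrightarrow> (\<forall>t. f t \<in> borel_measurable borel) \<longrightarrow> sorted (s # sorted_list_of_set J) \<longrightarrow>
      (\<integral>\<^sup>+\<omega>. (\<Prod>t\<in>J. f t (\<omega> t)) \<partial>M) = (\<integral>\<^sup>+x. cyl_int f s (sorted_list_of_set J) x \<partial>\<mu>))"
proof -
  have \<mu>': "\<mu> \<in> space (prob_algebra borel)" using \<mu> by (simp add: invariant_measure_def)
  interpret polish_projective UNIV "fdd \<mu>"
  proof (rule polish_projective.intro, rule projective_family.intro)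
    fix J H :: "real set" assume "J \<subseteq> H" "finite H"
    then show "fdd \<mu> J = distr (fdd \<mu> H) (Pi\<^sub>M J (\<lambda>_. borel)) (\<lambda>f. restrict f J)"
      by (rule fdd_projective[OF \<mu>])
  qed (rule prob_space_fdd[OF \<mu>'])
  have sl[measurable_cong]: "sets lim = sets path_space" by simp
  have "(\<integral>\<^sup>+\<omega>. (\<Prod>t\<in>J. f t (\<omega> t)) \<partial>lim) = (\<integral>\<^sup>+x. cyl_int f s (sorted_list_of_set J) x \<partial>\<mu>)"
    if J: "finite J" and f[measurable]: "\<And>t. f t \<in> borel_measurable borel" and s: "sorted (s # sorted_list_of_set J)"
    for J f s
  proof -
    have r: "(\<lambda>\<omega>. restrict \<omega> J) \<in> lim \<rightarrow>\<^sub>M Pi\<^sub>M J (\<lambda>_. borel)"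
      by (rule measurable_restrict) measurable
    have *: "fdd \<mu> J = distr lim (Pi\<^sub>M J (\<lambda>_. borel)) (\<lambda>\<omega>. restrict \<omega> J)"
    proof (rule measure_eqI)
      show "sets (fdd \<mu> J) = sets (distr lim (Pi\<^sub>M J (\<lambda>_. borel)) (\<lambda>\<omega>. restrict \<omega> J))"
        using sets_fdd[OF \<mu>' J] by simp
      fix X assume "X \<in> sets (fdd \<mu> J)"
      then have X: "X \<in> sets (Pi\<^sub>M J (\<lambda>_. borel))" using sets_fdd[OF \<mu>' J] by simp
      have "emeasure (distr lim (Pi\<^sub>M J (\<lambda>_. borel)) (\<lambda>\<omega>. restrict \<omega> J)) X = emeasure lim ((\<lambda>\<omega>. restrict \<omega> J) -` X \<inter> space lim)"
        by (rule emeasure_distr[OF r X])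
      also have "(\<lambda>\<omega>. restrict \<omega> J) -` X \<inter> space lim = emb UNIV J X"
        using sets_eq_imp_space_eq[OF sl] by (auto simp: prod_emb_def space_PiM)
      also have "emeasure lim \<dots> = emeasure (fdd \<mu> J) X"
        by (rule emeasure_lim_emb) (use J X in auto)
      finally show "emeasure (fdd \<mu> J) X = emeasure (distr lim (Pi\<^sub>M J (\<lambda>_. borel)) (\<lambda>\<omega>. restrict \<omega> J)) X" by (rule sym)
    qed
    have "(\<integral>\<^sup>+\<omega>. (\<Prod>t\<in>J. f t (\<omega> t)) \<partial>lim) = (\<integral>\<^sup>+\<omega>. (\<Prod>t\<in>J. f t (restrict \<omega> J t)) \<partial>lim)"
      by (intro nn_integral_cong prod.cong) auto
    also have "\<dots> = (\<integral>\<^sup>+\<omega>. (\<Prod>t\<in>J. f t (\<omega> t)) \<partial>fdd \<mu> J)"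
      unfolding * by (rule nn_integral_distr[OF r, symmetric]) measurable
    also have "\<dots> = (\<integral>\<^sup>+x. cyl_int f (start J) (sorted_list_of_set J) x \<partial>\<mu>)"
      by (rule nn_integral_fdd[OF \<mu>' J f])
    also have "\<dots> = (\<integral>\<^sup>+x. cyl_int f s (sorted_list_of_set J) x \<partial>\<mu>)"
      by (rule nn_integral_cyl_int_start[OF \<mu> f sorted_start[OF J] s])
    finally show ?thesis .
  qed
  moreover have "lim \<in> space (prob_algebra path_space)"
    using sl P.prob_space_axioms by (simp add: space_prob_algebra)
  ultimately show ?thesis by blast
qed

end

section \<open>The law of the stationary Markov process\<close>

definition cylinder :: "real set \<Rightarrow> (real \<Rightarrow> 'a set) \<Rightarrow> (real \<Rightarrow> 'a) set" where
  "cylinder J A = {\<omega>. \<forall>t\<in>J. \<omega> t \<in> A t}"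

text \<open>The time set \<open>S\<close> lets one family generate two kinds of \<sigma>-algebras:
  all of \<open>path_space\<close> for \<open>UNIV\<close>, and \<open>past s\<close> for
  \<open>{..s}\<close>. Open bases are the ones that \<open>open_approx\<close> can reach.\<close>

definition open_cylinders :: "real set \<Rightarrow> (real \<Rightarrow> 'a::topological_space) set set" where
  "open_cylinders S = {cylinder J A | J A. finite J \<and> J \<subseteq> S \<and> (\<forall>t. open (A t))}"

lemma cylinder_Int:
  "cylinder J A \<inter> cylinder K B
   = cylinder (J \<union> K) (\<lambda>t. (if t \<in> J then A t else UNIV) \<inter> (if t \<in> K then B t else UNIV))"
  by (auto simp: cylinder_def split: if_splits)

lemma Int_stable_open_cylinders: "Int_stable (open_cylinders S)"
proof (rule Int_stableI)
  fix a b :: "(real \<Rightarrow> 'a) set" assume "a \<in> open_cylinders S" "b \<in> open_cylinders S"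
  then obtain J A K B where "a = cylinder J A" "finite J" "J \<subseteq> S" "\<forall>t. open (A t)"
    "b = cylinder K B" "finite K" "K \<subseteq> S" "\<forall>t. open (B t)"
    unfolding open_cylinders_def by blast
  then show "a \<inter> b \<in> open_cylinders S"
    unfolding open_cylinders_def
    by (intro CollectI exI[of _ "J \<union> K"]
        exI[of _ "\<lambda>t. (if t \<in> J then A t else UNIV) \<inter> (if t \<in> K then B t else UNIV)"])
       (simp add: cylinder_Int open_Int)
qed

lemma sigma_sets_open_cylinders:
  "sigma_sets UNIV {{\<omega>. \<omega> r \<in> \<Gamma>} | r \<Gamma>. r \<in> S \<and> \<Gamma> \<in> sets borel}
   = sigma_sets UNIV (open_cylinders S :: (real \<Rightarrow> 'a::topological_space) set set)" (is "?L = ?R")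
proof
  let ?C = "sigma UNIV (open_cylinders S :: (real \<Rightarrow> 'a) set set)"
  let ?D = "sigma UNIV {{\<omega>. \<omega> r \<in> \<Gamma>} | r \<Gamma>. r \<in> S \<and> \<Gamma> \<in> sets (borel :: 'a measure)}"
  show "?L \<subseteq> ?R"
  proof (rule sigma_sets_mono)
    have "{\<omega>. \<omega> r \<in> \<Gamma>} \<in> ?R" if r: "r \<in> S" and \<Gamma>: "\<Gamma> \<in> sets borel" for r and \<Gamma> :: "'a set"
    proof -
      have "(\<lambda>\<omega>. \<omega> r) \<in> ?C \<rightarrow>\<^sub>M borel"
      proof (rule borel_measurableI)
        fix U :: "'a set" assume "open U"
        then have "cylinder {r} (\<lambda>_. U) \<in> open_cylinders S"
          using r unfolding open_cylinders_def by blast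
        then have "cylinder {r} (\<lambda>_. U) \<in> sets ?C" by simp
        then show "(\<lambda>\<omega>. \<omega> r) -` U \<inter> space ?C \<in> sets ?C"
          by (simp add: cylinder_def vimage_def)
      qed
      from measurable_sets[OF this \<Gamma>] show ?thesis by (simp add: vimage_def)
    qed
    then show "{{\<omega>. \<omega> r \<in> \<Gamma>} | r \<Gamma>. r \<in> S \<and> \<Gamma> \<in> sets borel} \<subseteq> ?R" by auto
  qed
  show "?R \<subseteq> ?L"
  proof (rule sigma_sets_mono)
    have "cylinder J A \<in> ?L" if J: "finite J" "J \<subseteq> S" and A: "\<And>t. open (A t)" for J and A :: "real \<Rightarrow> 'a set"
    proof -
      have eq: "cylinder J A = space ?D \<inter> (\<Inter>t\<in>J. {\<omega>. \<omega> t \<in> A t})" by (auto simp: cylinder_def)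
      have "{\<omega>. \<omega> t \<in> A t} \<in> sets ?D" if "t \<in> J" for t
      proof -
        have "{\<omega>. \<omega> t \<in> A t} \<in> {{\<omega>. \<omega> r \<in> \<Gamma>} | r \<Gamma>. r \<in> S \<and> \<Gamma> \<in> sets borel}"
          using that J A by (intro CollectI exI[of _ t] exI[of _ "A t"]) auto
        then show ?thesis by simp
      qed
      then have "space ?D \<inter> (\<Inter>t\<in>J. {\<omega>. \<omega> t \<in> A t}) \<in> sets ?D" if "J \<noteq> {}"
        using that J(1) by (intro sets.Int sets.top sets.finite_INT)
      then have "cylinder J A \<in> sets ?D"
        unfolding eq by (cases "J = {}") (simp_all only: INT_empty Int_UNIV_right sets.top simp_thms)
      then show ?thesis by simp
    qed
    then show "open_cylinders S \<subseteq> ?L" unfolding open_cylinders_def by auto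
  qed
qed

lemma sets_path_space:
  "sets (path_space :: (real \<Rightarrow> 'a::polish_space) measure) = sigma_sets UNIV (open_cylinders UNIV)"
  unfolding sigma_sets_open_cylinders[symmetric]
  by (subst sets_PiM_single) (auto intro!: arg_cong2[where f=sigma_sets] simp: PiE_UNIV_domain)

lemma sets_past:
  "sets (past s :: (real \<Rightarrow> 'a::polish_space) measure) = sigma_sets UNIV (open_cylinders {..s})"
  unfolding sigma_sets_open_cylinders[symmetric] past_def
  by (subst sets_measure_of) auto

lemma space_path_space: "space (path_space :: (real \<Rightarrow> 'a::polish_space) measure) = UNIV"
  by (simp add: space_PiM PiE_UNIV_domain)

lemma space_past: "space (past s) = UNIV"
  by (simp add: past_def space_measure_of_conv)

lemma coordinate_past_measurable: "r \<le> s \<Longrightarrow> (\<lambda>\<omega>. \<omega> r) \<in> past s \<rightarrow>\<^sub>M borel"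
proof (rule measurableI)
  fix \<Gamma> :: "'a set" assume "r \<le> s" "\<Gamma> \<in> sets borel"
  then have "{\<omega>. \<omega> r \<in> \<Gamma>} \<in> {{\<omega>. \<omega> r \<in> \<Gamma>} | r \<Gamma>. r \<le> s \<and> \<Gamma> \<in> sets borel}" by blast
  then show "(\<lambda>\<omega>. \<omega> r) -` \<Gamma> \<inter> space (past s) \<in> sets (past s)"
    unfolding past_def by (simp add: vimage_def space_measure_of_conv)
qed simp

lemma cylinder_sets:
  assumes "finite J" "\<And>t. A t \<in> sets borel"
  shows "cylinder J A \<in> sets (path_space :: (real \<Rightarrow> 'a::polish_space) measure)"
proof -
  have [measurable]: "A t \<in> sets borel" for t by fact
  have "{\<omega> \<in> space path_space. \<forall>t\<in>J. \<omega> t \<in> A t} \<in> sets path_space"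
    using assms(1) by measurable
  then show ?thesis by (simp add: cylinder_def space_path_space)
qed

lemma sets_past_mono: "s \<le> t \<Longrightarrow> sets (past s) \<subseteq> sets (past t)"
  unfolding sets_past by (rule sigma_sets_mono') (force simp: open_cylinders_def)

lemma sets_past_path_space: "sets (past s) \<subseteq> sets path_space"
  unfolding sets_past sets_path_space by (rule sigma_sets_mono') (force simp: open_cylinders_def)

lemma path_shift_measurable[measurable]: "path_shift t \<in> path_space \<rightarrow>\<^sub>M path_space"
  unfolding path_shift_def by (rule measurable_PiM_single') (auto simp: space_PiM)

lemma prob_measure_eqI_open_cylinders:
  fixes M N :: "(real \<Rightarrow> 'a::polish_space) measure"
  assumes M: "M \<in> space (prob_algebra path_space)" and N: "N \<in> space (prob_algebra path_space)"
    and eq: "\<And>J A. finite J \<Longrightarrow> (\<And>t. open (A t)) \<Longrightarrow> emeasure M (cylinder J A) = emeasure N (cylinder J A)"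
  shows "M = N"
proof (rule measure_eqI_generator_eq[OF Int_stable_open_cylinders])
  interpret M: prob_space M using M by (simp add: space_prob_algebra)
  show "open_cylinders UNIV \<subseteq> Pow UNIV" by simp
  show "emeasure M X = emeasure N X" if "X \<in> open_cylinders UNIV" for X
    using that eq unfolding open_cylinders_def by blast
  show "sets M = sigma_sets UNIV (open_cylinders UNIV)" "sets N = sigma_sets UNIV (open_cylinders UNIV)"
    using M N sets_path_space by (auto simp: space_prob_algebra)
  have "UNIV = cylinder {} (\<lambda>_. UNIV)" by (simp add: cylinder_def)
  then show "range (\<lambda>_::nat. UNIV) \<subseteq> (open_cylinders UNIV :: (real \<Rightarrow> 'a) set set)"
    unfolding open_cylinders_def by blast
  show "(\<Union>i::nat. UNIV) = UNIV" by simp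
  show "emeasure M UNIV \<noteq> \<infinity>" for i :: nat by simp
qed

lemma prod_indicator_cylinder:
  assumes "finite J"
  shows "(\<Prod>t\<in>J. indicator (A t) (\<omega> t)) = (indicator (cylinder J A) \<omega> :: ennreal)"
proof (cases "\<omega> \<in> cylinder J A")
  case True
  then have "(\<Prod>t\<in>J. indicator (A t) (\<omega> t)) = (1 :: ennreal)"
    by (intro prod.neutral) (auto simp: cylinder_def)
  with True show ?thesis by simp
next
  case False
  then obtain t where "t \<in> J" "\<omega> t \<notin> A t" by (auto simp: cylinder_def)
  with assms have "(\<Prod>t\<in>J. indicator (A t) (\<omega> t)) = (0 :: ennreal)"
    by (intro prod_zero bexI[of _ t]) auto
  with False show ?thesis by simp
qed

context markov_transition
begin

definition path_law :: "'a measure \<Rightarrow> (real \<Rightarrow> 'a) measure" where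
  "path_law \<mu> = (SOME M. M \<in> space (prob_algebra path_space) \<and>
    (\<forall>J f s. finite J \<longrightarrow> (\<forall>t. f t \<in> borel_measurable borel) \<longrightarrow> sorted (s # sorted_list_of_set J) \<longrightarrow>
      (\<integral>\<^sup>+\<omega>. (\<Prod>t\<in>J. f t (\<omega> t)) \<partial>M) = (\<integral>\<^sup>+x. cyl_int f s (sorted_list_of_set J) x \<partial>\<mu>)))"

lemma
  assumes "invariant_measure P \<mu>"
  shows path_law_in_prob_algebra: "path_law \<mu> \<in> space (prob_algebra path_space)"
    and nn_integral_path_law:
      "finite J \<Longrightarrow> (\<And>t. f t \<in> borel_measurable borel) \<Longrightarrow> sorted (s # sorted_list_of_set J) \<Longrightarrow>
       (\<integral>\<^sup>+\<omega>. (\<Prod>t\<in>J. f t (\<omega> t)) \<partial>path_law \<mu>) = (\<integral>\<^sup>+x. cyl_int f s (sorted_list_of_set J) x \<partial>\<mu>)"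
  using someI_ex[OF ex_path_law[OF assms]] unfolding path_law_def[symmetric] by blast+

lemma emeasure_path_law_cylinder:
  assumes \<mu>: "invariant_measure P \<mu>" and J: "finite J" and A: "\<And>t. A t \<in> sets borel"
    and s: "sorted (s # sorted_list_of_set J)"
  shows "emeasure (path_law \<mu>) (cylinder J A) = (\<integral>\<^sup>+x. cyl_int (\<lambda>t. indicator (A t)) s (sorted_list_of_set J) x \<partial>\<mu>)"
proof -
  have "cylinder J A \<in> sets (path_law \<mu>)"
    using cylinder_sets[OF J A] path_law_in_prob_algebra[OF \<mu>] by (simp add: space_prob_algebra)
  then have "emeasure (path_law \<mu>) (cylinder J A) = (\<integral>\<^sup>+\<omega>. indicator (cylinder J A) \<omega> \<partial>path_law \<mu>)"
    by simp
  also have "\<dots> = (\<integral>\<^sup>+\<omega>. (\<Prod>t\<in>J. indicator (A t) (\<omega> t)) \<partial>path_law \<mu>)"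
    by (simp add: prod_indicator_cylinder[OF J])
  also have "\<dots> = (\<integral>\<^sup>+x. cyl_int (\<lambda>t. indicator (A t)) s (sorted_list_of_set J) x \<partial>\<mu>)"
    by (rule nn_integral_path_law[OF \<mu> J _ s]) (use A in auto)
  finally show ?thesis .
qed

text \<open>\<open>cyl_int\<close> depends on time differences only, so translating the start and
  all times together changes no cylinder probability.\<close>

lemma path_law_shift:
  assumes \<mu>: "invariant_measure P \<mu>"
  shows "distr (path_law \<mu>) path_space (path_shift r) = path_law \<mu>"
proof (rule prob_measure_eqI_open_cylinders)
  note L = path_law_in_prob_algebra[OF \<mu>]
  then have [measurable_cong]: "sets (path_law \<mu>) = sets path_space" by (simp add: space_prob_algebra)
  interpret prob_space "path_law \<mu>" using L by (simp add: space_prob_algebra)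
  show "path_law \<mu> \<in> space (prob_algebra path_space)" by (rule L)
  show "distr (path_law \<mu>) path_space (path_shift r) \<in> space (prob_algebra path_space)"
    by (auto simp: space_prob_algebra intro!: prob_space_distr)
  fix J :: "real set" and A :: "real \<Rightarrow> 'a set" assume J: "finite J" and A: "\<And>t. open (A t)"
  then have A': "A t \<in> sets borel" for t by simp
  define s where "s = start J"
  have s: "sorted (s # sorted_list_of_set J)" unfolding s_def by (rule sorted_start[OF J])
  have smap: "sorted (map ((+) r) (sorted_list_of_set J))"
    by (rule sorted_map_add[OF sorted_sorted_list_of_set])
  then have list: "sorted_list_of_set ((+) r ` J) = map ((+) r) (sorted_list_of_set J)"
    using J by (intro sorted_distinct_set_unique) (auto simp: distinct_map)
  have "emeasure (distr (path_law \<mu>) path_space (path_shift r)) (cylinder J A)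
    = emeasure (path_law \<mu>) (path_shift r -` cylinder J A \<inter> space (path_law \<mu>))"
    by (rule emeasure_distr) (use cylinder_sets[OF J A'] in auto)
  also have "path_shift r -` cylinder J A \<inter> space (path_law \<mu>) = cylinder ((+) r ` J) (\<lambda>u. A (u - r))"
    using sets_eq_imp_space_eq[of "path_law \<mu>" path_space] L
    by (auto simp: cylinder_def path_shift_def space_path_space space_prob_algebra)
  also have "emeasure (path_law \<mu>) \<dots>
    = (\<integral>\<^sup>+x. cyl_int (\<lambda>u. indicator (A (u - r))) (r + s) (sorted_list_of_set ((+) r ` J)) x \<partial>\<mu>)"
    by (rule emeasure_path_law_cylinder[OF \<mu>]) (use J A' s smap in \<open>auto simp: list\<close>)
  also have "\<dots> = (\<integral>\<^sup>+x. cyl_int (\<lambda>t. indicator (A t)) s (sorted_list_of_set J) x \<partial>\<mu>)"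
    unfolding list using cyl_int_shift[of "\<lambda>t. indicator (A t)" r s] by simp
  also have "\<dots> = emeasure (path_law \<mu>) (cylinder J A)"
    by (rule emeasure_path_law_cylinder[OF \<mu> J A' s, symmetric])
  finally show "emeasure (distr (path_law \<mu>) path_space (path_shift r)) (cylinder J A)
    = emeasure (path_law \<mu>) (cylinder J A)" .
qed

lemma path_law_marginal:
  assumes \<mu>: "invariant_measure P \<mu>"
  shows "distr (path_law \<mu>) borel (\<lambda>\<omega>. \<omega> t) = \<mu>"
proof (rule measure_eqI)
  note L = path_law_in_prob_algebra[OF \<mu>]
  then have [measurable_cong]: "sets (path_law \<mu>) = sets path_space" by (simp add: space_prob_algebra)
  have sm: "sets \<mu> = sets borel" using \<mu> by (simp add: invariant_measure_def space_prob_algebra)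
  then show "sets (distr (path_law \<mu>) borel (\<lambda>\<omega>. \<omega> t)) = sets \<mu>" by simp
  fix \<Gamma> assume "\<Gamma> \<in> sets (distr (path_law \<mu>) borel (\<lambda>\<omega>. \<omega> t))"
  then have \<Gamma>: "\<Gamma> \<in> sets borel" by simp
  have "emeasure (distr (path_law \<mu>) borel (\<lambda>\<omega>. \<omega> t)) \<Gamma>
    = emeasure (path_law \<mu>) ((\<lambda>\<omega>. \<omega> t) -` \<Gamma> \<inter> space (path_law \<mu>))"
    by (rule emeasure_distr) (use \<Gamma> in measurable)
  also have "(\<lambda>\<omega>. \<omega> t) -` \<Gamma> \<inter> space (path_law \<mu>) = cylinder {t} (\<lambda>_. \<Gamma>)"
    using sets_eq_imp_space_eq[of "path_law \<mu>" path_space] L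
    by (auto simp: cylinder_def space_path_space space_prob_algebra)
  also have "emeasure (path_law \<mu>) \<dots> = (\<integral>\<^sup>+x. cyl_int (\<lambda>_. indicator \<Gamma>) t [t] x \<partial>\<mu>)"
    using emeasure_path_law_cylinder[OF \<mu>, of "{t}" "\<lambda>_. \<Gamma>" t] \<Gamma> by simp
  also have "\<dots> = (\<integral>\<^sup>+x. indicator \<Gamma> x * cyl_int (\<lambda>_. indicator \<Gamma>) t [] x \<partial>\<mu>)"
    by (rule nn_integral_cyl_int_invariant[OF \<mu>]) (use \<Gamma> in auto)
  also have "\<dots> = emeasure \<mu> \<Gamma>" using \<Gamma> sm by simp
  finally show "emeasure (distr (path_law \<mu>) borel (\<lambda>\<omega>. \<omega> t)) \<Gamma> = emeasure \<mu> \<Gamma>" .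
qed

text \<open>The last step of the chain integrates the indicator of \<open>\<Gamma>\<close> against
  \<open>P (t - s)\<close>, which is a function of the state at \<open>s\<close>; taken as an extra
  factor at time \<open>s\<close> it gives the right-hand side. Strictness makes \<open>t\<close> a
  new time; the case of equality is treated later, through \<open>P 0\<close>.\<close>

lemma path_law_Markov_cylinder:
  assumes \<mu>: "invariant_measure P \<mu>" and J: "finite J" "J \<subseteq> {..s}" and A: "\<And>t. A t \<in> sets borel"
    and st: "s < t" and \<Gamma>: "\<Gamma> \<in> sets borel"
  shows "emeasure (path_law \<mu>) (cylinder J A \<inter> {\<omega>. \<omega> t \<in> \<Gamma>})
    = (\<integral>\<^sup>+\<omega>. indicator (cylinder J A) \<omega> * emeasure (P (t - s) (\<omega> s)) \<Gamma> \<partial>path_law \<mu>)"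
proof -
  define B where "B u = (if u \<in> J then A u else if u = t then \<Gamma> else UNIV)" for u
  \<comment> \<open>Time \<open>s\<close> is always inserted, with trivial factor if it is not in
    \<open>J\<close>, so that there is a coordinate to carry the kernel factor of
    \<open>g\<close>.\<close>
  define f where "f u = (indicator (if u \<in> J then A u else UNIV) ::'a \<Rightarrow> ennreal)" for u
  define g where "g u x = (if u = s then f u x * emeasure (P (t - s) x) \<Gamma> else f u x)" for u x
  define I where "I = sorted_list_of_set (insert s J - {s})"
  define r where "r = start (insert s J)"
  have tJ: "t \<notin> J" "t \<noteq> s" using J st by auto
  have B: "B u \<in> sets borel" and f[measurable]: "f u \<in> borel_measurable borel" for u
    using A \<Gamma> by (auto simp: B_def f_def)
  have [measurable]: "(\<lambda>x. emeasure (P (t - s) x) \<Gamma>) \<in> borel_measurable borel"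
    using measurable_compose[OF measurable_prob_algebraD[OF kernel_measurable] measurable_emeasure_subprob_algebra[OF \<Gamma>], of "t - s"] st
    by simp
  have g: "g u \<in> borel_measurable borel" for u
    unfolding g_def by (cases "u = s") simp_all
  have I: "sorted I" "set I = J - {s}" "distinct I"
    using J by (auto simp: I_def)
  have l1: "sorted_list_of_set (insert s J) = I @ [s]"
    using J I by (intro sorted_distinct_set_unique) (auto simp: sorted_append simp del: sorted_list_of_set_insert_remove)
  have l2: "sorted_list_of_set (insert t (insert s J)) = I @ [s, t]"
    using J I st by (intro sorted_distinct_set_unique) (auto simp: sorted_append simp del: sorted_list_of_set_insert_remove)
  have r1: "sorted (r # I @ [s])"
    using sorted_start[of "insert s J"] J unfolding r_def l1[symmetric] by simp
  then have r2: "sorted (r # I @ [s, t])" using st by (auto simp: sorted_append simp del: sorted_list_of_set_insert_remove)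
  have eq: "cyl_int (\<lambda>u. indicator (B u)) v (K @ [s, t]) x = cyl_int g v (K @ [s]) x"
    if "set K \<subseteq> J - {s}" for v x K
    using that
  proof (induction K arbitrary: v x)
    case Nil
    have "(\<integral>\<^sup>+y. indicator (B t) y \<partial>P (t - s) z) = emeasure (P (t - s) z) \<Gamma>" for z
      using \<Gamma> tJ st by (simp add: B_def sets_kernel)
    then show ?case using tJ by (simp add: g_def f_def B_def)
  next
    case (Cons u K)
    then have "u \<in> J" "u \<noteq> s" by auto
    then have "g u = indicator (B u)" by (auto simp: g_def f_def B_def)
    then show ?case using Cons by simp
  qed
  have "cylinder J A \<inter> {\<omega>. \<omega> t \<in> \<Gamma>} = cylinder (insert t (insert s J)) B"
    using tJ by (auto simp: cylinder_def B_def)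
  then have "emeasure (path_law \<mu>) (cylinder J A \<inter> {\<omega>. \<omega> t \<in> \<Gamma>})
    = (\<integral>\<^sup>+x. cyl_int (\<lambda>u. indicator (B u)) r (I @ [s, t]) x \<partial>\<mu>)"
    using emeasure_path_law_cylinder[OF \<mu>, of "insert t (insert s J)" B r] J B r2 l2 by simp
  also have "\<dots> = (\<integral>\<^sup>+x. cyl_int g r (I @ [s]) x \<partial>\<mu>)"
    using I by (intro nn_integral_cong eq) auto
  also have "\<dots> = (\<integral>\<^sup>+\<omega>. (\<Prod>u\<in>insert s J. g u (\<omega> u)) \<partial>path_law \<mu>)"
    using nn_integral_path_law[OF \<mu>, of "insert s J" g r] J g r1 l1 by simp
  also have "\<dots> = (\<integral>\<^sup>+\<omega>. indicator (cylinder J A) \<omega> * emeasure (P (t - s) (\<omega> s)) \<Gamma> \<partial>path_law \<mu>)"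
  proof (rule nn_integral_cong)
    fix \<omega> :: "real \<Rightarrow> 'a"
    have "(\<Prod>u\<in>insert s J. g u (\<omega> u)) = g s (\<omega> s) * (\<Prod>u\<in>insert s J - {s}. g u (\<omega> u))"
      using J by (intro prod.remove) auto
    also have "(\<Prod>u\<in>insert s J - {s}. g u (\<omega> u)) = (\<Prod>u\<in>insert s J - {s}. f u (\<omega> u))"
      by (intro prod.cong) (auto simp: g_def)
    also have "g s (\<omega> s) * \<dots> = (f s (\<omega> s) * \<dots>) * emeasure (P (t - s) (\<omega> s)) \<Gamma>"
      by (simp add: g_def mult_ac)
    also have "f s (\<omega> s) * (\<Prod>u\<in>insert s J - {s}. f u (\<omega> u)) = (\<Prod>u\<in>insert s J. f u (\<omega> u))"
      using J by (intro prod.remove[symmetric]) auto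
    also have "\<dots> = indicator (cylinder (insert s J) (\<lambda>u. if u \<in> J then A u else UNIV)) \<omega>"
      unfolding f_def using J by (intro prod_indicator_cylinder) auto
    also have "cylinder (insert s J) (\<lambda>u. if u \<in> J then A u else UNIV) = cylinder J A"
      by (auto simp: cylinder_def)
    finally show "(\<Prod>u\<in>insert s J. g u (\<omega> u)) = indicator (cylinder J A) \<omega> * emeasure (P (t - s) (\<omega> s)) \<Gamma>" .
  qed
  finally show ?thesis .
qed

end

section \<open>The Markov property in integrated form and uniqueness of the law\<close>

context markov_transition
begin

text \<open>The conditional expectation is replaced by its defining integrals over past events, in
  nonnegative form, so that the inductions below carry neither versions nor integrability.\<close>

definition markov_path :: "(real \<Rightarrow> 'a) measure \<Rightarrow> bool" where
  "markov_path M \<longleftrightarrow> M \<in> space (prob_algebra path_space) \<and>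
     (\<forall>s t B \<Gamma>. s \<le> t \<longrightarrow> B \<in> sets (past s) \<longrightarrow> \<Gamma> \<in> sets borel \<longrightarrow>
       emeasure M (B \<inter> {\<omega>. \<omega> t \<in> \<Gamma>}) = (\<integral>\<^sup>+\<omega>. indicator B \<omega> * emeasure (P (t - s) (\<omega> s)) \<Gamma> \<partial>M))"

lemma emeasure_kernel_measurable:
  "0 \<le> t \<Longrightarrow> \<Gamma> \<in> sets borel \<Longrightarrow> (\<lambda>x. emeasure (P t x) \<Gamma>) \<in> borel_measurable borel"
  using measurable_compose[OF measurable_prob_algebraD[OF kernel_measurable]
      measurable_emeasure_subprob_algebra] by blast

lemma measure_kernel_measurable:
  "0 \<le> t \<Longrightarrow> \<Gamma> \<in> sets borel \<Longrightarrow> (\<lambda>x. measure (P t x) \<Gamma>) \<in> borel_measurable borel"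
  using measurable_compose[OF kernel_measurable measurable_measure_prob_algebra] by blast

lemma emeasure_kernel: "0 \<le> t \<Longrightarrow> emeasure (P t x) \<Gamma> = ennreal (measure (P t x) \<Gamma>)"
  using prob_space_kernel[of t x] by (simp add: prob_space_def finite_measure.emeasure_eq_measure)

lemma measure_kernel_le_1: "0 \<le> t \<Longrightarrow> measure (P t x) \<Gamma> \<le> 1"
  using prob_space_kernel[of t x] by (rule prob_space.prob_le_1)

text \<open>Turns an integral over past events into a measure on \<open>past s\<close>, so that two
  integrands can be compared on the open cylinders generating the past.\<close>

lemma emeasure_past_distr:
  fixes M :: "(real \<Rightarrow> 'a) measure"
  assumes "sets M = sets path_space" "g \<in> borel_measurable M" "B \<in> sets (past s)"
  shows "emeasure (distr (density M g) (past s) (\<lambda>\<omega>. \<omega>)) B = (\<integral>\<^sup>+\<omega>. indicator B \<omega> * g \<omega> \<partial>M)"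
proof -
  have B: "B \<in> sets M" using assms sets_past_path_space by blast
  have "space M = UNIV" using sets_eq_imp_space_eq[OF assms(1)] space_path_space by metis
  then have "(\<lambda>\<omega>. \<omega>) \<in> density M g \<rightarrow>\<^sub>M past s"
    using assms(1) sets_past_path_space by (intro measurableI) (auto simp: space_past)
  then have "emeasure (distr (density M g) (past s) (\<lambda>\<omega>. \<omega>)) B = emeasure (density M g) B"
    using assms(3) \<open>space M = UNIV\<close> by (subst emeasure_distr) auto
  also have "\<dots> = (\<integral>\<^sup>+\<omega>. indicator B \<omega> * g \<omega> \<partial>M)"
    using assms(2) B by (simp add: emeasure_density mult.commute)
  finally show ?thesis .
qed

lemma stationary_markov_law_imp_markov_path:
  assumes M: "stationary_markov_law P \<mu> M"
  shows "markov_path M"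
  unfolding markov_path_def
proof (intro conjI allI impI)
  show MA: "M \<in> space (prob_algebra path_space)" using M by (simp add: stationary_markov_law_def)
  then have sM[measurable_cong]: "sets M = sets path_space" by (simp add: space_prob_algebra)
  interpret prob_space M using MA by (simp add: space_prob_algebra)
  have spM: "space M = UNIV" using sets_eq_imp_space_eq[OF sM] by (simp add: space_path_space)
  fix s t :: real and B :: "(real \<Rightarrow> 'a) set" and \<Gamma> :: "'a set"
  assume st: "s \<le> t" and B: "B \<in> sets (past s)" and \<Gamma>[measurable]: "\<Gamma> \<in> sets borel"
  have B'[measurable]: "B \<in> sets M" using B sets_past_path_space sM by blast
  interpret finite_measure_subalgebra M "past s"
    by unfold_locales (use sM spM sets_past_path_space in \<open>auto simp: subalgebra_def space_past\<close>)
  have "{\<omega> \<in> space M. \<omega> t \<in> \<Gamma>} \<in> sets M" by measurable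
  then have E[measurable]: "{\<omega>. \<omega> t \<in> \<Gamma>} \<in> sets M" by (simp add: spM)
  have m: "(\<lambda>\<omega>. measure (P (t - s) (\<omega> s)) \<Gamma>) \<in> borel_measurable M"
  proof -
    have "(\<lambda>\<omega>. \<omega> s) \<in> M \<rightarrow>\<^sub>M borel" by measurable
    from measurable_compose[OF this measure_kernel_measurable[OF _ \<Gamma>], of "t - s"] st
    show ?thesis by simp
  qed
  have ae: "AE \<omega> in M. real_cond_exp M (past s) (indicator {\<omega>. \<omega> t \<in> \<Gamma>}) \<omega> = measure (P (t - s) (\<omega> s)) \<Gamma>"
    using M st \<Gamma> by (simp add: stationary_markov_law_def)
  have "measure M (B \<inter> {\<omega>. \<omega> t \<in> \<Gamma>}) = (LINT \<omega>:B|M. indicator {\<omega>. \<omega> t \<in> \<Gamma>} \<omega>)"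
    by (simp add: set_lebesgue_integral_def indicator_inter_arith[symmetric])
  also have "\<dots> = (LINT \<omega>:B|M. real_cond_exp M (past s) (indicator {\<omega>. \<omega> t \<in> \<Gamma>}) \<omega>)"
    using E B by (intro real_cond_exp_intA) (auto simp: less_top[symmetric])
  also have "\<dots> = (\<integral>\<omega>. indicator B \<omega> * measure (P (t - s) (\<omega> s)) \<Gamma> \<partial>M)"
    unfolding set_lebesgue_integral_def using ae m
    by (intro integral_cong_AE) auto
  finally have *: "measure M (B \<inter> {\<omega>. \<omega> t \<in> \<Gamma>}) = (\<integral>\<omega>. indicator B \<omega> * measure (P (t - s) (\<omega> s)) \<Gamma> \<partial>M)" .
  have "(\<integral>\<^sup>+\<omega>. indicator B \<omega> * emeasure (P (t - s) (\<omega> s)) \<Gamma> \<partial>M)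
    = (\<integral>\<^sup>+\<omega>. ennreal (indicator B \<omega> * measure (P (t - s) (\<omega> s)) \<Gamma>) \<partial>M)"
    using st by (intro nn_integral_cong) (simp add: emeasure_kernel split: split_indicator)
  also have "\<dots> = ennreal (\<integral>\<omega>. indicator B \<omega> * measure (P (t - s) (\<omega> s)) \<Gamma> \<partial>M)"
    using st m measure_kernel_le_1[of "t - s"]
    by (intro nn_integral_eq_integral integrable_const_bound[where B=1]) (auto split: split_indicator)
  finally show "emeasure M (B \<inter> {\<omega>. \<omega> t \<in> \<Gamma>}) = (\<integral>\<^sup>+\<omega>. indicator B \<omega> * emeasure (P (t - s) (\<omega> s)) \<Gamma> \<partial>M)"
    by (simp add: emeasure_eq_measure *)
qed

text \<open>Weighting \<open>M\<close> by the past event \<open>B\<close> makes the Markov property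
  an equality of measures: the weighted law of the state at \<open>t\<close> is the weighted law at
  \<open>s\<close> pushed by \<open>P (t - s)\<close>. Integrating \<open>h\<close> against both
  sides replaces an approximation of \<open>h\<close> by simple functions.\<close>

lemma markov_path_nn_integral:
  assumes M: "markov_path M" and st: "s \<le> t" and B: "B \<in> sets (past s)"
    and h: "h \<in> borel_measurable borel"
  shows "(\<integral>\<^sup>+\<omega>. indicator B \<omega> * h (\<omega> t) \<partial>M) = (\<integral>\<^sup>+\<omega>. indicator B \<omega> * (\<integral>\<^sup>+y. h y \<partial>P (t - s) (\<omega> s)) \<partial>M)"
proof -
  have MA: "M \<in> space (prob_algebra path_space)" using M by (simp add: markov_path_def)
  then have sM[measurable_cong]: "sets M = sets path_space" by (simp add: space_prob_algebra)
  have spM: "space M = UNIV" using sets_eq_imp_space_eq[OF sM] by (simp add: space_path_space)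
  have [measurable]: "B \<in> sets M" using B sets_past_path_space sM by blast
  let ?D = "density M (indicator B)"
  have K: "P (t - s) \<in> borel \<rightarrow>\<^sub>M subprob_algebra borel"
    using st by (intro measurable_prob_algebraD kernel_measurable) simp
  have [measurable]: "(\<lambda>\<omega>. \<omega> u) \<in> ?D \<rightarrow>\<^sub>M borel" for u by measurable
  have Kd: "P (t - s) \<in> distr ?D borel (\<lambda>\<omega>. \<omega> s) \<rightarrow>\<^sub>M subprob_algebra borel"
    using K by (simp cong: measurable_cong_sets)
  have eq: "distr ?D borel (\<lambda>\<omega>. \<omega> t) = distr ?D borel (\<lambda>\<omega>. \<omega> s) \<bind> P (t - s)"
  proof (rule measure_eqI)
    show "sets (distr ?D borel (\<lambda>\<omega>. \<omega> t)) = sets (distr ?D borel (\<lambda>\<omega>. \<omega> s) \<bind> P (t - s))"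
      by (subst sets_bind_measurable[OF Kd]) auto
    fix \<Gamma> assume "\<Gamma> \<in> sets (distr ?D borel (\<lambda>\<omega>. \<omega> t))"
    then have \<Gamma>[measurable]: "\<Gamma> \<in> sets borel" by simp
    have [measurable]: "(\<lambda>x. emeasure (P (t - s) x) \<Gamma>) \<in> borel_measurable borel"
      using st \<Gamma> by (intro emeasure_kernel_measurable) auto
    have E[measurable]: "{\<omega>. \<omega> t \<in> \<Gamma>} \<in> sets M"
    proof -
      have "{\<omega> \<in> space M. \<omega> t \<in> \<Gamma>} \<in> sets M" by measurable
      then show ?thesis by (simp add: spM)
    qed
    have "emeasure (distr ?D borel (\<lambda>\<omega>. \<omega> t)) \<Gamma> = emeasure ?D {\<omega>. \<omega> t \<in> \<Gamma>}"
      by (subst emeasure_distr) (auto simp: spM vimage_def)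
    also have "\<dots> = emeasure M (B \<inter> {\<omega>. \<omega> t \<in> \<Gamma>})"
      by (subst emeasure_density) (auto simp: indicator_inter_arith[symmetric])
    also have "\<dots> = (\<integral>\<^sup>+\<omega>. indicator B \<omega> * emeasure (P (t - s) (\<omega> s)) \<Gamma> \<partial>M)"
      using M st B \<Gamma> by (auto simp: markov_path_def)
    also have "\<dots> = (\<integral>\<^sup>+\<omega>. emeasure (P (t - s) (\<omega> s)) \<Gamma> \<partial>?D)"
      by (subst nn_integral_density) auto
    also have "\<dots> = (\<integral>\<^sup>+x. emeasure (P (t - s) x) \<Gamma> \<partial>distr ?D borel (\<lambda>\<omega>. \<omega> s))"
      by (subst nn_integral_distr) auto
    also have "\<dots> = emeasure (distr ?D borel (\<lambda>\<omega>. \<omega> s) \<bind> P (t - s)) \<Gamma>"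
      by (subst emeasure_bind[OF _ Kd]) auto
    finally show "emeasure (distr ?D borel (\<lambda>\<omega>. \<omega> t)) \<Gamma>
      = emeasure (distr ?D borel (\<lambda>\<omega>. \<omega> s) \<bind> P (t - s)) \<Gamma>" .
  qed
  have [measurable]: "(\<lambda>x. \<integral>\<^sup>+y. h y \<partial>P (t - s) x) \<in> borel_measurable borel"
    using st h by (intro nn_integral_kernel_measurable) auto
  have "(\<integral>\<^sup>+\<omega>. indicator B \<omega> * h (\<omega> t) \<partial>M) = (\<integral>\<^sup>+\<omega>. h (\<omega> t) \<partial>?D)"
    using h by (subst nn_integral_density) auto
  also have "\<dots> = (\<integral>\<^sup>+y. h y \<partial>distr ?D borel (\<lambda>\<omega>. \<omega> t))"
    using h by (subst nn_integral_distr) auto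
  also have "\<dots> = (\<integral>\<^sup>+x. \<integral>\<^sup>+y. h y \<partial>P (t - s) x \<partial>distr ?D borel (\<lambda>\<omega>. \<omega> s))"
    unfolding eq by (rule nn_integral_bind[OF h Kd])
  also have "\<dots> = (\<integral>\<^sup>+\<omega>. \<integral>\<^sup>+y. h y \<partial>P (t - s) (\<omega> s) \<partial>?D)"
    by (subst nn_integral_distr) auto
  also have "\<dots> = (\<integral>\<^sup>+\<omega>. indicator B \<omega> * (\<integral>\<^sup>+y. h y \<partial>P (t - s) (\<omega> s)) \<partial>M)"
    by (subst nn_integral_density) auto
  finally show ?thesis .
qed

text \<open>Induction over the times: the event at the first time is absorbed into the past, which
  is why \<open>B\<close> has to range over all past events, and the remaining integral is a
  function of the state at that time.\<close>

lemma markov_path_list: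
  assumes M: "markov_path M" and "sorted (s # ts)" "B \<in> sets (past s)" "\<And>t. A t \<in> sets borel"
  shows "emeasure M (B \<inter> {\<omega>. \<forall>t\<in>set ts. \<omega> t \<in> A t})
    = (\<integral>\<^sup>+\<omega>. indicator B \<omega> * cyl_int (\<lambda>t. indicator (A t)) s ts (\<omega> s) \<partial>M)"
  using assms(2,3)
proof (induction ts arbitrary: s B)
  case Nil
  have "sets M = sets path_space" using M by (simp add: markov_path_def space_prob_algebra)
  then have "B \<in> sets M" using Nil sets_past_path_space by blast
  then show ?case by simp
next
  case (Cons t ts)
  have st: "s \<le> t" "sorted (t # ts)" using Cons.prems by auto
  have "{\<omega>. \<omega> t \<in> A t} \<in> sets (past t)"
    using measurable_sets[OF coordinate_past_measurable[of t t], of "A t"] assms(4)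
    by (simp add: vimage_def space_past)
  then have B': "B \<inter> {\<omega>. \<omega> t \<in> A t} \<in> sets (past t)"
    using Cons.prems sets_past_mono[OF st(1)] by blast
  have m: "(\<lambda>y. indicator (A t) y * cyl_int (\<lambda>t. indicator (A t)) t ts y) \<in> borel_measurable borel"
    using cyl_int_measurable[of "\<lambda>t. indicator (A t)" t ts] assms(4) st by simp
  have "B \<inter> {\<omega>. \<forall>u\<in>set (t # ts). \<omega> u \<in> A u} = (B \<inter> {\<omega>. \<omega> t \<in> A t}) \<inter> {\<omega>. \<forall>u\<in>set ts. \<omega> u \<in> A u}"
    by auto
  then have "emeasure M (B \<inter> {\<omega>. \<forall>u\<in>set (t # ts). \<omega> u \<in> A u})
    = (\<integral>\<^sup>+\<omega>. indicator (B \<inter> {\<omega>. \<omega> t \<in> A t}) \<omega> * cyl_int (\<lambda>t. indicator (A t)) t ts (\<omega> t) \<partial>M)"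
    using Cons.IH[OF st(2) B'] by simp
  also have "\<dots> = (\<integral>\<^sup>+\<omega>. indicator B \<omega> * (indicator (A t) (\<omega> t) * cyl_int (\<lambda>t. indicator (A t)) t ts (\<omega> t)) \<partial>M)"
    by (intro nn_integral_cong) (auto split: split_indicator)
  also have "\<dots> = (\<integral>\<^sup>+\<omega>. indicator B \<omega> * cyl_int (\<lambda>t. indicator (A t)) s (t # ts) (\<omega> s) \<partial>M)"
    using markov_path_nn_integral[OF M st(1) Cons.prems(2) m] by simp
  finally show ?case .
qed

text \<open>With the whole space as past event at the earliest time, the marginal there and the
  kernels determine every open cylinder.\<close>

lemma markov_path_unique:
  assumes \<mu>: "invariant_measure P \<mu>" and M: "markov_path M"
    and marg: "\<And>t. distr M borel (\<lambda>\<omega>. \<omega> t) = \<mu>"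
  shows "M = path_law \<mu>"
proof (rule prob_measure_eqI_open_cylinders)
  show MA: "M \<in> space (prob_algebra path_space)" using M by (simp add: markov_path_def)
  then have sM[measurable_cong]: "sets M = sets path_space" by (simp add: space_prob_algebra)
  show "path_law \<mu> \<in> space (prob_algebra path_space)" by (rule path_law_in_prob_algebra[OF \<mu>])
  fix J :: "real set" and A :: "real \<Rightarrow> 'a set" assume J: "finite J" and A: "\<And>t. open (A t)"
  then have A': "A t \<in> sets borel" for t by simp
  note s = sorted_start[OF J]
  have U: "UNIV \<in> sets (past (start J))" using sets.top[of "past (start J)"] by (simp add: space_past)
  have "emeasure M (cylinder J A) = (\<integral>\<^sup>+\<omega>. cyl_int (\<lambda>t. indicator (A t)) (start J) (sorted_list_of_set J) (\<omega> (start J)) \<partial>M)"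
    using markov_path_list[OF M s U, of A] A' J by (simp add: cylinder_def)
  also have "\<dots> = (\<integral>\<^sup>+x. cyl_int (\<lambda>t. indicator (A t)) (start J) (sorted_list_of_set J) x
      \<partial>distr M borel (\<lambda>\<omega>. \<omega> (start J)))"
    using cyl_int_measurable[OF _ s, of "\<lambda>t. indicator (A t)"] A'
    by (subst nn_integral_distr) auto
  also have "\<dots> = emeasure (path_law \<mu>) (cylinder J A)"
    unfolding marg by (rule emeasure_path_law_cylinder[OF \<mu> J A' s, symmetric])
  finally show "emeasure M (cylinder J A) = emeasure (path_law \<mu>) (cylinder J A)" .
qed

end

section \<open>Existence of the canonical law\<close>

context stochastically_continuous_transition
begin

text \<open>\<open>P h\<close> equals \<open>P 0\<close> followed by \<open>P h\<close>. As
  \<open>h\<close> decreases to 0, the former converges weakly to the point mass at \<open>x\<close>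
  and the latter to \<open>P 0 x\<close>.\<close>

lemma kernel_zero: "P 0 x = return borel x"
proof -
  have h: "0 < 1 / real (Suc n)" for n by simp
  have h0: "(\<lambda>n. 1 / real (Suc n)) \<longlonglongrightarrow> 0" by (rule LIMSEQ_Suc[OF lim_inverse_n'])
  have P0: "P 0 x \<in> space (prob_algebra borel)" by (rule kernel_in_prob_algebra) simp
  have int: "(\<integral>y. f y \<partial>P 0 x) = f x"
    if f: "continuous_on UNIV f" "\<And>x. 0 \<le> f x \<and> f x \<le> 1" for f :: "'a \<Rightarrow> real"
  proof (rule LIMSEQ_unique)
    show "(\<lambda>n. \<integral>y. f y \<partial>P (1 / real (Suc n)) x) \<longlonglongrightarrow> f x"
      by (rule kernel_tendsto_zero[OF f h h0])
    have "P 0 x \<bind> P (1 / real (Suc n)) = P (1 / real (Suc n)) x" for n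
      using kernel_add[of 0 "1 / real (Suc n)" x] by simp
    then show "(\<lambda>n. \<integral>y. f y \<partial>P (1 / real (Suc n)) x) \<longlonglongrightarrow> (\<integral>y. f y \<partial>P 0 x)"
      using bind_kernel_tendsto[OF f h h0 P0] by simp
  qed
  interpret Q: prob_space "P 0 x" by (rule prob_space_kernel) simp
  show ?thesis
  proof (rule measure_eqI_generator_eq[where \<Omega>=UNIV and E="{U. open U}" and A="\<lambda>_. UNIV"])
    show "Int_stable {U::'a set. open U}" by (auto simp: Int_stable_def)
    show "{U::'a set. open U} \<subseteq> Pow UNIV" by auto
    show "sets (P 0 x) = sigma_sets UNIV {U. open U}" "sets (return borel x) = sigma_sets UNIV {U. open U}"
      by (simp_all add: sets_kernel sets_borel)
    show "range (\<lambda>_::nat. UNIV) \<subseteq> {U::'a set. open U}" by auto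
    show "(\<Union>i::nat. UNIV) = (UNIV :: 'a set)" by simp
    show "emeasure (P 0 x) UNIV \<noteq> \<infinity>" for i :: nat by simp
    fix U :: "'a set" assume "U \<in> {U. open U}"
    then have U: "open U" by simp
    have "(\<lambda>n. \<integral>y. open_approx U n y \<partial>P 0 x) \<longlonglongrightarrow> measure (P 0 x) U"
      using measure_open_approx_LIMSEQ[OF _ _ U] prob_space_kernel sets_kernel by simp
    moreover have "(\<integral>y. open_approx U n y \<partial>P 0 x) = open_approx U n x" for n
      by (intro int continuous_open_approx) (auto simp: open_approx_bounds)
    ultimately have "measure (P 0 x) U = indicator U x"
      using open_approx_LIMSEQ[OF U, of x] by (simp add: LIMSEQ_unique)
    then show "emeasure (P 0 x) U = emeasure (return borel x) U"
      using U by (simp add: Q.emeasure_eq_measure split: split_indicator)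
  qed
qed

text \<open>As functions of \<open>B\<close> both sides are finite measures on
  \<open>past s\<close>, so agreement on the open cylinders up to \<open>s\<close> is enough. For
  \<open>s = t\<close> the state is already known, and the identity rests on \<open>P 0\<close>
  being the identity kernel.\<close>

lemma path_law_markov_path:
  assumes \<mu>: "invariant_measure P \<mu>"
  shows "markov_path (path_law \<mu>)"
  unfolding markov_path_def
proof (intro conjI allI impI)
  show L: "path_law \<mu> \<in> space (prob_algebra path_space)" by (rule path_law_in_prob_algebra[OF \<mu>])
  then have sL[measurable_cong]: "sets (path_law \<mu>) = sets path_space" by (simp add: space_prob_algebra)
  interpret prob_space "path_law \<mu>" using L by (simp add: space_prob_algebra)
  have spL: "space (path_law \<mu>) = UNIV" using sets_eq_imp_space_eq[OF sL] by (simp add: space_path_space)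
  fix s t :: real and B :: "(real \<Rightarrow> 'a) set" and \<Gamma> :: "'a set"
  assume st: "s \<le> t" and B: "B \<in> sets (past s)" and \<Gamma>[measurable]: "\<Gamma> \<in> sets borel"
  have B'[measurable]: "B \<in> sets (path_law \<mu>)" using B sets_past_path_space sL by blast
  have E: "{\<omega>. \<omega> t \<in> \<Gamma>} \<in> sets (path_law \<mu>)"
  proof -
    have "{\<omega> \<in> space (path_law \<mu>). \<omega> t \<in> \<Gamma>} \<in> sets (path_law \<mu>)" by measurable
    then show ?thesis by (simp add: spL)
  qed
  show "emeasure (path_law \<mu>) (B \<inter> {\<omega>. \<omega> t \<in> \<Gamma>})
    = (\<integral>\<^sup>+\<omega>. indicator B \<omega> * emeasure (P (t - s) (\<omega> s)) \<Gamma> \<partial>path_law \<mu>)"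
  proof (cases "s = t")
    case True
    have "(\<integral>\<^sup>+\<omega>. indicator B \<omega> * emeasure (P (t - s) (\<omega> s)) \<Gamma> \<partial>path_law \<mu>)
      = (\<integral>\<^sup>+\<omega>. indicator (B \<inter> {\<omega>. \<omega> t \<in> \<Gamma>}) \<omega> \<partial>path_law \<mu>)"
      using True by (intro nn_integral_cong) (simp add: kernel_zero split: split_indicator)
    then show ?thesis using E by simp
  next
    case False
    with st have lt: "s < t" by simp
    let ?f = "indicator {\<omega>. \<omega> t \<in> \<Gamma>} :: (real \<Rightarrow> 'a) \<Rightarrow> ennreal"
    let ?g = "\<lambda>\<omega>::real \<Rightarrow> 'a. emeasure (P (t - s) (\<omega> s)) \<Gamma>"
    have f: "?f \<in> borel_measurable (path_law \<mu>)" using E by simp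
    have g: "?g \<in> borel_measurable (path_law \<mu>)"
    proof -
      have "(\<lambda>\<omega>. \<omega> s) \<in> path_law \<mu> \<rightarrow>\<^sub>M borel" by measurable
      from measurable_compose[OF this emeasure_kernel_measurable[OF _ \<Gamma>], of "t - s"] st
      show ?thesis by simp
    qed
    have eq: "distr (density (path_law \<mu>) ?f) (past s) (\<lambda>\<omega>. \<omega>) = distr (density (path_law \<mu>) ?g) (past s) (\<lambda>\<omega>. \<omega>)"
      (is "?F = ?G")
    proof (rule measure_eqI_generator_eq[OF Int_stable_open_cylinders])
      show "open_cylinders {..s} \<subseteq> Pow UNIV" by simp
      show "sets ?F = sigma_sets UNIV (open_cylinders {..s})" "sets ?G = sigma_sets UNIV (open_cylinders {..s})"
        by (simp_all add: sets_past)
      have "UNIV = cylinder {} (\<lambda>_. UNIV)" by (simp add: cylinder_def)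
      then show "range (\<lambda>_::nat. UNIV) \<subseteq> (open_cylinders {..s} :: (real \<Rightarrow> 'a) set set)"
        unfolding open_cylinders_def by blast
      show "(\<Union>i::nat. UNIV) = UNIV" by simp
      have U: "UNIV \<in> sets (past s)" using sets.top[of "past s"] by (simp add: space_past)
      have "emeasure ?F UNIV = emeasure (path_law \<mu>) {\<omega>. \<omega> t \<in> \<Gamma>}"
        using emeasure_past_distr[OF sL f U] E by simp
      then show "emeasure ?F UNIV \<noteq> \<infinity>" for i :: nat by simp
      fix X :: "(real \<Rightarrow> 'a) set" assume X: "X \<in> open_cylinders {..s}"
      then have Xp: "X \<in> sets (past s)" by (simp add: sets_past)
      then have X': "X \<in> sets (path_law \<mu>)" using sets_past_path_space sL by blast
      obtain J A where JA: "X = cylinder J A" "finite J" "J \<subseteq> {..s}" "\<And>t. A t \<in> sets borel"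
        using X unfolding open_cylinders_def by auto
      have "emeasure ?F X = emeasure (path_law \<mu>) (X \<inter> {\<omega>. \<omega> t \<in> \<Gamma>})"
        using emeasure_past_distr[OF sL f Xp] E X' by (simp add: indicator_inter_arith[symmetric])
      also have "\<dots> = emeasure ?G X"
        using path_law_Markov_cylinder[OF \<mu> JA(2,3,4) lt \<Gamma>] emeasure_past_distr[OF sL g Xp] JA(1) by simp
      finally show "emeasure ?F X = emeasure ?G X" .
    qed
    have "emeasure (path_law \<mu>) (B \<inter> {\<omega>. \<omega> t \<in> \<Gamma>}) = emeasure ?F B"
      using emeasure_past_distr[OF sL f B] E by (simp add: indicator_inter_arith[symmetric])
    also have "\<dots> = (\<integral>\<^sup>+\<omega>. indicator B \<omega> * ?g \<omega> \<partial>path_law \<mu>)"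
      unfolding eq by (rule emeasure_past_distr[OF sL g B])
    finally show ?thesis .
  qed
qed

lemma stationary_markov_law_path_law:
  assumes \<mu>: "invariant_measure P \<mu>"
  shows "stationary_markov_law P \<mu> (path_law \<mu>)"
  unfolding stationary_markov_law_def
proof (intro conjI allI impI ballI)
  show L: "path_law \<mu> \<in> space (prob_algebra path_space)" by (rule path_law_in_prob_algebra[OF \<mu>])
  show "distr (path_law \<mu>) path_space (path_shift t) = path_law \<mu>" for t by (rule path_law_shift[OF \<mu>])
  show "distr (path_law \<mu>) borel (\<lambda>\<omega>. \<omega> t) = \<mu>" for t by (rule path_law_marginal[OF \<mu>])
  from L have sL[measurable_cong]: "sets (path_law \<mu>) = sets path_space" by (simp add: space_prob_algebra)
  interpret prob_space "path_law \<mu>" using L by (simp add: space_prob_algebra)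
  have spL: "space (path_law \<mu>) = UNIV" using sets_eq_imp_space_eq[OF sL] by (simp add: space_path_space)
  fix s t :: real and \<Gamma> :: "'a set"
  assume st: "s \<le> t" and \<Gamma>[measurable]: "\<Gamma> \<in> sets borel"
  interpret finite_measure_subalgebra "path_law \<mu>" "past s"
    by unfold_locales (use sL spL sets_past_path_space in \<open>auto simp: subalgebra_def space_past\<close>)
  have E[measurable]: "{\<omega>. \<omega> t \<in> \<Gamma>} \<in> sets (path_law \<mu>)"
  proof -
    have "{\<omega> \<in> space (path_law \<mu>). \<omega> t \<in> \<Gamma>} \<in> sets (path_law \<mu>)" by measurable
    then show ?thesis by (simp add: spL)
  qed
  have gp: "(\<lambda>\<omega>. measure (P (t - s) (\<omega> s)) \<Gamma>) \<in> borel_measurable (past s)"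
    using measurable_compose[OF coordinate_past_measurable measure_kernel_measurable[OF _ \<Gamma>], of s s "t - s"] st
    by simp
  then have g[measurable]: "(\<lambda>\<omega>. measure (P (t - s) (\<omega> s)) \<Gamma>) \<in> borel_measurable (path_law \<mu>)"
    by (rule measurable_from_subalg[OF subalg])
  have le1: "measure (P (t - s) x) \<Gamma> \<le> 1" for x using st by (intro measure_kernel_le_1) simp
  show "AE \<omega> in path_law \<mu>. real_cond_exp (path_law \<mu>) (past s) (indicator {\<omega>. \<omega> t \<in> \<Gamma>}) \<omega>
    = measure (P (t - s) (\<omega> s)) \<Gamma>"
  proof (rule real_cond_exp_charact[OF _ _ _ gp])
    show "integrable (path_law \<mu>) (indicator {\<omega>. \<omega> t \<in> \<Gamma>} :: _ \<Rightarrow> real)"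
      using E by (auto simp: less_top[symmetric])
    show "integrable (path_law \<mu>) (\<lambda>\<omega>. measure (P (t - s) (\<omega> s)) \<Gamma>)"
      by (intro integrable_const_bound[where B=1]) (use le1 in auto)
    fix B :: "(real \<Rightarrow> 'a) set" assume B: "B \<in> sets (past s)"
    then have B'[measurable]: "B \<in> sets (path_law \<mu>)" using sets_past_path_space sL by blast
    have "(LINT \<omega>:B|path_law \<mu>. indicator {\<omega>. \<omega> t \<in> \<Gamma>} \<omega>) = measure (path_law \<mu>) (B \<inter> {\<omega>. \<omega> t \<in> \<Gamma>})"
      by (simp add: set_lebesgue_integral_def indicator_inter_arith[symmetric])
    also have "\<dots> = enn2real (\<integral>\<^sup>+\<omega>. indicator B \<omega> * emeasure (P (t - s) (\<omega> s)) \<Gamma> \<partial>path_law \<mu>)"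
      using path_law_markov_path[OF \<mu>] st B \<Gamma> by (auto simp: markov_path_def measure_def)
    also have "\<dots> = enn2real (\<integral>\<^sup>+\<omega>. ennreal (indicator B \<omega> * measure (P (t - s) (\<omega> s)) \<Gamma>) \<partial>path_law \<mu>)"
      using st by (intro arg_cong[where f=enn2real] nn_integral_cong)
        (simp add: emeasure_kernel split: split_indicator)
    also have "\<dots> = (\<integral>\<omega>. indicator B \<omega> * measure (P (t - s) (\<omega> s)) \<Gamma> \<partial>path_law \<mu>)"
      by (intro integral_eq_nn_integral[symmetric]) auto
    finally show "(LINT \<omega>:B|path_law \<mu>. indicator {\<omega>. \<omega> t \<in> \<Gamma>} \<omega>)
      = (LINT \<omega>:B|path_law \<mu>. measure (P (t - s) (\<omega> s)) \<Gamma>)"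
      by (simp add: set_lebesgue_integral_def)
  qed
qed

lemma canonical_law_eq:
  assumes \<mu>: "invariant_measure P \<mu>"
  shows "canonical_law P \<mu> = path_law \<mu>"
  unfolding canonical_law_def
proof (rule the_equality)
  show "stationary_markov_law P \<mu> (path_law \<mu>)" by (rule stationary_markov_law_path_law[OF \<mu>])
  fix M assume M: "stationary_markov_law P \<mu> M"
  show "M = path_law \<mu>"
    by (rule markov_path_unique[OF \<mu> stationary_markov_law_imp_markov_path[OF M]])
       (use M in \<open>auto simp: stationary_markov_law_def\<close>)
qed

end

section \<open>Time averages\<close>

lemma bounded_set_integrable:
  fixes \<phi> :: "real \<Rightarrow> real"
  assumes "\<phi> \<in> borel_measurable borel" "\<And>t. \<bar>\<phi> t\<bar> \<le> C"
  shows "set_integrable lborel {a..b} \<phi>"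
  unfolding set_integrable_def
  by (rule integrableI_bounded_set_indicator[where B=C]) (use assms in \<open>auto simp: emeasure_lborel_Icc_eq\<close>)

lemma set_integral_Icc_add:
  fixes \<phi> :: "real \<Rightarrow> real"
  assumes \<phi>: "\<phi> \<in> borel_measurable borel" "\<And>t. \<bar>\<phi> t\<bar> \<le> C" and le: "a \<le> b" "b \<le> c"
  shows "(LBINT t:{a..c}. \<phi> t) = (LBINT t:{a..b}. \<phi> t) + (LBINT t:{b..c}. \<phi> t)"
proof -
  have "set_integrable lborel {a<..<c} \<phi>"
    by (rule set_integrable_subset[OF bounded_set_integrable[OF \<phi>, of a c]]) auto
  then have "interval_lebesgue_integrable lborel (min (ereal a) (min (ereal b) (ereal c)))
      (max (ereal a) (max (ereal b) (ereal c))) \<phi>"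
    using le by (simp add: interval_lebesgue_integrable_def)
  from interval_integral_sum[OF this] le show ?thesis
    by (simp add: interval_integral_Icc[symmetric])
qed

lemma set_integral_Icc_bound:
  fixes \<phi> :: "real \<Rightarrow> real"
  assumes \<phi>: "\<phi> \<in> borel_measurable borel" "\<And>t. \<bar>\<phi> t\<bar> \<le> C" and "a \<le> b"
  shows "\<bar>LBINT t:{a..b}. \<phi> t\<bar> \<le> C * (b - a)"
proof -
  have "\<bar>LBINT t:{a..b}. \<phi> t\<bar> \<le> (LBINT t:{a..b}. \<bar>\<phi> t\<bar>)"
    using set_integral_norm_bound[OF bounded_set_integrable[OF \<phi>], of a b] by simp
  also have "\<dots> \<le> (LBINT t:{a..b}. C)"
    using \<phi> by (intro set_integral_mono bounded_set_integrable[where C=C]) (auto intro: order_trans[OF abs_ge_zero])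
  also have "\<dots> = C * (b - a)" using assms(3) by (simp add: set_integral_const mult.commute)
  finally show ?thesis .
qed

lemma set_integral_Icc_shift:
  fixes \<phi> :: "real \<Rightarrow> real"
  shows "(LBINT t:{a..b}. \<phi> (t + c)) = (LBINT t:{a + c..b + c}. \<phi> t)"
proof -
  have "(LBINT t:{a + c..b + c}. \<phi> t) = (\<integral>t. indicator {a + c..b + c} (c + 1 * t) *\<^sub>R \<phi> (c + 1 * t) \<partial>lborel)"
    unfolding set_lebesgue_integral_def by (subst lborel_integral_real_affine[where c=1 and t=c]) auto
  also have "\<dots> = (LBINT t:{a..b}. \<phi> (t + c))"
    unfolding set_lebesgue_integral_def
    by (intro Bochner_Integration.integral_cong) (auto simp: add.commute split: split_indicator)
  finally show ?thesis by simp
qed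

lemma set_integral_Icc_sum:
  fixes \<phi> :: "real \<Rightarrow> real"
  assumes \<phi>: "\<phi> \<in> borel_measurable borel" "\<And>t. \<bar>\<phi> t\<bar> \<le> C" and \<tau>: "0 \<le> \<tau>"
  shows "(LBINT t:{0..real N * \<tau>}. \<phi> t) = (\<Sum>k<N. LBINT s:{0..\<tau>}. \<phi> (s + real k * \<tau>))"
proof (induction N)
  case 0
  have "\<bar>LBINT t:{0..0}. \<phi> t\<bar> \<le> C * (0 - 0)" by (rule set_integral_Icc_bound[OF \<phi>]) simp
  then show ?case by simp
next
  case (Suc N)
  have "(LBINT t:{0..real (Suc N) * \<tau>}. \<phi> t)
    = (LBINT t:{0..real N * \<tau>}. \<phi> t) + (LBINT t:{0 + real N * \<tau>..\<tau> + real N * \<tau>}. \<phi> t)"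
    using \<tau> by (subst set_integral_Icc_add[OF \<phi>, of 0 "real N * \<tau>"]) (auto simp: algebra_simps)
  then show ?case by (simp only: Suc set_integral_Icc_shift[symmetric]) simp
qed

definition cesaro :: "(real \<Rightarrow> real) \<Rightarrow> real \<Rightarrow> bool" where
  "cesaro \<phi> l \<longleftrightarrow> ((\<lambda>T. (1 / T) * (LBINT t:{0..T}. \<phi> t)) \<longlongrightarrow> l) at_top"

lemma cesaro_cong:
  assumes "\<And>t. 0 \<le> t \<Longrightarrow> \<phi> t = \<psi> t"
  shows "cesaro \<phi> l \<longleftrightarrow> cesaro \<psi> l"
proof -
  have "(LBINT t:{0..T}. \<phi> t) = (LBINT t:{0..T}. \<psi> t)" for T
    by (rule set_lebesgue_integral_cong) (use assms in auto)
  then show ?thesis by (simp add: cesaro_def)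
qed

lemma cesaro_const: "cesaro (\<lambda>_. c) c"
proof -
  have "\<forall>\<^sub>F T in at_top. (1 / T) * (LBINT t:{0..T}. c) = (c::real)"
    using eventually_gt_at_top[of 0] by eventually_elim (simp add: set_integral_const)
  then show ?thesis unfolding cesaro_def by (rule tendsto_eventually)
qed

lemma cesaro_add_mult:
  assumes "\<phi> \<in> borel_measurable borel" "\<And>t. \<bar>\<phi> t\<bar> \<le> C" "\<psi> \<in> borel_measurable borel" "\<And>t. \<bar>\<psi> t\<bar> \<le> D"
    and "cesaro \<phi> l" "cesaro \<psi> m"
  shows "cesaro (\<lambda>t. \<phi> t + c * \<psi> t) (l + c * m)"
proof -
  note i = bounded_set_integrable[OF assms(1,2)] bounded_set_integrable[OF assms(3,4)]
  have "(LBINT t:{0..T}. \<phi> t + c * \<psi> t) = (LBINT t:{0..T}. \<phi> t) + c * (LBINT t:{0..T}. \<psi> t)" for T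
    using i by (subst set_integral_add(2)) auto
  then have eq: "(\<lambda>T. (1 / T) * (LBINT t:{0..T}. \<phi> t + c * \<psi> t))
    = (\<lambda>T. (1 / T) * (LBINT t:{0..T}. \<phi> t) + c * ((1 / T) * (LBINT t:{0..T}. \<psi> t)))"
    by (simp add: algebra_simps)
  show ?thesis
    using tendsto_add[OF assms(5)[unfolded cesaro_def] tendsto_mult[OF tendsto_const[of c] assms(6)[unfolded cesaro_def]]]
    unfolding cesaro_def eq[symmetric] .
qed

lemma cesaro_transfer:
  assumes "cesaro \<phi> l" and K: "\<And>T. 0 \<le> T \<Longrightarrow> \<bar>(LBINT t:{0..T}. \<psi> t) - (LBINT t:{0..T}. \<phi> t)\<bar> \<le> K"
  shows "cesaro \<psi> l"
proof -
  have "((\<lambda>T. (1 / T) * ((LBINT t:{0..T}. \<psi> t) - (LBINT t:{0..T}. \<phi> t))) \<longlongrightarrow> 0) at_top"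
  proof (rule tendsto_0_le[where K=1])
    show "((\<lambda>T. K / T) \<longlongrightarrow> 0) at_top"
      by (rule real_tendsto_divide_at_top[OF tendsto_const filterlim_ident])
    show "\<forall>\<^sub>F T in at_top. norm ((1 / T) * ((LBINT t:{0..T}. \<psi> t) - (LBINT t:{0..T}. \<phi> t))) \<le> norm (K / T) * 1"
      using eventually_gt_at_top[of 0]
    proof eventually_elim
      case (elim T)
      then show ?case using K[of T] by (simp add: abs_mult divide_right_mono)
    qed
  qed
  from tendsto_add[OF this assms(1)[unfolded cesaro_def]] show ?thesis
    unfolding cesaro_def by (simp add: algebra_simps)
qed

text \<open>The two integrals differ by one piece of length \<open>c\<close> at each end, hence by a
  bound independent of \<open>T\<close>. This allows waiting until a shifted cylinder lies after a
  given past.\<close>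

lemma cesaro_shift:
  assumes \<phi>: "\<phi> \<in> borel_measurable borel" "\<And>t. \<bar>\<phi> t\<bar> \<le> C" and c: "0 \<le> c"
    and "cesaro (\<lambda>t. \<phi> (t + c)) l"
  shows "cesaro \<phi> l"
proof (rule cesaro_transfer[OF assms(4), where K="2 * C * c"])
  fix T :: real assume T: "0 \<le> T"
  have "(LBINT t:{0..T}. \<phi> (t + c)) = (LBINT t:{c..T + c}. \<phi> t)"
    using set_integral_Icc_shift[of 0 T \<phi> c] by simp
  moreover have "(LBINT t:{0..T + c}. \<phi> t) = (LBINT t:{0..c}. \<phi> t) + (LBINT t:{c..T + c}. \<phi> t)"
    using T c by (intro set_integral_Icc_add[OF \<phi>]) auto
  moreover have "(LBINT t:{0..T + c}. \<phi> t) = (LBINT t:{0..T}. \<phi> t) + (LBINT t:{T..T + c}. \<phi> t)"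
    using T c by (intro set_integral_Icc_add[OF \<phi>]) auto
  moreover have "\<bar>LBINT t:{0..c}. \<phi> t\<bar> \<le> C * (c - 0)" "\<bar>LBINT t:{T..T + c}. \<phi> t\<bar> \<le> C * (T + c - T)"
    using T c by (intro set_integral_Icc_bound[OF \<phi>]; simp)+
  ultimately show "\<bar>(LBINT t:{0..T}. \<phi> t) - (LBINT t:{0..T}. \<phi> (t + c))\<bar> \<le> 2 * C * c"
    by simp
qed

text \<open>\<open>n T\<close> counts the full periods before \<open>T\<close>. The average over
  these periods is rescaled by a factor tending to 1, and the incomplete period contributes at most
  \<open>C * \<tau> / T\<close>.\<close>

lemma cesaro_sequence:
  assumes \<phi>: "\<phi> \<in> borel_measurable borel" "\<And>t. \<bar>\<phi> t\<bar> \<le> C" and \<tau>: "0 < \<tau>"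
  shows "cesaro \<phi> l \<longleftrightarrow> (\<lambda>N. (1 / (real N * \<tau>)) * (LBINT t:{0..real N * \<tau>}. \<phi> t)) \<longlonglongrightarrow> l"
proof
  have N\<tau>: "filterlim (\<lambda>N. real N * \<tau>) at_top sequentially"
    using \<tau> by (intro filterlim_at_top_mult_tendsto_pos[OF tendsto_const] filterlim_real_sequentially)
  show "(\<lambda>N. (1 / (real N * \<tau>)) * (LBINT t:{0..real N * \<tau>}. \<phi> t)) \<longlonglongrightarrow> l" if "cesaro \<phi> l"
    using filterlim_compose[OF that[unfolded cesaro_def] N\<tau>] .
  assume lim: "(\<lambda>N. (1 / (real N * \<tau>)) * (LBINT t:{0..real N * \<tau>}. \<phi> t)) \<longlonglongrightarrow> l"
  define n where "n T = nat \<lfloor>T / \<tau>\<rfloor>" for T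
  have n: "real (n T) * \<tau> \<le> T" "T < real (n T) * \<tau> + \<tau>" if "0 \<le> T" for T
  proof -
    have "real (n T) = of_int \<lfloor>T / \<tau>\<rfloor>" using that \<tau> by (simp add: n_def)
    then have "real (n T) \<le> T / \<tau>" "T / \<tau> < real (n T) + 1" by linarith+
    then show "real (n T) * \<tau> \<le> T" "T < real (n T) * \<tau> + \<tau>"
      using \<tau> by (simp_all add: field_simps)
  qed
  have "filterlim (\<lambda>T. T / \<tau>) at_top at_top"
    using filterlim_tendsto_pos_mult_at_top[OF tendsto_const _ filterlim_ident, of "1 / \<tau>"] \<tau> by simp
  then have n_top: "filterlim n sequentially at_top"
    unfolding n_def
    by (intro filterlim_compose[OF filterlim_nat_sequentially] filterlim_compose[OF filterlim_floor_sequentially])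
  have "((\<lambda>T. (1 / (real (n T) * \<tau>)) * (LBINT t:{0..real (n T) * \<tau>}. \<phi> t)) \<longlongrightarrow> l) at_top"
    by (rule filterlim_compose[OF lim n_top])
  moreover have "((\<lambda>T. real (n T) * \<tau> / T) \<longlongrightarrow> 1) at_top"
  proof (rule tendsto_sandwich)
    show "\<forall>\<^sub>F T in at_top. 1 - \<tau> / T \<le> real (n T) * \<tau> / T"
      using eventually_gt_at_top[of 0]
    proof eventually_elim
      case (elim T)
      then have "T - \<tau> \<le> real (n T) * \<tau>" using n(2)[of T] by simp
      then have "(T - \<tau>) / T \<le> real (n T) * \<tau> / T" using elim by (intro divide_right_mono) auto
      then show ?case using elim by (simp add: diff_divide_distrib)
    qed
    show "\<forall>\<^sub>F T in at_top. real (n T) * \<tau> / T \<le> 1"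
      using eventually_gt_at_top[of 0] by eventually_elim (use n in simp)
    have "((\<lambda>T. \<tau> / T) \<longlongrightarrow> 0) at_top"
      by (rule real_tendsto_divide_at_top[OF tendsto_const filterlim_ident])
    from tendsto_diff[OF tendsto_const this, of 1] show "((\<lambda>T. 1 - \<tau> / T) \<longlongrightarrow> 1) at_top" by simp
  qed simp
  ultimately have "((\<lambda>T. (1 / (real (n T) * \<tau>)) * (LBINT t:{0..real (n T) * \<tau>}. \<phi> t) * (real (n T) * \<tau> / T)) \<longlongrightarrow> l * 1) at_top"
    by (rule tendsto_mult)
  moreover have "((\<lambda>T. (1 / T) * (LBINT t:{real (n T) * \<tau>..T}. \<phi> t)) \<longlongrightarrow> 0) at_top"
  proof (rule tendsto_0_le[where K=1])
    show "((\<lambda>T. C * \<tau> / T) \<longlongrightarrow> 0) at_top"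
      by (rule real_tendsto_divide_at_top[OF tendsto_const filterlim_ident])
    show "\<forall>\<^sub>F T in at_top. norm ((1 / T) * (LBINT t:{real (n T) * \<tau>..T}. \<phi> t)) \<le> norm (C * \<tau> / T) * 1"
      using eventually_gt_at_top[of 0]
    proof eventually_elim
      case (elim T)
      have "0 \<le> C" using \<phi>(2)[of 0] by simp
      have "\<bar>LBINT t:{real (n T) * \<tau>..T}. \<phi> t\<bar> \<le> C * (T - real (n T) * \<tau>)"
        using elim n by (intro set_integral_Icc_bound[OF \<phi>]) auto
      also have "\<dots> \<le> C * \<tau>" using n(2)[of T] elim \<open>0 \<le> C\<close> by (intro mult_left_mono) auto
      finally show ?case using elim \<open>0 \<le> C\<close> \<tau> by (simp add: abs_mult divide_right_mono)
    qed
  qed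
  ultimately have "((\<lambda>T. (1 / (real (n T) * \<tau>)) * (LBINT t:{0..real (n T) * \<tau>}. \<phi> t) * (real (n T) * \<tau> / T)
      + (1 / T) * (LBINT t:{real (n T) * \<tau>..T}. \<phi> t)) \<longlongrightarrow> l * 1 + 0) at_top"
    by (rule tendsto_add)
  moreover have "\<forall>\<^sub>F T in at_top. (1 / (real (n T) * \<tau>)) * (LBINT t:{0..real (n T) * \<tau>}. \<phi> t) * (real (n T) * \<tau> / T)
      + (1 / T) * (LBINT t:{real (n T) * \<tau>..T}. \<phi> t) = (1 / T) * (LBINT t:{0..T}. \<phi> t)"
    \<comment> \<open>From \<open>\<tau>\<close> on there is at least one full period, so
      \<open>n T\<close> may be cancelled.\<close>
    using eventually_ge_at_top[of \<tau>]
  proof eventually_elim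
    case (elim T)
    then have T: "0 \<le> T" "0 < T" using \<tau> by auto
    have "n T \<noteq> 0"
    proof
      assume "n T = 0"
      then show False using n(2)[of T] T elim by simp
    qed
    have "(LBINT t:{0..T}. \<phi> t) = (LBINT t:{0..real (n T) * \<tau>}. \<phi> t) + (LBINT t:{real (n T) * \<tau>..T}. \<phi> t)"
      using T n[of T] \<tau> by (intro set_integral_Icc_add[OF \<phi>]) auto
    then show ?case using \<open>n T \<noteq> 0\<close> T \<tau> by (simp add: field_simps)
  qed
  ultimately show "cesaro \<phi> l"
    unfolding cesaro_def using tendsto_cong by fastforce
qed

text \<open>An approximation uniform in time costs the same in every average. Three errors of at
  most \<open>e / 4\<close> are added: between the functions, between the average of the approximant
  and its limit, and between the limits.\<close>

lemma cesaro_uniform_limit: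
  assumes \<phi>: "\<phi> \<in> borel_measurable borel" "\<And>t. \<bar>\<phi> t\<bar> \<le> C"
    and approx: "\<And>e. 0 < e \<Longrightarrow> \<exists>\<psi> m D. \<psi> \<in> borel_measurable borel \<and> (\<forall>t. \<bar>\<psi> t\<bar> \<le> D) \<and> cesaro \<psi> m
      \<and> (\<forall>t. \<bar>\<phi> t - \<psi> t\<bar> \<le> e) \<and> \<bar>l - m\<bar> \<le> e"
  shows "cesaro \<phi> l"
  unfolding cesaro_def
proof (rule tendstoI)
  fix e :: real assume e: "0 < e"
  then obtain \<psi> m D where \<psi>: "\<psi> \<in> borel_measurable borel" "\<And>t. \<bar>\<psi> t\<bar> \<le> D" "cesaro \<psi> m"
    "\<And>t. \<bar>\<phi> t - \<psi> t\<bar> \<le> e / 4" "\<bar>l - m\<bar> \<le> e / 4"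
    using approx[of "e / 4"] by auto
  have "\<forall>\<^sub>F T in at_top. dist ((1 / T) * (LBINT t:{0..T}. \<psi> t)) m < e / 4"
    using \<psi>(3) e unfolding cesaro_def by (intro tendstoD) auto
  with eventually_gt_at_top[of 0]
  show "\<forall>\<^sub>F T in at_top. dist ((1 / T) * (LBINT t:{0..T}. \<phi> t)) l < e"
  proof eventually_elim
    case (elim T)
    have "(LBINT t:{0..T}. \<phi> t) - (LBINT t:{0..T}. \<psi> t) = (LBINT t:{0..T}. \<phi> t - \<psi> t)"
      by (rule set_integral_diff(2)[symmetric]) (intro bounded_set_integrable[OF \<phi>] bounded_set_integrable[OF \<psi>(1,2)])+
    moreover have "\<bar>LBINT t:{0..T}. \<phi> t - \<psi> t\<bar> \<le> e / 4 * (T - 0)"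
      using \<psi> \<phi> elim by (intro set_integral_Icc_bound) auto
    ultimately have "\<bar>(LBINT t:{0..T}. \<phi> t) - (LBINT t:{0..T}. \<psi> t)\<bar> \<le> e / 4 * T" by simp
    then have "\<bar>(LBINT t:{0..T}. \<phi> t) - (LBINT t:{0..T}. \<psi> t)\<bar> / T \<le> e / 4"
      using elim by (simp add: field_simps)
    then have "\<bar>(1 / T) * (LBINT t:{0..T}. \<phi> t) - (1 / T) * (LBINT t:{0..T}. \<psi> t)\<bar> \<le> e / 4"
      using elim by (simp add: diff_divide_distrib[symmetric])
    then show ?case using elim(2) \<psi>(5) e unfolding dist_real_def by linarith
  qed
qed

text \<open>Bounded measurable functions are uniform limits of staircases, which are built by adding
  one multiple of an indicator at a time. The closure rule asks for uniform rather than monotone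
  limits because Cesaro limits survive uniform errors.\<close>

lemma bounded_measurable_induct[consumes 2, case_names indicator add uniform]:
  fixes f :: "'a::topological_space \<Rightarrow> real"
  assumes f: "f \<in> borel_measurable borel" "\<And>x. \<bar>f x\<bar> \<le> C"
    and ind: "\<And>A. A \<in> sets borel \<Longrightarrow> Q (indicator A)"
    and add: "\<And>f g c C D. f \<in> borel_measurable borel \<Longrightarrow> (\<And>x. \<bar>f x\<bar> \<le> C) \<Longrightarrow> Q f \<Longrightarrow>
      g \<in> borel_measurable borel \<Longrightarrow> (\<And>x. \<bar>g x\<bar> \<le> D) \<Longrightarrow> Q g \<Longrightarrow> Q (\<lambda>x. f x + c * g x)"
    and unif: "\<And>f C. f \<in> borel_measurable borel \<Longrightarrow> (\<And>x. \<bar>f x\<bar> \<le> C) \<Longrightarrow>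
      (\<And>e. 0 < e \<Longrightarrow> \<exists>g D. g \<in> borel_measurable borel \<and> (\<forall>x. \<bar>g x\<bar> \<le> D) \<and> Q g \<and> (\<forall>x. \<bar>f x - g x\<bar> \<le> e)) \<Longrightarrow> Q f"
  shows "Q f"
proof (rule unif[OF f])
  fix e :: real assume e: "0 < e"
  obtain n :: nat where n: "C / e \<le> real n" using real_arch_simple by blast
  \<comment> \<open>The levels rise in steps of \<open>e\<close> from \<open>(1 - n) * e\<close>,
    where \<open>n * e\<close> bounds \<open>f\<close> in absolute value. The number of levels that
    \<open>f x\<close> reaches is the integer part of \<open>f x / e + n\<close>, so
    \<open>g (2 * n)\<close> rounds \<open>f\<close> down to a multiple of \<open>e\<close>.\<close>
  define A where "A i = {x. (real i + 1 - real n) * e \<le> f x}" for i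
  have [measurable]: "f \<in> borel_measurable borel" by (rule f(1))
  have A: "A i \<in> sets borel" for i
  proof -
    have "{x \<in> space borel. (real i + 1 - real n) * e \<le> f x} \<in> sets borel" by measurable
    then show ?thesis by (simp add: A_def)
  qed
  define g where "g m x = - (real n * e) + e * (\<Sum>i<m. indicator (A i) x)" for m x
  have gm: "g m \<in> borel_measurable borel" for m
    unfolding g_def using A by measurable
  have gb: "\<bar>g m x\<bar> \<le> real n * e + e * real m" for m x
  proof -
    have "\<bar>\<Sum>i<m. indicator (A i) x :: real\<bar> \<le> (\<Sum>i<m. 1)"
      by (rule order_trans[OF sum_abs sum_mono]) (simp split: split_indicator)
    then have "\<bar>e * (\<Sum>i<m. indicator (A i) x)\<bar> \<le> e * real m" using e by (simp add: abs_mult)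
    moreover have "\<bar>- (real n * e)\<bar> = real n * e" using e by simp
    ultimately show ?thesis unfolding g_def by linarith
  qed
  have "Q (g m)" for m
  proof (induction m)
    case 0
    \<comment> \<open>A constant is built from the indicators of the empty set and of the whole
      space, the only functions available at the start.\<close>
    have "Q (\<lambda>x. indicator {} x + (- (real n * e)) * indicator UNIV x)"
      by (rule add[OF _ _ ind _ _ ind, where C=1 and D=1]) auto
    then show ?case by (simp add: g_def)
  next
    case (Suc m)
    have "Q (\<lambda>x. g m x + e * indicator (A m) x)"
      by (rule add[OF gm gb Suc, where D=1]) (use A in \<open>auto intro: ind split: split_indicator\<close>)
    moreover have "(\<lambda>x. g m x + e * indicator (A m) x) = g (Suc m)"
      by (auto simp: g_def algebra_simps)
    ultimately show ?case by simp
  qed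
  moreover have "\<bar>f x - g (2 * n) x\<bar> \<le> e" for x
  proof -
    define k where "k = nat \<lfloor>f x / e + real n\<rfloor>"
    have fe: "\<bar>f x / e\<bar> \<le> real n"
      using f(2)[of x] e n by (simp add: abs_div divide_right_mono order_trans[OF divide_right_mono n])
    have "0 \<le> f x / e + real n" using fe by (simp only: abs_le_iff) linarith
    then have "0 \<le> \<lfloor>f x / e + real n\<rfloor>" by (simp only: zero_le_floor)
    then have k: "real k = of_int \<lfloor>f x / e + real n\<rfloor>" unfolding k_def by (rule of_nat_nat)
    then have k': "real k \<le> f x / e + real n" "f x / e + real n < real k + 1" by linarith+
    have "k \<le> 2 * n" using k'(1) fe by linarith
    have "indicator (A i) x = (if i < k then 1 else 0 :: real)" for i
    proof -
      have "x \<in> A i \<longleftrightarrow> real i + 1 \<le> f x / e + real n"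
        using e by (simp add: A_def field_simps)
      also have "\<dots> \<longleftrightarrow> i < k" using k' by linarith
      finally show ?thesis by simp
    qed
    then have "(\<Sum>i<2 * n. indicator (A i) x) = (\<Sum>i<2 * n. if i < k then 1 else 0 :: real)" by simp
    also have "\<dots> = real (card {i. i < 2 * n \<and> i < k})"
      by (subst sum.If_cases) (auto simp: Int_def lessThan_def)
    also have "{i. i < 2 * n \<and> i < k} = {..<k}" using \<open>k \<le> 2 * n\<close> by auto
    finally have "g (2 * n) x = e * (real k - real n)" by (simp add: g_def algebra_simps)
    moreover have "e * (real k - real n) \<le> f x" "f x \<le> e * (real k + 1 - real n)"
      using k' e by (simp_all add: field_simps)
    ultimately show ?thesis by (simp add: algebra_simps abs_le_iff)
  qed
  ultimately show "\<exists>g D. g \<in> borel_measurable borel \<and> (\<forall>x. \<bar>g x\<bar> \<le> D) \<and> Q g \<and> (\<forall>x. \<bar>f x - g x\<bar> \<le> e)"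
    using gm gb by blast
qed

lemma Fubini_time:
  fixes F :: "real \<Rightarrow> 'a \<Rightarrow> real"
  assumes M: "prob_space M" and F[measurable]: "(\<lambda>(t, x). F t x) \<in> borel_measurable (borel \<Otimes>\<^sub>M M)"
    and C: "\<And>t x. x \<in> space M \<Longrightarrow> \<bar>F t x\<bar> \<le> C"
  shows "(LBINT t:{a..b}. \<integral>x. F t x \<partial>M) = (\<integral>x. (LBINT t:{a..b}. F t x) \<partial>M)"
proof -
  interpret M: prob_space M by fact
  interpret pair_sigma_finite lborel M by unfold_locales
  have "sets (lborel \<Otimes>\<^sub>M M) = sets (borel \<Otimes>\<^sub>M M)"
    by (intro sets_pair_measure_cong) auto
  then have F'[measurable]: "(\<lambda>(t, x). F t x) \<in> borel_measurable (lborel \<Otimes>\<^sub>M M)"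
    using F by (simp cong: measurable_cong_sets)
  have "integrable (lborel \<Otimes>\<^sub>M M) (\<lambda>p. indicator ({a..b} \<times> space M) p *\<^sub>R (case p of (t, x) \<Rightarrow> F t x))"
    by (rule integrableI_bounded_set_indicator[where B=C])
       (use C in \<open>auto simp: M.emeasure_pair_measure_Times emeasure_lborel_Icc_eq M.emeasure_space_1\<close>)
  also have "?this \<longleftrightarrow> integrable (lborel \<Otimes>\<^sub>M M) (case_prod (\<lambda>t x. indicator {a..b} t *\<^sub>R F t x))"
    by (intro Bochner_Integration.integrable_cong refl) (auto simp: space_pair_measure indicator_def)
  finally have "integrable (lborel \<Otimes>\<^sub>M M) (case_prod (\<lambda>t x. indicator {a..b} t *\<^sub>R F t x))" .
  from Fubini_integral[OF this] show ?thesis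
    by (simp add: set_lebesgue_integral_def)
qed

lemma measurable_time_integral:
  fixes F :: "real \<Rightarrow> 'a \<Rightarrow> real"
  assumes F: "(\<lambda>(t, x). F t x) \<in> borel_measurable (borel \<Otimes>\<^sub>M M)"
  shows "(\<lambda>x. LBINT t:{a..b}. F t x) \<in> borel_measurable M"
proof -
  have "(\<lambda>(x, t). indicator {a..b} t *\<^sub>R F t x) \<in> borel_measurable (M \<Otimes>\<^sub>M lborel)"
  proof -
    have "(\<lambda>(t, x). F t x) \<in> borel_measurable (lborel \<Otimes>\<^sub>M M)"
      using F by (simp cong: measurable_cong_sets sets_pair_measure_cong)
    from measurable_compose[OF measurable_pair_swap' this]
    have [measurable]: "(\<lambda>p. F (snd p) (fst p)) \<in> borel_measurable (M \<Otimes>\<^sub>M lborel)"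
      by (simp add: case_prod_beta')
    show ?thesis unfolding case_prod_beta' by measurable
  qed
  then show ?thesis
    unfolding set_lebesgue_integral_def
    by (rule sigma_finite_measure.borel_measurable_lebesgue_integral[OF sigma_finite_lborel])
qed

text \<open>Summed up, the recursion bounds \<open>S n\<close> by twice the sum of the
  \<open>c k\<close>, which is of smaller order than the square of \<open>n\<close>.
  \<open>D\<close> collects the finitely many early terms, so that one linear bound on
  \<open>c n\<close> serves all \<open>n\<close> in the induction.\<close>

lemma square_growth_tendsto_zero:
  fixes S c :: "nat \<Rightarrow> real"
  assumes S0: "S 0 = 0" and Spos: "\<And>n. 0 \<le> S n" and step: "\<And>n. S (Suc n) \<le> S n + 2 * c (Suc n)"
    and c: "(\<lambda>n. c n / real n) \<longlonglongrightarrow> 0"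
  shows "(\<lambda>n. S n / (real n)\<^sup>2) \<longlonglongrightarrow> 0"
proof (rule LIMSEQ_I)
  fix e :: real assume e: "0 < e"
  from LIMSEQ_D[OF c, of "e / 8"] e obtain K where K: "\<And>n. K \<le> n \<Longrightarrow> \<bar>c n / real n\<bar> < e / 8" by auto
  define D where "D = (\<Sum>k\<le>K. \<bar>c k\<bar>)"
  have "0 \<le> D" unfolding D_def by (intro sum_nonneg) simp
  have cD: "c n \<le> D + e / 8 * real n" for n
  proof (cases "n \<le> K")
    case True
    then have "\<bar>c n\<bar> \<le> D" unfolding D_def by (intro member_le_sum) auto
    moreover have "0 \<le> e / 8 * real n" using e by simp
    ultimately show ?thesis by linarith
  next
    case False
    then have "0 < real n" "\<bar>c n\<bar> / real n < e / 8" using K[of n] by (auto simp: abs_divide)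
    then have "\<bar>c n\<bar> \<le> e / 8 * real n" by (simp add: pos_divide_less_eq)
    then show ?thesis using \<open>0 \<le> D\<close> by linarith
  qed
  have Sn: "S n \<le> real n * (2 * D + e / 4 * real n)" for n
  proof (induction n)
    case (Suc n)
    have "S (Suc n) \<le> real n * (2 * D + e / 4 * real n) + 2 * (D + e / 8 * real (Suc n))"
      by (rule order_trans[OF step add_mono[OF Suc]]) (use cD[of "Suc n"] in simp)
    also have "\<dots> \<le> real (Suc n) * (2 * D + e / 4 * real (Suc n))"
      using e by (simp add: algebra_simps)
    finally show ?case .
  qed (simp add: S0)
  obtain N :: nat where N: "4 * D / e < real N" using reals_Archimedean2 by blast
  show "\<exists>no. \<forall>n\<ge>no. norm (S n / (real n)\<^sup>2 - 0) < e"
  proof (intro exI allI impI)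
    fix n assume n: "Suc N \<le> n"
    then have n0: "0 < real n" and "4 * D / e < real n" using N by auto
    then have "2 * D < e / 2 * real n" using e by (simp add: field_simps)
    have "S n / (real n)\<^sup>2 \<le> real n * (2 * D + e / 4 * real n) / (real n)\<^sup>2"
      using Sn[of n] by (intro divide_right_mono) auto
    also have "\<dots> = (2 * D + e / 4 * real n) / real n" using n0 by (simp add: power2_eq_square)
    also have "\<dots> < (e / 2 * real n + e / 4 * real n) / real n"
      using \<open>2 * D < e / 2 * real n\<close> n0 by (intro divide_strict_right_mono) auto
    also have "\<dots> \<le> e" using n0 e by (simp add: field_simps)
    finally show "norm (S n / (real n)\<^sup>2 - 0) < e" using Spos[of n] by simp
  qed
qed

text \<open>Nonnegativity of the variance.\<close>

lemma (in prob_space) integral_square_le: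
  fixes f :: "'a \<Rightarrow> real"
  assumes f: "f \<in> borel_measurable M" "\<And>x. x \<in> space M \<Longrightarrow> \<bar>f x\<bar> \<le> C"
  shows "(\<integral>x. f x \<partial>M)\<^sup>2 \<le> (\<integral>x. (f x)\<^sup>2 \<partial>M)"
proof -
  note [measurable] = f(1)
  have "integrable M f" by (rule integral_abs_le(1)[OF f])
  moreover have "integrable M (\<lambda>x. (f x)\<^sup>2)"
  proof (rule integral_abs_le(1))
    show "\<bar>(f x)\<^sup>2\<bar> \<le> C\<^sup>2" if "x \<in> space M" for x
      using power_mono[OF f(2)[OF that], of 2] by simp
  qed measurable
  ultimately show ?thesis using variance_eq[of f] variance_positive[of f] by simp
qed

text \<open>The shift is a bijection, so the image in the ergodicity condition is a preimage under a
  measurable map.\<close>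

lemma path_shift_image: "path_shift (- t) ` A = path_shift t -` A"
proof (intro equalityI subsetI)
  fix \<omega> assume "\<omega> \<in> path_shift (- t) ` A"
  then show "\<omega> \<in> path_shift t -` A" by (auto simp: path_shift_def)
next
  fix \<omega> assume "\<omega> \<in> path_shift t -` A"
  moreover have "\<omega> = path_shift (- t) (path_shift t \<omega>)" by (simp add: path_shift_def)
  ultimately show "\<omega> \<in> path_shift (- t) ` A" by blast
qed

section \<open>Ergodicity and convergence of the mean transition probabilities\<close>

context stochastically_continuous_transition
begin

lemma transition_pair_measurable:
  fixes f :: "'a \<Rightarrow> real"
  assumes f: "f \<in> borel_measurable borel"
  shows "(\<lambda>(t, x). \<integral>y. f y \<partial>P (max 0 t) x) \<in> borel_measurable (borel \<Otimes>\<^sub>M borel)"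
  using measurable_compose[OF measurable_prob_algebraD[OF kernel_pair_measurable]
      integral_measurable_subprob_algebra[OF f]] by (simp add: case_prod_beta')

lemma transition_measurable:
  fixes f :: "'a \<Rightarrow> real"
  assumes "0 \<le> t" "f \<in> borel_measurable borel"
  shows "(\<lambda>x. \<integral>y. f y \<partial>P t x) \<in> borel_measurable borel"
  using measurable_compose[OF measurable_prob_algebraD[OF kernel_measurable[OF assms(1)]]
      integral_measurable_subprob_algebra[OF assms(2)]] by simp

lemma transition_bound:
  fixes f :: "'a \<Rightarrow> real"
  assumes "0 \<le> t" "f \<in> borel_measurable borel" "\<And>x. \<bar>f x\<bar> \<le> C"
  shows "\<bar>\<integral>y. f y \<partial>P t x\<bar> \<le> C"
  using assms sets_kernel[OF assms(1), of x]
  by (intro prob_space.integral_abs_le(2)[OF prob_space_kernel]) (auto cong: measurable_cong_sets)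

lemma transition_add:
  fixes f :: "'a \<Rightarrow> real"
  assumes "0 \<le> s" "0 \<le> t" "f \<in> borel_measurable borel" "\<And>x. \<bar>f x\<bar> \<le> C"
  shows "(\<integral>y. f y \<partial>P (s + t) x) = (\<integral>z. \<integral>y. f y \<partial>P t z \<partial>P s x)"
  unfolding kernel_add[OF assms(1,2)]
  by (rule integral_bind_prob_algebra[OF kernel_in_prob_algebra kernel_measurable]) (use assms in auto)

lemma transition_invariant:
  fixes f :: "'a \<Rightarrow> real"
  assumes "invariant_measure P \<mu>" "0 \<le> t" "f \<in> borel_measurable borel" "\<And>x. \<bar>f x\<bar> \<le> C"
  shows "(\<integral>x. \<integral>y. f y \<partial>P t x \<partial>\<mu>) = (\<integral>y. f y \<partial>\<mu>)"
proof -
  have "(\<integral>y. f y \<partial>(\<mu> \<bind> P t)) = (\<integral>x. \<integral>y. f y \<partial>P t x \<partial>\<mu>)"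
    by (rule integral_bind_prob_algebra[OF _ kernel_measurable])
       (use assms in \<open>auto simp: invariant_measure_def\<close>)
  then show ?thesis using invariant_measure_bind[OF assms(1,2)] by simp
qed

context
  fixes \<mu> :: "'a measure"
  assumes \<mu>: "invariant_measure P \<mu>"
begin

lemma
  shows prob_space_invariant: "prob_space \<mu>" and sets_invariant: "sets \<mu> = sets borel"
    and space_invariant: "space \<mu> = UNIV"
  using \<mu> prob_algebra_borelD[of \<mu>] by (auto simp: invariant_measure_def)

lemma correlation_measurable:
  fixes f h :: "'a \<Rightarrow> real"
  assumes f: "f \<in> borel_measurable borel" and h: "h \<in> borel_measurable borel"
  shows "(\<lambda>t. \<integral>x. h x * (\<integral>y. f y \<partial>P (max 0 t) x) \<partial>\<mu>) \<in> borel_measurable borel"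
proof -
  interpret prob_space \<mu> by (rule prob_space_invariant)
  have [measurable]: "(\<lambda>(t, x). \<integral>y. f y \<partial>P (max 0 t) x) \<in> borel_measurable (borel \<Otimes>\<^sub>M \<mu>)"
    using transition_pair_measurable[OF f] sets_invariant
    by (simp cong: measurable_cong_sets sets_pair_measure_cong)
  have [measurable]: "h \<in> borel_measurable \<mu>"
    using h sets_invariant by (simp cong: measurable_cong_sets)
  show ?thesis by measurable
qed

lemma correlation_bound:
  fixes f h :: "'a \<Rightarrow> real"
  assumes f: "f \<in> borel_measurable borel" "\<And>x. \<bar>f x\<bar> \<le> C" and h: "h \<in> borel_measurable borel" "\<And>x. \<bar>h x\<bar> \<le> D"
  shows "\<bar>\<integral>x. h x * (\<integral>y. f y \<partial>P (max 0 t) x) \<partial>\<mu>\<bar> \<le> D * C"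
proof (rule prob_space.integral_abs_le(2)[OF prob_space_invariant])
  show "(\<lambda>x. h x * (\<integral>y. f y \<partial>P (max 0 t) x)) \<in> borel_measurable \<mu>"
    using h transition_measurable[OF _ f(1), of "max 0 t"] sets_invariant by (simp cong: measurable_cong_sets)
  show "\<bar>h x * (\<integral>y. f y \<partial>P (max 0 t) x)\<bar> \<le> D * C" for x
    unfolding abs_mult using h(2)[of x] transition_bound[OF _ f, of "max 0 t" x]
    by (intro mult_mono) auto
qed

lemma correlation_integrable:
  fixes f h :: "'a \<Rightarrow> real"
  assumes f: "f \<in> borel_measurable borel" "\<And>x. \<bar>f x\<bar> \<le> C" and h: "h \<in> borel_measurable borel" "\<And>x. \<bar>h x\<bar> \<le> D"
  shows "integrable \<mu> (\<lambda>x. h x * (\<integral>y. f y \<partial>P (max 0 t) x))"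
proof (rule prob_space.integral_abs_le(1)[OF prob_space_invariant])
  show "(\<lambda>x. h x * (\<integral>y. f y \<partial>P (max 0 t) x)) \<in> borel_measurable \<mu>"
    using h transition_measurable[OF _ f(1), of "max 0 t"] sets_invariant by (simp cong: measurable_cong_sets)
  show "\<bar>h x * (\<integral>y. f y \<partial>P (max 0 t) x)\<bar> \<le> D * C" for x
    unfolding abs_mult using h(2)[of x] transition_bound[OF _ f, of "max 0 t" x]
    by (intro mult_mono) auto
qed

text \<open>Ergodicity speaks of sets \<open>\<Delta>\<close>, while the recursion for the squared
  norms is tested against a bounded function. The correlation is linear in \<open>h\<close> and,
  uniformly in time, Lipschitz for the supremum norm.\<close>

lemma cesaro_correlation_bounded:
  fixes f h :: "'a \<Rightarrow> real"
  assumes f: "f \<in> borel_measurable borel" "\<And>x. \<bar>f x\<bar> \<le> C"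
    and ind: "\<And>\<Delta>. \<Delta> \<in> sets borel \<Longrightarrow> cesaro (\<lambda>t. \<integral>x. indicator \<Delta> x * (\<integral>y. f y \<partial>P (max 0 t) x) \<partial>\<mu>) 0"
    and h: "h \<in> borel_measurable borel" "\<And>x. \<bar>h x\<bar> \<le> D"
  shows "cesaro (\<lambda>t. \<integral>x. h x * (\<integral>y. f y \<partial>P (max 0 t) x) \<partial>\<mu>) 0"
  using h
proof (induction h rule: bounded_measurable_induct)
  case (indicator A)
  then show ?case by (rule ind)
next
  case (add g h c D E)
  have "(\<integral>x. (g x + c * h x) * (\<integral>y. f y \<partial>P (max 0 t) x) \<partial>\<mu>)
    = (\<integral>x. g x * (\<integral>y. f y \<partial>P (max 0 t) x) \<partial>\<mu>) + c * (\<integral>x. h x * (\<integral>y. f y \<partial>P (max 0 t) x) \<partial>\<mu>)" for t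
    using correlation_integrable[OF f add(1,2), of t] correlation_integrable[OF f add(3,4), of t]
    by (simp add: distrib_right mult.assoc)
  moreover have "cesaro (\<lambda>t. (\<integral>x. g x * (\<integral>y. f y \<partial>P (max 0 t) x) \<partial>\<mu>)
      + c * (\<integral>x. h x * (\<integral>y. f y \<partial>P (max 0 t) x) \<partial>\<mu>)) (0 + c * 0)"
    using add f by (intro cesaro_add_mult[where C="D * C" and D="E * C"] correlation_measurable correlation_bound)
  ultimately show ?case by simp
next
  case (uniform h D)
  have C0: "0 \<le> C" using f(2)[of undefined] by simp
  show ?case
  proof (rule cesaro_uniform_limit[OF correlation_measurable[OF f(1) uniform(1)] correlation_bound[OF f uniform(1,2)]])
    fix e :: real assume e: "0 < e"
    \<comment> \<open>\<open>C + 1\<close> instead of \<open>C\<close> avoids a division by zero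
      when the bound \<open>C\<close> is 0.\<close>
    then have "0 < e / (C + 1)" using C0 by simp
    then obtain g E where g: "g \<in> borel_measurable borel" "\<And>x. \<bar>g x\<bar> \<le> E"
      "cesaro (\<lambda>t. \<integral>x. g x * (\<integral>y. f y \<partial>P (max 0 t) x) \<partial>\<mu>) 0" "\<And>x. \<bar>h x - g x\<bar> \<le> e / (C + 1)"
      using uniform(3)[of "e / (C + 1)"] by blast
    have "\<bar>(\<integral>x. h x * (\<integral>y. f y \<partial>P (max 0 t) x) \<partial>\<mu>) - (\<integral>x. g x * (\<integral>y. f y \<partial>P (max 0 t) x) \<partial>\<mu>)\<bar> \<le> e" for t
    proof -
      have "(\<integral>x. h x * (\<integral>y. f y \<partial>P (max 0 t) x) \<partial>\<mu>) - (\<integral>x. g x * (\<integral>y. f y \<partial>P (max 0 t) x) \<partial>\<mu>)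
        = (\<integral>x. (h x - g x) * (\<integral>y. f y \<partial>P (max 0 t) x) \<partial>\<mu>)"
        using correlation_integrable[OF f uniform(1,2), of t] correlation_integrable[OF f g(1,2), of t]
        by (simp add: left_diff_distrib)
      also have "\<bar>\<dots>\<bar> \<le> e / (C + 1) * C"
        using uniform(1) g by (intro correlation_bound f) auto
      also have "\<dots> \<le> e" using e C0 by (simp add: field_simps)
      finally show ?thesis .
    qed
    then show "\<exists>\<psi> m D. \<psi> \<in> borel_measurable borel \<and> (\<forall>t. \<bar>\<psi> t\<bar> \<le> D) \<and> cesaro \<psi> m
      \<and> (\<forall>t. \<bar>(\<integral>x. h x * (\<integral>y. f y \<partial>P (max 0 t) x) \<partial>\<mu>) - \<psi> t\<bar> \<le> e) \<and> \<bar>0 - m\<bar> \<le> e"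
      using correlation_measurable[OF f(1) g(1)] correlation_bound[OF f g(1,2)] g(3) e
      by (intro exI[of _ "\<lambda>t. \<integral>x. g x * (\<integral>y. f y \<partial>P (max 0 t) x) \<partial>\<mu>"] exI[of _ 0] exI[of _ "E * C"]) auto
  qed
qed

text \<open>
  Writing \<open>W n\<close> for the time integral up to \<open>n\<tau>\<close> and \<open>Q\<close> for the operator \<open>P \<tau>\<close>, one has
  \<open>W (n + 1) = W 1 + Q (W n)\<close>. As \<open>Q\<close> contracts the \<open>L\<^sup>2\<close> norm, expanding the square gives
  \<open>\<parallel>W (n + 1)\<parallel>\<^sup>2 \<le> \<parallel>W n\<parallel>\<^sup>2 + 2 \<langle>W 1, W (n + 1)\<rangle>\<close>, so weak decay of the averages implies strong decay.
\<close>

lemma weak_mean_imp_strong_mean: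
  fixes f :: "'a \<Rightarrow> real"
  assumes f: "f \<in> borel_measurable borel" "\<And>x. \<bar>f x\<bar> \<le> C" and \<tau>: "0 < \<tau>"
    and weak: "\<And>\<Delta>. \<Delta> \<in> sets borel \<Longrightarrow> cesaro (\<lambda>t. \<integral>x. indicator \<Delta> x * (\<integral>y. f y \<partial>P (max 0 t) x) \<partial>\<mu>) 0"
  shows "(\<lambda>N. \<integral>x. \<bar>(1 / (real N * \<tau>)) * (LBINT t:{0..real N * \<tau>}. \<integral>y. f y \<partial>P (max 0 t) x)\<bar> \<partial>\<mu>) \<longlonglongrightarrow> 0"
proof -
  interpret prob_space \<mu> by (rule prob_space_invariant)
  note [measurable_cong] = sets_invariant
  define a where "a t x = (\<integral>y. f y \<partial>P (max 0 t) x)" for t x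
  define W where "W n x = (LBINT t:{0..real n * \<tau>}. a t x)" for n :: nat and x
  define h where "h = W 1"
  define Q where "Q g x = (\<integral>y. g y \<partial>P \<tau> x)" for g :: "'a \<Rightarrow> real" and x
  have C0: "0 \<le> C" using f(2)[of undefined] by simp
  have am: "(\<lambda>(t, x). a t x) \<in> borel_measurable (borel \<Otimes>\<^sub>M borel)"
    unfolding a_def by (rule transition_pair_measurable[OF f(1)])
  have at: "(\<lambda>t. a t x) \<in> borel_measurable borel" for x
    using measurable_Pair2'[of x borel borel] measurable_compose[OF _ am, of "\<lambda>t. (t, x)" borel] by simp
  have ab: "\<bar>a t x\<bar> \<le> C" for t x
    unfolding a_def by (rule transition_bound[OF _ f]) simp
  have Wm[measurable]: "W n \<in> borel_measurable borel" for n
    unfolding W_def by (rule measurable_time_integral[OF am])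
  have Wb: "\<bar>W n x\<bar> \<le> C * (real n * \<tau>)" for n x
    unfolding W_def using set_integral_Icc_bound[OF at ab, of 0 "real n * \<tau>" x] \<tau> by simp
  have hm: "h \<in> borel_measurable borel" and hb: "\<bar>h x\<bar> \<le> C * \<tau>" for x
    using Wm[of 1] Wb[of 1 x] by (auto simp: h_def)
  \<comment> \<open>The first period is split off. By the semigroup law and Fubini, the rest is the
    integral over \<open>n\<close> periods seen from one period later, that is, averaged by
    \<open>P \<tau>\<close>.\<close>
  have W_Suc: "W (Suc n) x = h x + Q (W n) x" for n x
  proof -
    have s\<tau>: "sets (P \<tau> x) = sets borel" "space (P \<tau> x) = UNIV"
      using \<tau> by (auto simp: sets_kernel space_kernel)
    have "Q (W n) x = (LBINT t:{0..real n * \<tau>}. \<integral>y. a t y \<partial>P \<tau> x)"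
      unfolding Q_def W_def
    proof (rule Fubini_time[symmetric, where C=C])
      show "prob_space (P \<tau> x)" using \<tau> by (intro prob_space_kernel) simp
      show "(\<lambda>(t, y). a t y) \<in> borel_measurable (borel \<Otimes>\<^sub>M P \<tau> x)"
        using am s\<tau>(1) by (simp cong: measurable_cong_sets sets_pair_measure_cong)
    qed (rule ab)
    also have "\<dots> = (LBINT t:{0..real n * \<tau>}. a (t + \<tau>) x)"
    proof (rule set_lebesgue_integral_cong)
      show "\<forall>t. t \<in> {0..real n * \<tau>} \<longrightarrow> (\<integral>y. a t y \<partial>P \<tau> x) = a (t + \<tau>) x"
        using transition_add[OF less_imp_le[OF \<tau>] _ f] \<tau> by (auto simp: a_def add.commute)
    qed simp
    also have "\<dots> = (LBINT t:{\<tau>..real (Suc n) * \<tau>}. a t x)"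
      using set_integral_Icc_shift[of 0 "real n * \<tau>" "\<lambda>t. a t x" \<tau>] by (simp add: algebra_simps)
    finally show ?thesis
      using set_integral_Icc_add[OF at ab, of 0 \<tau> "real (Suc n) * \<tau>" x] \<tau>
      by (simp add: h_def W_def)
  qed
  define S where "S n = (\<integral>x. (W n x)\<^sup>2 \<partial>\<mu>)" for n
  define c where "c n = (\<integral>x. h x * W n x \<partial>\<mu>)" for n
  have sq_bound: "\<bar>(g x)\<^sup>2\<bar> \<le> B\<^sup>2" if "\<bar>g x\<bar> \<le> B" for g :: "'a \<Rightarrow> real" and B x
    using power_mono[OF that, of 2] by simp
  have W2i: "integrable \<mu> (\<lambda>x. (W n x)\<^sup>2)" for n
    by (rule integral_abs_le(1)[OF _ sq_bound[OF Wb]]) measurable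
  have hW: "\<bar>h x * W n x\<bar> \<le> C * \<tau> * (C * (real n * \<tau>))" for n x
    unfolding abs_mult using hb[of x] Wb[of n x] by (intro mult_mono) auto
  have [measurable]: "h \<in> borel_measurable borel" by (rule hm)
  have hWi: "integrable \<mu> (\<lambda>x. h x * W n x)" for n
    by (rule integral_abs_le(1)[OF _ hW]) measurable
  have QW: "\<bar>Q (W n) x\<bar> \<le> C * (real n * \<tau>)" for n x
    unfolding Q_def using \<tau> by (intro transition_bound Wm Wb) auto
  have QWm[measurable]: "Q (W n) \<in> borel_measurable borel" for n
    using transition_measurable[OF less_imp_le[OF \<tau>] Wm[of n]] by (simp add: Q_def[abs_def])
  have QW2i: "integrable \<mu> (\<lambda>x. (Q (W n) x)\<^sup>2)" for n
    by (rule integral_abs_le(1)[OF _ sq_bound[OF QW]]) measurable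
  \<comment> \<open>Jensen for each probability \<open>P \<tau> x\<close>, then invariance of
    \<open>\<mu>\<close>.\<close>
  have contraction: "(\<integral>x. (Q (W n) x)\<^sup>2 \<partial>\<mu>) \<le> S n" for n
  proof -
    have W2b: "\<bar>(W n x)\<^sup>2\<bar> \<le> (C * (real n * \<tau>))\<^sup>2" for x by (rule sq_bound[OF Wb])
    have W2m: "(\<lambda>x. (W n x)\<^sup>2) \<in> borel_measurable borel" by measurable
    have [measurable]: "(\<lambda>x. \<integral>y. (W n y)\<^sup>2 \<partial>P \<tau> x) \<in> borel_measurable borel"
      by (rule transition_measurable[OF less_imp_le[OF \<tau>] W2m])
    have "(\<integral>x. (Q (W n) x)\<^sup>2 \<partial>\<mu>) \<le> (\<integral>x. \<integral>y. (W n y)\<^sup>2 \<partial>P \<tau> x \<partial>\<mu>)"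
    proof (rule integral_mono[OF QW2i])
      show "integrable \<mu> (\<lambda>x. \<integral>y. (W n y)\<^sup>2 \<partial>P \<tau> x)"
        by (rule integral_abs_le(1)[OF _ transition_bound[OF less_imp_le[OF \<tau>] W2m W2b]]) measurable
      fix x
      show "(Q (W n) x)\<^sup>2 \<le> (\<integral>y. (W n y)\<^sup>2 \<partial>P \<tau> x)"
        unfolding Q_def
        by (rule prob_space.integral_square_le[OF prob_space_kernel _ Wb])
           (use Wm \<tau> sets_kernel[of \<tau> x] in \<open>auto cong: measurable_cong_sets\<close>)
    qed
    also have "\<dots> = S n"
      unfolding S_def by (rule transition_invariant[OF \<mu> less_imp_le[OF \<tau>] W2m W2b])
    finally show ?thesis .
  qed
  have step: "S (Suc n) \<le> S n + 2 * c (Suc n)" for n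
  proof -
    have "S (Suc n) \<le> (\<integral>x. (Q (W n) x)\<^sup>2 + 2 * (h x * W (Suc n) x) \<partial>\<mu>)"
      unfolding S_def
    proof (rule integral_mono[OF W2i])
      show "integrable \<mu> (\<lambda>x. (Q (W n) x)\<^sup>2 + 2 * (h x * W (Suc n) x))"
        using QW2i hWi by auto
      fix x
      \<comment> \<open>\<open>Q (W n)\<close> is \<open>W (Suc n) - h\<close>. Expanded around
        \<open>W (Suc n)\<close>, the square leaves minus the square of \<open>h\<close>, which has
        the right sign to be dropped, and a cross term with the fixed function
        \<open>h\<close>.\<close>
      have "(W (Suc n) x)\<^sup>2 = (Q (W n) x)\<^sup>2 + 2 * (h x * W (Suc n) x) - (h x)\<^sup>2"
        unfolding W_Suc by (simp add: power2_eq_square algebra_simps)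
      then show "(W (Suc n) x)\<^sup>2 \<le> (Q (W n) x)\<^sup>2 + 2 * (h x * W (Suc n) x)" by simp
    qed
    also have "\<dots> = (\<integral>x. (Q (W n) x)\<^sup>2 \<partial>\<mu>) + 2 * c (Suc n)"
      unfolding c_def using QW2i hWi by simp
    finally show ?thesis using contraction[of n] by linarith
  qed
  \<comment> \<open>By Fubini \<open>c n\<close> is a time integral of correlations with
    \<open>h\<close>, the form in which weak decay is available.\<close>
  have c_eq: "c n = (LBINT t:{0..real n * \<tau>}. \<integral>x. h x * a t x \<partial>\<mu>)" for n
  proof -
    have "(LBINT t:{0..real n * \<tau>}. \<integral>x. h x * a t x \<partial>\<mu>) = (\<integral>x. (LBINT t:{0..real n * \<tau>}. h x * a t x) \<partial>\<mu>)"
    proof (rule Fubini_time[where C="C * \<tau> * C"])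
      have [measurable]: "(\<lambda>(t, x). a t x) \<in> borel_measurable (borel \<Otimes>\<^sub>M \<mu>)"
        using am sets_invariant by (simp cong: measurable_cong_sets sets_pair_measure_cong)
      have [measurable]: "h \<in> borel_measurable \<mu>" using hm by measurable
      show "(\<lambda>(t, x). h x * a t x) \<in> borel_measurable (borel \<Otimes>\<^sub>M \<mu>)" by measurable
      show "\<bar>h x * a t x\<bar> \<le> C * \<tau> * C" for t x
        unfolding abs_mult using hb[of x] ab[of t x] by (intro mult_mono) auto
    qed (rule prob_space_invariant)
    then show ?thesis by (simp add: c_def W_def)
  qed
  have "cesaro (\<lambda>t. \<integral>x. h x * a t x \<partial>\<mu>) 0"
    unfolding a_def by (rule cesaro_correlation_bounded[OF f weak hm hb])
  also have "?this \<longleftrightarrow> (\<lambda>N. (1 / (real N * \<tau>)) * (LBINT t:{0..real N * \<tau>}. \<integral>x. h x * a t x \<partial>\<mu>)) \<longlonglongrightarrow> 0"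
    unfolding a_def
    by (rule cesaro_sequence[OF correlation_measurable[OF f(1) hm] correlation_bound[OF f hm hb] \<tau>])
  finally have "(\<lambda>n. (1 / (real n * \<tau>)) * c n) \<longlonglongrightarrow> 0" by (simp only: c_eq)
  from tendsto_mult_right[OF this, of \<tau>] have "(\<lambda>n. c n / real n) \<longlonglongrightarrow> 0"
    using \<tau> by (simp add: mult.commute)
  moreover have "S 0 = 0" using Wb[of 0] by (simp add: S_def)
  moreover have "0 \<le> S n" for n unfolding S_def by (intro Bochner_Integration.integral_nonneg) simp
  ultimately have "(\<lambda>n. S n / (real n)\<^sup>2) \<longlonglongrightarrow> 0"
    using step by (intro square_growth_tendsto_zero)
  from tendsto_mult_left[OF tendsto_real_sqrt[OF this], of "1 / \<tau>"]
  have lim: "(\<lambda>n. (1 / \<tau>) * sqrt (S n / (real n)\<^sup>2)) \<longlonglongrightarrow> 0" by simp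
  show ?thesis
  proof (rule tendsto_sandwich[OF _ _ tendsto_const lim])
    show "\<forall>\<^sub>F N in sequentially. 0 \<le> (\<integral>x. \<bar>(1 / (real N * \<tau>)) * (LBINT t:{0..real N * \<tau>}. \<integral>y. f y \<partial>P (max 0 t) x)\<bar> \<partial>\<mu>)"
      by (intro always_eventually allI Bochner_Integration.integral_nonneg) simp
    show "\<forall>\<^sub>F N in sequentially. (\<integral>x. \<bar>(1 / (real N * \<tau>)) * (LBINT t:{0..real N * \<tau>}. \<integral>y. f y \<partial>P (max 0 t) x)\<bar> \<partial>\<mu>)
      \<le> (1 / \<tau>) * sqrt (S N / (real N)\<^sup>2)"
    proof (intro always_eventually allI)
      fix N :: nat
      \<comment> \<open>On a probability space the L1 norm is at most the L2 norm.\<close>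
      have "(\<integral>x. \<bar>W N x\<bar> \<partial>\<mu>)\<^sup>2 \<le> (\<integral>x. \<bar>W N x\<bar>\<^sup>2 \<partial>\<mu>)"
        by (rule integral_square_le[where C="C * (real N * \<tau>)"]) (use Wb in auto)
      then have "(\<integral>x. \<bar>W N x\<bar> \<partial>\<mu>) \<le> sqrt (S N)"
        unfolding S_def by (intro real_le_rsqrt) simp
      then have "(1 / (real N * \<tau>)) * (\<integral>x. \<bar>W N x\<bar> \<partial>\<mu>) \<le> (1 / (real N * \<tau>)) * sqrt (S N)"
        using \<tau> by (intro mult_left_mono) auto
      moreover have "(\<integral>x. \<bar>(1 / (real N * \<tau>)) * W N x\<bar> \<partial>\<mu>) = (1 / (real N * \<tau>)) * (\<integral>x. \<bar>W N x\<bar> \<partial>\<mu>)"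
        using \<tau> by (simp add: abs_mult)
      moreover have "(1 / (real N * \<tau>)) * sqrt (S N) = (1 / \<tau>) * sqrt (S N / (real N)\<^sup>2)"
        by (simp add: real_sqrt_divide)
      ultimately show "(\<integral>x. \<bar>(1 / (real N * \<tau>)) * (LBINT t:{0..real N * \<tau>}. \<integral>y. f y \<partial>P (max 0 t) x)\<bar> \<partial>\<mu>)
        \<le> (1 / \<tau>) * sqrt (S N / (real N)\<^sup>2)"
        unfolding a_def[symmetric] W_def[symmetric] by (simp only:)
    qed
  qed
qed

lemma measure_path_law_two_point:
  assumes t: "0 \<le> t" and \<Gamma>: "\<Gamma> \<in> sets borel" and \<Delta>: "\<Delta> \<in> sets borel"
  shows "measure (path_law \<mu>) ({\<omega>. \<omega> t \<in> \<Gamma>} \<inter> {\<omega>. \<omega> 0 \<in> \<Delta>}) = (\<integral>x. indicator \<Delta> x * measure (P t x) \<Gamma> \<partial>\<mu>)"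
proof -
  have sL[measurable_cong]: "sets (path_law \<mu>) = sets path_space"
    using path_law_in_prob_algebra[OF \<mu>] by (simp add: space_prob_algebra)
  note [measurable_cong] = sets_invariant
  have [measurable]: "(\<lambda>x. measure (P t x) \<Gamma>) \<in> borel_measurable borel"
    by (rule measure_kernel_measurable[OF t \<Gamma>])
  note [measurable] = \<Delta>
  have B: "{\<omega>. \<omega> 0 \<in> \<Delta>} \<in> sets (past 0)"
    using measurable_sets[OF coordinate_past_measurable[of 0 0] \<Delta>] by (simp add: vimage_def space_past)
  have "emeasure (path_law \<mu>) ({\<omega>. \<omega> 0 \<in> \<Delta>} \<inter> {\<omega>. \<omega> t \<in> \<Gamma>})
    = (\<integral>\<^sup>+\<omega>. indicator {\<omega>. \<omega> 0 \<in> \<Delta>} \<omega> * emeasure (P (t - 0) (\<omega> 0)) \<Gamma> \<partial>path_law \<mu>)"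
    using path_law_markov_path[OF \<mu>] t B \<Gamma> unfolding markov_path_def by blast
  also have "\<dots> = (\<integral>\<^sup>+\<omega>. ennreal (indicator \<Delta> (\<omega> 0) * measure (P t (\<omega> 0)) \<Gamma>) \<partial>path_law \<mu>)"
    using t by (intro nn_integral_cong) (simp add: emeasure_kernel split: split_indicator)
  also have "\<dots> = (\<integral>\<^sup>+x. ennreal (indicator \<Delta> x * measure (P t x) \<Gamma>) \<partial>distr (path_law \<mu>) borel (\<lambda>\<omega>. \<omega> 0))"
    by (subst nn_integral_distr) auto
  finally have "emeasure (path_law \<mu>) ({\<omega>. \<omega> 0 \<in> \<Delta>} \<inter> {\<omega>. \<omega> t \<in> \<Gamma>})
    = (\<integral>\<^sup>+x. ennreal (indicator \<Delta> x * measure (P t x) \<Gamma>) \<partial>\<mu>)"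
    unfolding path_law_marginal[OF \<mu>] .
  then have "measure (path_law \<mu>) ({\<omega>. \<omega> 0 \<in> \<Delta>} \<inter> {\<omega>. \<omega> t \<in> \<Gamma>})
    = enn2real (\<integral>\<^sup>+x. ennreal (indicator \<Delta> x * measure (P t x) \<Gamma>) \<partial>\<mu>)"
    by (simp add: measure_def)
  also have "\<dots> = (\<integral>x. indicator \<Delta> x * measure (P t x) \<Gamma> \<partial>\<mu>)"
    by (intro integral_eq_nn_integral[symmetric]) auto
  finally show ?thesis by (simp add: Int_commute)
qed

lemma coordinate_event: "\<Gamma> \<in> sets borel \<Longrightarrow> {\<omega>. \<omega> t \<in> \<Gamma>} \<in> sets (path_space :: (real \<Rightarrow> 'a) measure)"
  using measurable_sets[OF measurable_component_singleton[of t UNIV "\<lambda>_. borel :: 'a measure"], of \<Gamma>]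
  by (simp add: vimage_def space_path_space)

lemma measure_path_law_coordinate:
  assumes "\<Gamma> \<in> sets borel"
  shows "measure (path_law \<mu>) {\<omega>. \<omega> t \<in> \<Gamma>} = measure \<mu> \<Gamma>"
proof -
  have sL[measurable_cong]: "sets (path_law \<mu>) = sets path_space"
    using path_law_in_prob_algebra[OF \<mu>] by (simp add: space_prob_algebra)
  have "measure (distr (path_law \<mu>) borel (\<lambda>\<omega>. \<omega> t)) \<Gamma> = measure (path_law \<mu>) {\<omega>. \<omega> t \<in> \<Gamma>}"
    using assms sets_eq_imp_space_eq[OF sL]
    by (subst measure_distr) (auto simp: vimage_def space_path_space)
  then show ?thesis by (simp add: path_law_marginal[OF \<mu>])
qed

lemma ergodic_two_point:
  assumes erg: "ergodic_measure P \<mu>" and \<Gamma>: "\<Gamma> \<in> sets borel" and \<Delta>: "\<Delta> \<in> sets borel"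
  shows "cesaro (\<lambda>t. \<integral>x. indicator \<Delta> x * measure (P t x) \<Gamma> \<partial>\<mu>) (measure \<mu> \<Gamma> * measure \<mu> \<Delta>)"
proof -
  let ?A = "{\<omega> :: real \<Rightarrow> 'a. \<omega> 0 \<in> \<Gamma>}" and ?B = "{\<omega> :: real \<Rightarrow> 'a. \<omega> 0 \<in> \<Delta>}"
  have "cesaro (\<lambda>t. measure (path_law \<mu>) (path_shift (- t) ` ?A \<inter> ?B)) (measure (path_law \<mu>) ?A * measure (path_law \<mu>) ?B)"
    using erg coordinate_event[OF \<Gamma>] coordinate_event[OF \<Delta>]
    unfolding ergodic_measure_def canonical_law_eq[OF \<mu>] cesaro_def by blast
  moreover have "path_shift (- t) ` ?A \<inter> ?B = {\<omega>. \<omega> t \<in> \<Gamma>} \<inter> ?B" for t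
    unfolding path_shift_image by (auto simp: path_shift_def)
  ultimately have "cesaro (\<lambda>t. measure (path_law \<mu>) ({\<omega>. \<omega> t \<in> \<Gamma>} \<inter> ?B)) (measure \<mu> \<Gamma> * measure \<mu> \<Delta>)"
    by (simp add: measure_path_law_coordinate \<Gamma> \<Delta>)
  then show ?thesis
    by (subst (asm) cesaro_cong[where \<psi>="\<lambda>t. \<integral>x. indicator \<Delta> x * measure (P t x) \<Gamma> \<partial>\<mu>"])
       (auto intro: measure_path_law_two_point \<Gamma> \<Delta>)
qed

lemma ergodic_imp_mean_convergence:
  assumes erg: "ergodic_measure P \<mu>" and \<Gamma>: "\<Gamma> \<in> sets borel" and \<tau>: "0 < \<tau>"
  shows "(\<lambda>N. \<integral>x. \<bar>(1 / (real N * \<tau>)) * (LBINT t:{0..real N * \<tau>}. measure (P (max 0 t) x) \<Gamma>) - measure \<mu> \<Gamma>\<bar> \<partial>\<mu>) \<longlonglongrightarrow> 0"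
proof -
  interpret prob_space \<mu> by (rule prob_space_invariant)
  note [measurable_cong] = sets_invariant
  \<comment> \<open>Centring moves the weak limit to 0, the only limit that the recursion for the
    norms can detect.\<close>
  define f where "f x = indicator \<Gamma> x - measure \<mu> \<Gamma>" for x
  have f[measurable]: "f \<in> borel_measurable borel" using \<Gamma> by (simp add: f_def[abs_def])
  have \<mu>\<Gamma>: "0 \<le> measure \<mu> \<Gamma>" "measure \<mu> \<Gamma> \<le> 1" by auto
  have fb: "\<bar>f x\<bar> \<le> 1" for x using \<mu>\<Gamma> by (auto simp: f_def split: split_indicator)
  have Pf: "(\<integral>y. f y \<partial>P (max 0 t) x) = measure (P (max 0 t) x) \<Gamma> - measure \<mu> \<Gamma>" for t x
  proof -
    interpret K: prob_space "P (max 0 t) x" by (rule prob_space_kernel) simp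
    have "\<Gamma> \<in> sets (P (max 0 t) x)" using \<Gamma> by (simp add: sets_kernel)
    then show ?thesis unfolding f_def by (simp add: K.prob_space less_top[symmetric])
  qed
  have "cesaro (\<lambda>t. \<integral>x. indicator \<Delta> x * (\<integral>y. f y \<partial>P (max 0 t) x) \<partial>\<mu>) 0" if \<Delta>[measurable]: "\<Delta> \<in> sets borel" for \<Delta>
  proof -
    let ?c = "\<lambda>t. \<integral>x. indicator \<Delta> x * measure (P (max 0 t) x) \<Gamma> \<partial>\<mu>"
    have ind: "(\<lambda>t. \<integral>x. indicator \<Delta> x * (\<integral>y. (indicator \<Gamma> y :: real) \<partial>P (max 0 t) x) \<partial>\<mu>) = ?c"
      using \<Gamma> by (simp add: sets_kernel)
    have "cesaro ?c (measure \<mu> \<Gamma> * measure \<mu> \<Delta>)"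
      using ergodic_two_point[OF erg \<Gamma> \<Delta>] by (subst cesaro_cong) auto
    moreover have "?c \<in> borel_measurable borel"
      unfolding ind[symmetric] by (rule correlation_measurable) (use \<Gamma> \<Delta> in auto)
    moreover have "\<bar>?c t\<bar> \<le> 1" for t
      using correlation_bound[of "indicator \<Gamma>" 1 "indicator \<Delta>" 1 t] \<Gamma> \<Delta> fun_cong[OF ind, of t]
      by (simp add: indicator_def)
    ultimately have "cesaro (\<lambda>t. ?c t + (- 1) * (measure \<mu> \<Gamma> * measure \<mu> \<Delta>)) (measure \<mu> \<Gamma> * measure \<mu> \<Delta> + (- 1) * (measure \<mu> \<Gamma> * measure \<mu> \<Delta>))"
      by (intro cesaro_add_mult[where C=1 and D="measure \<mu> \<Gamma> * measure \<mu> \<Delta>"] cesaro_const) auto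
    moreover have "(\<integral>x. indicator \<Delta> x * (\<integral>y. f y \<partial>P (max 0 t) x) \<partial>\<mu>) = ?c t + (- 1) * (measure \<mu> \<Gamma> * measure \<mu> \<Delta>)" for t
    proof -
      have [measurable]: "(\<lambda>x. measure (P (max 0 t) x) \<Gamma>) \<in> borel_measurable borel"
        by (rule measure_kernel_measurable) (use \<Gamma> in auto)
      have "integrable \<mu> (\<lambda>x. indicator \<Delta> x * measure (P (max 0 t) x) \<Gamma>)"
        by (rule integral_abs_le(1)[where C=1]) (auto simp: measure_kernel_le_1 split: split_indicator)
      then show ?thesis
        unfolding Pf by (simp add: right_diff_distrib less_top[symmetric] sets_invariant mult.commute)
    qed
    ultimately show ?thesis by simp
  qed
  from weak_mean_imp_strong_mean[OF f fb \<tau> this]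
  have lim: "(\<lambda>N. \<integral>x. \<bar>(1 / (real N * \<tau>)) * (LBINT t:{0..real N * \<tau>}. measure (P (max 0 t) x) \<Gamma> - measure \<mu> \<Gamma>)\<bar> \<partial>\<mu>) \<longlonglongrightarrow> 0"
    unfolding Pf .
  \<comment> \<open>At \<open>N = 0\<close> division by zero makes the left side 0 instead of
    \<open>- measure \<mu> \<Gamma>\<close>, hence the restriction to
    \<open>1 \<le> N\<close>.\<close>
  have eq: "(1 / (real N * \<tau>)) * (LBINT t:{0..real N * \<tau>}. measure (P (max 0 t) x) \<Gamma> - measure \<mu> \<Gamma>)
    = (1 / (real N * \<tau>)) * (LBINT t:{0..real N * \<tau>}. measure (P (max 0 t) x) \<Gamma>) - measure \<mu> \<Gamma>" if "1 \<le> N" for N x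
  proof -
    have "(\<lambda>(t, x). \<integral>y. (indicator \<Gamma> y :: real) \<partial>P (max 0 t) x) \<in> borel_measurable (borel \<Otimes>\<^sub>M borel)"
      by (rule transition_pair_measurable) (use \<Gamma> in simp)
    then have "(\<lambda>(t, x). measure (P (max 0 t) x) \<Gamma>) \<in> borel_measurable (borel \<Otimes>\<^sub>M borel)"
      using \<Gamma> by (simp add: sets_kernel)
    from measurable_compose[OF _ this, of "\<lambda>t. (t, x)" borel]
    have m: "(\<lambda>t. measure (P (max 0 t) x) \<Gamma>) \<in> borel_measurable borel" by simp
    have "(LBINT t:{0..real N * \<tau>}. measure (P (max 0 t) x) \<Gamma> - measure \<mu> \<Gamma>)
      = (LBINT t:{0..real N * \<tau>}. measure (P (max 0 t) x) \<Gamma>) - (LBINT t:{0..real N * \<tau>}. measure \<mu> \<Gamma>)"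
      by (intro set_integral_diff(2) bounded_set_integrable[where C=1] m) (auto simp: measure_kernel_le_1)
    also have "(LBINT t:{0..real N * \<tau>}. measure \<mu> \<Gamma>) = real N * \<tau> * measure \<mu> \<Gamma>"
      using \<tau> by (simp add: set_integral_const)
    finally show ?thesis using that \<tau> by (simp add: right_diff_distrib)
  qed
  show ?thesis
  proof (rule Lim_transform_eventually[OF lim])
    show "\<forall>\<^sub>F N in sequentially.
        (\<integral>x. \<bar>(1 / (real N * \<tau>)) * (LBINT t:{0..real N * \<tau>}. measure (P (max 0 t) x) \<Gamma> - measure \<mu> \<Gamma>)\<bar> \<partial>\<mu>)
      = (\<integral>x. \<bar>(1 / (real N * \<tau>)) * (LBINT t:{0..real N * \<tau>}. measure (P (max 0 t) x) \<Gamma>) - measure \<mu> \<Gamma>\<bar> \<partial>\<mu>)"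
      using eventually_ge_at_top[of 1] by eventually_elim (simp only: eq)
  qed
qed

end

end

text \<open>\<open>\<psi> t\<close> plays a measure of total mass \<open>c\<close> dominated by
  \<open>m\<close>. Domination bounds the tail of a disjoint union uniformly in \<open>t\<close>, so
  the union is a uniform limit in time of its partial sums. Measurability in \<open>t\<close> is
  carried along because integrals of sums split only for measurable functions.\<close>

lemma cesaro_sigma_sets:
  fixes \<psi> :: "real \<Rightarrow> 'b set \<Rightarrow> real"
  assumes m: "prob_space m" and G: "Int_stable G" "G \<subseteq> Pow (space m)" "sets m = sigma_sets (space m) G"
    and union: "\<And>t A. range A \<subseteq> sets m \<Longrightarrow> disjoint_family A \<Longrightarrow> (\<lambda>i::nat. \<psi> t (A i)) sums \<psi> t (\<Union>i. A i)"
    and space: "\<And>t. \<psi> t (space m) = c"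
    and nonneg: "\<And>t A. A \<in> sets m \<Longrightarrow> 0 \<le> \<psi> t A"
    and le: "\<And>t A. A \<in> sets m \<Longrightarrow> \<psi> t A \<le> measure m A"
    and base: "\<And>A. A \<in> G \<Longrightarrow> (\<lambda>t. \<psi> t A) \<in> borel_measurable borel \<and> cesaro (\<lambda>t. \<psi> t A) (c * measure m A)"
    and A: "A \<in> sets m"
  shows "(\<lambda>t. \<psi> t A) \<in> borel_measurable borel \<and> cesaro (\<lambda>t. \<psi> t A) (c * measure m A)"
proof -
  interpret prob_space m by fact
  have c: "0 \<le> c" "c \<le> 1"
    using nonneg[OF sets.top, of 0] le[OF sets.top, of 0] space[of 0] by (auto simp: prob_space)
  have b1: "\<bar>\<psi> t A\<bar> \<le> 1" if "A \<in> sets m" for t A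
    using nonneg[OF that, of t] le[OF that, of t] prob_le_1[of A] by linarith
  have empty: "\<psi> t {} = 0" for t
    using nonneg[of "{}" t] le[of "{}" t] by simp
  have "A \<in> sigma_sets (space m) G" using A G by simp
  with G(1,2) show ?thesis
  proof (induction A rule: sigma_sets_induct_disjoint)
    case (basic A)
    then show ?case by (rule base)
  next
    case empty
    then show ?case using cesaro_const[of 0] by (simp add: \<open>\<And>t. \<psi> t {} = 0\<close>)
  next
    case (compl A)
    then have A: "A \<in> sets m" using G by simp
    have eq: "\<psi> t (space m - A) = c + (- 1) * \<psi> t A" for t
    proof -
      have "(\<lambda>n. \<psi> t (binaryset A (space m - A) n)) sums \<psi> t (\<Union>i. binaryset A (space m - A) i)"
        by (rule union) (use A in \<open>auto simp: binaryset_def disjoint_family_on_def\<close>)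
      moreover have "(\<Union>i. binaryset A (space m - A) i) = space m"
        using sets.sets_into_space[OF A] by (auto simp: UN_binaryset_eq)
      moreover have "(\<lambda>n. \<psi> t (binaryset A (space m - A) n)) sums (\<psi> t A + \<psi> t (space m - A))"
        by (rule binaryset_sums) (rule \<open>\<psi> t {} = 0\<close>)
      ultimately have "\<psi> t A + \<psi> t (space m - A) = c"
        using space[of t] sums_unique2 by metis
      then show ?thesis by simp
    qed
    have "cesaro (\<lambda>t. c + (- 1) * \<psi> t A) (c + (- 1) * (c * measure m A))"
      using compl b1[OF A] c by (intro cesaro_add_mult[where C=1 and D=1] cesaro_const) auto
    moreover have "c + (- 1) * (c * measure m A) = c * measure m (space m - A)"
      using prob_compl[OF A] by (simp add: right_diff_distrib)
    ultimately show ?case using compl unfolding eq by (auto intro!: borel_measurable_add borel_measurable_times)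
  next
    case (union A)
    then have A: "range A \<subseteq> sets m" and d: "disjoint_family A" using G by auto
    then have Ai: "A i \<in> sets m" for i by auto
    note s = assms(5)[OF A d]
    note sm = finite_measure_UNION[OF A d]
    have UA: "(\<Union>i. A i) \<in> sets m" using Ai by auto
    have meas: "(\<lambda>t. \<psi> t (\<Union>i. A i)) \<in> borel_measurable borel"
    proof (rule borel_measurable_LIMSEQ_real)
      show "(\<lambda>n. \<Sum>i<n. \<psi> t (A i)) \<longlonglongrightarrow> \<psi> t (\<Union>i. A i)" for t
        using s[of t] by (simp add: sums_def)
      show "(\<lambda>t. \<Sum>i<n. \<psi> t (A i)) \<in> borel_measurable borel" for n
        using union by (intro borel_measurable_sum) auto
    qed
    have fin: "cesaro (\<lambda>t. \<Sum>i<n. \<psi> t (A i)) (c * (\<Sum>i<n. measure m (A i)))" for n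
    proof (induction n)
      case 0
      then show ?case using cesaro_const[of 0] by simp
    next
      case (Suc n)
      have "\<bar>\<Sum>i<n. \<psi> t (A i)\<bar> \<le> real n" for t
        using order_trans[OF sum_abs sum_mono[of "{..<n}" "\<lambda>i. \<bar>\<psi> t (A i)\<bar>" "\<lambda>_. 1"]] b1[OF Ai] by simp
      then have "cesaro (\<lambda>t. (\<Sum>i<n. \<psi> t (A i)) + 1 * \<psi> t (A n)) (c * (\<Sum>i<n. measure m (A i)) + 1 * (c * measure m (A n)))"
        using union Suc b1[OF Ai] by (intro cesaro_add_mult[where C="real n" and D=1] borel_measurable_sum) auto
      then show ?case by (simp add: distrib_left)
    qed
    have "cesaro (\<lambda>t. \<psi> t (\<Union>i. A i)) (c * measure m (\<Union>i. A i))"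
    proof (rule cesaro_uniform_limit[OF meas b1[OF UA]])
      fix e :: real assume e: "0 < e"
      have "(\<lambda>n. \<Sum>i<n. measure m (A i)) \<longlonglongrightarrow> measure m (\<Union>i. A i)" using sm by (simp add: sums_def)
      from LIMSEQ_D[OF this e] obtain n where n: "\<bar>(\<Sum>i<n. measure m (A i)) - measure m (\<Union>i. A i)\<bar> < e" by auto
      have "\<bar>\<psi> t (\<Union>i. A i) - (\<Sum>i<n. \<psi> t (A i))\<bar> \<le> e" for t
      proof -
        have s1: "(\<lambda>i. \<psi> t (A (i + n))) sums (\<psi> t (\<Union>i. A i) - (\<Sum>i<n. \<psi> t (A i)))"
          by (rule sums_split_initial_segment[OF s])
        have s2: "(\<lambda>i. measure m (A (i + n))) sums (measure m (\<Union>i. A i) - (\<Sum>i<n. measure m (A i)))"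
          by (rule sums_split_initial_segment[OF sm])
        have "\<psi> t (\<Union>i. A i) - (\<Sum>i<n. \<psi> t (A i)) \<le> measure m (\<Union>i. A i) - (\<Sum>i<n. measure m (A i))"
          by (rule sums_le[OF _ s1 s2]) (rule le[OF Ai])
        moreover have "0 \<le> \<psi> t (\<Union>i. A i) - (\<Sum>i<n. \<psi> t (A i))"
          by (rule sums_le[OF _ sums_zero s1]) (rule nonneg[OF Ai])
        ultimately show ?thesis using n by linarith
      qed
      moreover have "\<bar>c * measure m (\<Union>i. A i) - c * (\<Sum>i<n. measure m (A i))\<bar> \<le> e"
      proof -
        have "\<bar>c * measure m (\<Union>i. A i) - c * (\<Sum>i<n. measure m (A i))\<bar>
          = c * \<bar>(\<Sum>i<n. measure m (A i)) - measure m (\<Union>i. A i)\<bar>"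
          using c by (simp add: right_diff_distrib[symmetric] abs_mult abs_minus_commute)
        also have "\<dots> \<le> 1 * e" using c n by (intro mult_mono) auto
        finally show ?thesis by simp
      qed
      moreover have "\<bar>\<Sum>i<n. \<psi> t (A i)\<bar> \<le> real n" for t
        using order_trans[OF sum_abs sum_mono[of "{..<n}" "\<lambda>i. \<bar>\<psi> t (A i)\<bar>" "\<lambda>_. 1"]] b1[OF Ai] by simp
      moreover have "(\<lambda>t. \<Sum>i<n. \<psi> t (A i)) \<in> borel_measurable borel"
        using union by (intro borel_measurable_sum) auto
      ultimately show "\<exists>\<phi> l D. \<phi> \<in> borel_measurable borel \<and> (\<forall>t. \<bar>\<phi> t\<bar> \<le> D) \<and> cesaro \<phi> l
        \<and> (\<forall>t. \<bar>\<psi> t (\<Union>i. A i) - \<phi> t\<bar> \<le> e) \<and> \<bar>c * measure m (\<Union>i. A i) - l\<bar> \<le> e"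
        using fin[of n] by blast
    qed
    with meas show ?case by blast
  qed
qed

section \<open>Continuity in probability of the coordinate process\<close>

context stochastically_continuous_transition
begin

lemma cyl_int_le_1:
  assumes "\<And>t x. f t x \<le> 1" "sorted (s # ts)"
  shows "cyl_int f s ts x \<le> 1"
  using assms(2)
proof (induction ts arbitrary: s x)
  case (Cons t ts)
  have t: "0 \<le> t - s" "sorted (t # ts)" using Cons.prems by auto
  have "(\<integral>\<^sup>+y. f t y * cyl_int f t ts y \<partial>P (t - s) x) \<le> (\<integral>\<^sup>+y. 1 * 1 \<partial>P (t - s) x)"
    by (intro nn_integral_mono mult_mono assms(1) Cons.IH[OF t(2)]) auto
  also have "\<dots> = 1" using prob_space.emeasure_space_1[OF prob_space_kernel[OF t(1)]] by simp
  finally show ?case by simp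
qed simp

context
  fixes \<mu> :: "'a measure"
  assumes \<mu>: "invariant_measure P \<mu>"
begin

lemma
  shows prob_space_path_law: "prob_space (path_law \<mu>)"
    and sets_path_law: "sets (path_law \<mu>) = sets path_space"
    and space_path_law: "space (path_law \<mu>) = UNIV"
  using path_law_in_prob_algebra[OF \<mu>] sets_eq_imp_space_eq[of "path_law \<mu>" path_space]
  by (auto simp: space_prob_algebra space_path_space)

lemma integral_path_law_coordinate:
  fixes f :: "'a \<Rightarrow> real"
  assumes "f \<in> borel_measurable borel"
  shows "(\<integral>\<omega>. f (\<omega> t) \<partial>path_law \<mu>) = (\<integral>x. f x \<partial>\<mu>)"
proof -
  note [measurable_cong] = sets_path_law
  have "(\<integral>x. f x \<partial>distr (path_law \<mu>) borel (\<lambda>\<omega>. \<omega> t)) = (\<integral>\<omega>. f (\<omega> t) \<partial>path_law \<mu>)"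
    by (rule integral_distr) (use assms in measurable)
  then show ?thesis by (simp add: path_law_marginal[OF \<mu>])
qed

lemma integral_path_law_pair:
  fixes f :: "'a \<Rightarrow> real"
  assumes f[measurable]: "f \<in> borel_measurable borel" and b: "\<And>x. 0 \<le> f x \<and> f x \<le> 1" and h: "0 < h"
  shows "(\<integral>\<omega>. f (\<omega> u) * f (\<omega> (u + h)) \<partial>path_law \<mu>) = (\<integral>x. f x * (\<integral>y. f y \<partial>P h x) \<partial>\<mu>)"
proof -
  note [measurable_cong] = sets_path_law sets_invariant[OF \<mu>]
  have [measurable]: "(\<lambda>x. \<integral>y. f y \<partial>P h x) \<in> borel_measurable borel"
    using h by (intro transition_measurable f) simp
  define F where "F t x = ennreal (f x)" for t :: real and x
  have F: "F t \<in> borel_measurable borel" for t unfolding F_def by measurable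
  have list: "sorted_list_of_set {u, u + h} = [u, u + h]"
    using h by (intro sorted_distinct_set_unique) auto
  have "(\<integral>\<^sup>+\<omega>. ennreal (f (\<omega> u) * f (\<omega> (u + h))) \<partial>path_law \<mu>)
    = (\<integral>\<^sup>+\<omega>. (\<Prod>t\<in>{u, u + h}. F t (\<omega> t)) \<partial>path_law \<mu>)"
    using h b by (intro nn_integral_cong) (simp add: F_def ennreal_mult)
  also have "\<dots> = (\<integral>\<^sup>+x. cyl_int F u (sorted_list_of_set {u, u + h}) x \<partial>\<mu>)"
    using h by (intro nn_integral_path_law[OF \<mu>] F) auto
  also have "\<dots> = (\<integral>\<^sup>+x. F u x * cyl_int F u [u + h] x \<partial>\<mu>)"
    unfolding list using h by (intro nn_integral_cyl_int_invariant[OF \<mu>] F) auto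
  also have "\<dots> = (\<integral>\<^sup>+x. ennreal (f x * (\<integral>y. f y \<partial>P h x)) \<partial>\<mu>)"
  proof (rule nn_integral_cong)
    fix x
    have "(\<integral>\<^sup>+y. ennreal (f y) \<partial>P h x) = ennreal (\<integral>y. f y \<partial>P h x)"
      by (intro nn_integral_eq_integral prob_space.integral_abs_le(1)[where C=1] prob_space_kernel)
         (use b h in \<open>auto simp: measurable_cong_sets[OF sets_kernel refl]\<close>)
    then show "F u x * cyl_int F u [u + h] x = ennreal (f x * (\<integral>y. f y \<partial>P h x))"
      using b by (simp add: F_def ennreal_mult)
  qed
  finally have eq: "(\<integral>\<^sup>+\<omega>. ennreal (f (\<omega> u) * f (\<omega> (u + h))) \<partial>path_law \<mu>) = (\<integral>\<^sup>+x. ennreal (f x * (\<integral>y. f y \<partial>P h x)) \<partial>\<mu>)" .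
  have "(\<integral>\<omega>. f (\<omega> u) * f (\<omega> (u + h)) \<partial>path_law \<mu>) = enn2real (\<integral>\<^sup>+\<omega>. ennreal (f (\<omega> u) * f (\<omega> (u + h))) \<partial>path_law \<mu>)"
    using b by (intro integral_eq_nn_integral) auto
  also have "\<dots> = (\<integral>x. f x * (\<integral>y. f y \<partial>P h x) \<partial>\<mu>)"
    unfolding eq using b by (intro integral_eq_nn_integral[symmetric]) auto
  finally show ?thesis .
qed

text \<open>Expanding the square, stationarity makes the two diagonal terms equal, and the mixed
  term tends to the same value because \<open>P (h n)\<close> tends to the identity on
  \<open>f\<close>. Increments therefore vanish in mean square, hence in mean.\<close>

lemma path_law_increment:
  fixes f :: "'a \<Rightarrow> real"
  assumes f: "continuous_on UNIV f" "\<And>x. 0 \<le> f x \<and> f x \<le> 1" and h: "\<And>n. 0 < h n" "h \<longlonglongrightarrow> 0"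
  shows "(\<lambda>n. \<integral>\<omega>. \<bar>f (\<omega> (u + h n)) - f (\<omega> u)\<bar> \<partial>path_law \<mu>) \<longlonglongrightarrow> 0"
proof -
  note [measurable_cong] = sets_path_law sets_invariant[OF \<mu>]
  interpret L: prob_space "path_law \<mu>" by (rule prob_space_path_law)
  interpret M: prob_space \<mu> by (rule prob_space_invariant[OF \<mu>])
  have [measurable]: "f \<in> borel_measurable borel" by (rule borel_measurable_continuous_onI[OF f(1)])
  have fb: "\<bar>f x\<bar> \<le> 1" and ff: "\<bar>f x * f y\<bar> \<le> 1" and fd: "\<bar>\<bar>f x - f y\<bar>\<bar> \<le> 1" for x y
    using f(2)[of x] f(2)[of y] by (auto simp: abs_mult mult_le_one)
  have Pm[measurable]: "(\<lambda>x. \<integral>y. f y \<partial>P (h n) x) \<in> borel_measurable borel" for n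
    using h(1)[of n] by (intro transition_measurable) auto
  have sq: "(\<integral>\<omega>. (f (\<omega> (u + h n)) - f (\<omega> u))\<^sup>2 \<partial>path_law \<mu>)
    = 2 * (\<integral>x. f x * f x \<partial>\<mu>) - 2 * (\<integral>x. f x * (\<integral>y. f y \<partial>P (h n) x) \<partial>\<mu>)" for n
  proof -
    have i: "integrable (path_law \<mu>) (\<lambda>\<omega>. f (\<omega> a) * f (\<omega> b))" for a b
      by (rule L.integral_abs_le(1)[where C=1]) (use ff in auto)
    have "(\<integral>\<omega>. (f (\<omega> (u + h n)) - f (\<omega> u))\<^sup>2 \<partial>path_law \<mu>)
      = (\<integral>\<omega>. f (\<omega> (u + h n)) * f (\<omega> (u + h n)) + f (\<omega> u) * f (\<omega> u) - 2 * (f (\<omega> u) * f (\<omega> (u + h n))) \<partial>path_law \<mu>)"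
      by (intro Bochner_Integration.integral_cong) (auto simp: power2_eq_square algebra_simps)
    also have "\<dots> = (\<integral>\<omega>. f (\<omega> (u + h n)) * f (\<omega> (u + h n)) \<partial>path_law \<mu>) + (\<integral>\<omega>. f (\<omega> u) * f (\<omega> u) \<partial>path_law \<mu>)
      - 2 * (\<integral>\<omega>. f (\<omega> u) * f (\<omega> (u + h n)) \<partial>path_law \<mu>)"
      using i by simp
    finally show ?thesis
      using integral_path_law_coordinate[of "\<lambda>x. f x * f x"] integral_path_law_pair[of f, OF _ f(2) h(1)] by simp
  qed
  have "(\<lambda>n. \<integral>x. f x * (\<integral>y. f y \<partial>P (h n) x) \<partial>\<mu>) \<longlonglongrightarrow> (\<integral>x. f x * f x \<partial>\<mu>)"
  proof (rule integral_dominated_convergence[where w="\<lambda>_. 1"])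
    show "AE x in \<mu>. (\<lambda>n. f x * (\<integral>y. f y \<partial>P (h n) x)) \<longlonglongrightarrow> f x * f x"
      by (intro AE_I2 tendsto_mult tendsto_const kernel_tendsto_zero f h)
    show "AE x in \<mu>. norm (f x * (\<integral>y. f y \<partial>P (h n) x)) \<le> 1" for n
    proof (rule AE_I2)
      fix x
      have "\<bar>\<integral>y. f y \<partial>P (h n) x\<bar> \<le> 1"
        by (rule transition_bound) (use h(1)[of n] fb in auto)
      then show "norm (f x * (\<integral>y. f y \<partial>P (h n) x)) \<le> 1"
        using fb[of x] by (simp add: abs_mult mult_le_one)
    qed
  qed auto
  from tendsto_diff[OF tendsto_const tendsto_mult_left[OF this, of 2], of "2 * (\<integral>x. f x * f x \<partial>\<mu>)"]
  have "(\<lambda>n. \<integral>\<omega>. (f (\<omega> (u + h n)) - f (\<omega> u))\<^sup>2 \<partial>path_law \<mu>) \<longlonglongrightarrow> 0"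
    unfolding sq by simp
  from tendsto_real_sqrt[OF this]
  have lim: "(\<lambda>n. sqrt (\<integral>\<omega>. (f (\<omega> (u + h n)) - f (\<omega> u))\<^sup>2 \<partial>path_law \<mu>)) \<longlonglongrightarrow> 0" by simp
  show ?thesis
  proof (rule tendsto_sandwich[OF _ _ tendsto_const lim])
    show "\<forall>\<^sub>F n in sequentially. 0 \<le> (\<integral>\<omega>. \<bar>f (\<omega> (u + h n)) - f (\<omega> u)\<bar> \<partial>path_law \<mu>)"
      by (intro always_eventually allI Bochner_Integration.integral_nonneg) simp
    show "\<forall>\<^sub>F n in sequentially. (\<integral>\<omega>. \<bar>f (\<omega> (u + h n)) - f (\<omega> u)\<bar> \<partial>path_law \<mu>)
      \<le> sqrt (\<integral>\<omega>. (f (\<omega> (u + h n)) - f (\<omega> u))\<^sup>2 \<partial>path_law \<mu>)"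
    proof (intro always_eventually allI real_le_rsqrt)
      fix n
      have "(\<integral>\<omega>. \<bar>f (\<omega> (u + h n)) - f (\<omega> u)\<bar> \<partial>path_law \<mu>)\<^sup>2 \<le> (\<integral>\<omega>. \<bar>f (\<omega> (u + h n)) - f (\<omega> u)\<bar>\<^sup>2 \<partial>path_law \<mu>)"
        by (rule L.integral_square_le[where C=1]) (use fd in auto)
      then show "(\<integral>\<omega>. \<bar>f (\<omega> (u + h n)) - f (\<omega> u)\<bar> \<partial>path_law \<mu>)\<^sup>2
        \<le> (\<integral>\<omega>. (f (\<omega> (u + h n)) - f (\<omega> u))\<^sup>2 \<partial>path_law \<mu>)" by simp
    qed
  qed
qed

text \<open>
  Paths are not assumed to be regular, so measurability in time comes from continuity in
  probability. It cannot be skipped: the time integral of a nonmeasurable function is \<open>0\<close> by convention.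
\<close>

lemma shift_cylinder_measurable:
  assumes J: "finite J" and A: "\<And>t. open (A t)" and B: "B \<in> sets path_space"
  shows "(\<lambda>t. measure (path_law \<mu>) (path_shift t -` cylinder J A \<inter> B)) \<in> borel_measurable borel"
proof -
  note [measurable_cong] = sets_path_law
  interpret L: prob_space "path_law \<mu>" by (rule prob_space_path_law)
  note [measurable] = B
  \<comment> \<open>The indicator of the shifted cylinder is replaced by a product of continuous
    approximations, whose mean is right continuous in \<open>t\<close>; the event \<open>B\<close>
    stays fixed.\<close>
  define G where "G n t \<omega> = (\<Prod>s\<in>J. open_approx (A s) n (\<omega> (t + s))) * indicator B \<omega>"
    for n t and \<omega> :: "real \<Rightarrow> 'a"
  have [measurable]: "open_approx (A s) n \<in> borel_measurable borel" for s n
    by (rule borel_measurable_continuous_onI[OF continuous_open_approx])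
  have Gm[measurable]: "G n t \<in> borel_measurable (path_law \<mu>)" for n t
    unfolding G_def by measurable
  have ob: "\<bar>open_approx U n x\<bar> \<le> 1" for U n and x :: 'a
    using open_approx_bounds[of U n x] by simp
  have Gb: "\<bar>G n t \<omega>\<bar> \<le> 1" for n t \<omega>
  proof -
    have "\<bar>\<Prod>s\<in>J. open_approx (A s) n (\<omega> (t + s))\<bar> \<le> 1"
      unfolding abs_prod by (rule prod_le_1) (simp add: ob)
    then show ?thesis by (simp add: G_def abs_mult split: split_indicator)
  qed
  have Gi: "integrable (path_law \<mu>) (G n t)" for n t
    by (rule L.integral_abs_le(1)[OF Gm Gb])
  have "(\<lambda>t. \<integral>\<omega>. G n t \<omega> \<partial>path_law \<mu>) \<in> borel_measurable borel" for n
  proof -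
    \<comment> \<open>The unit component is a dummy state, since right continuity is exploited for
      functions of time and state.\<close>
    have "(\<lambda>(t, x::unit). \<integral>\<omega>. G n t \<omega> \<partial>path_law \<mu>) \<in> borel_measurable (borel \<Otimes>\<^sub>M count_space UNIV)"
    proof (rule borel_measurable_right_continuous)
      fix t :: real and h :: "nat \<Rightarrow> real" assume h: "\<And>n. 0 < h n" "h \<longlonglongrightarrow> 0"
      let ?d = "\<lambda>k s. \<integral>\<omega>. \<bar>open_approx (A s) n (\<omega> (t + s + h k)) - open_approx (A s) n (\<omega> (t + s))\<bar> \<partial>path_law \<mu>"
      have "(\<lambda>k. \<Sum>s\<in>J. ?d k s) \<longlonglongrightarrow> (\<Sum>s\<in>J. 0)"
        by (intro tendsto_sum path_law_increment continuous_open_approx h) (simp add: open_approx_bounds)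
      then have lim: "(\<lambda>k. \<Sum>s\<in>J. ?d k s) \<longlonglongrightarrow> 0" by simp
      have le: "\<bar>(\<integral>\<omega>. G n (t + h k) \<omega> \<partial>path_law \<mu>) - (\<integral>\<omega>. G n t \<omega> \<partial>path_law \<mu>)\<bar> \<le> (\<Sum>s\<in>J. ?d k s)" for k
      proof -
        have di: "integrable (path_law \<mu>) (\<lambda>\<omega>. \<bar>open_approx (A s) n (\<omega> (t + s + h k)) - open_approx (A s) n (\<omega> (t + s))\<bar>)" for s
        proof (rule L.integral_abs_le(1)[where C=2])
          show "\<bar>\<bar>open_approx (A s) n (\<omega> (t + s + h k)) - open_approx (A s) n (\<omega> (t + s))\<bar>\<bar> \<le> 2" for \<omega> :: "real \<Rightarrow> 'a"
            using ob[of "A s" n "\<omega> (t + s + h k)"] ob[of "A s" n "\<omega> (t + s)"] by linarith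
        qed measurable
        have "\<bar>(\<integral>\<omega>. G n (t + h k) \<omega> \<partial>path_law \<mu>) - (\<integral>\<omega>. G n t \<omega> \<partial>path_law \<mu>)\<bar>
          = \<bar>\<integral>\<omega>. G n (t + h k) \<omega> - G n t \<omega> \<partial>path_law \<mu>\<bar>"
          using Gi by simp
        also have "\<dots> \<le> (\<integral>\<omega>. \<bar>G n (t + h k) \<omega> - G n t \<omega>\<bar> \<partial>path_law \<mu>)"
          using Gi by (intro integral_abs_bound)
        also have "\<dots> \<le> (\<integral>\<omega>. (\<Sum>s\<in>J. \<bar>open_approx (A s) n (\<omega> (t + s + h k)) - open_approx (A s) n (\<omega> (t + s))\<bar>) \<partial>path_law \<mu>)"
        proof (rule integral_mono)
          fix \<omega>
          have "\<bar>G n (t + h k) \<omega> - G n t \<omega>\<bar>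
            \<le> norm ((\<Prod>s\<in>J. open_approx (A s) n (\<omega> (t + h k + s))) - (\<Prod>s\<in>J. open_approx (A s) n (\<omega> (t + s))))"
            by (simp add: G_def split: split_indicator)
          \<comment> \<open>A product of factors bounded by 1 changes by at most the sum of the
            changes of its factors.\<close>
          also have "\<dots> \<le> (\<Sum>s\<in>J. norm (open_approx (A s) n (\<omega> (t + h k + s)) - open_approx (A s) n (\<omega> (t + s))))"
            by (rule norm_prod_diff) (simp_all add: ob)
          finally show "\<bar>G n (t + h k) \<omega> - G n t \<omega>\<bar>
            \<le> (\<Sum>s\<in>J. \<bar>open_approx (A s) n (\<omega> (t + s + h k)) - open_approx (A s) n (\<omega> (t + s))\<bar>)"
            by (simp add: add.commute add.left_commute)
        qed (use Gi di in auto)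
        also have "\<dots> = (\<Sum>s\<in>J. ?d k s)"
          using di by (intro Bochner_Integration.integral_sum) auto
        finally show ?thesis .
      qed
      show "(\<lambda>k. \<integral>\<omega>. G n (t + h k) \<omega> \<partial>path_law \<mu>) \<longlonglongrightarrow> (\<integral>\<omega>. G n t \<omega> \<partial>path_law \<mu>)"
        by (rule LIM_zero_cancel, rule tendsto_0_le[OF lim, where K=1])
           (use le in \<open>auto intro!: always_eventually order_trans[OF _ abs_ge_self]\<close>)
    qed simp
    from measurable_compose[OF _ this, of "\<lambda>t. (t, ())" borel] show ?thesis by simp
  qed
  then show ?thesis
  proof (rule borel_measurable_LIMSEQ_real[rotated])
    fix t :: real
    have S: "path_shift t -` cylinder J A \<inter> B \<in> sets (path_law \<mu>)"
      using measurable_sets[OF path_shift_measurable cylinder_sets[OF J, of A], of t] A B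
      by (auto simp: sets_path_law space_path_space)
    have "(\<lambda>n. \<integral>\<omega>. G n t \<omega> \<partial>path_law \<mu>) \<longlonglongrightarrow> (\<integral>\<omega>. indicator (path_shift t -` cylinder J A \<inter> B) \<omega> \<partial>path_law \<mu>)"
    proof (rule integral_dominated_convergence[where w="\<lambda>_. 1"])
      show "AE \<omega> in path_law \<mu>. (\<lambda>n. G n t \<omega>) \<longlonglongrightarrow> indicator (path_shift t -` cylinder J A \<inter> B) \<omega>"
      proof (rule AE_I2)
        fix \<omega> :: "real \<Rightarrow> 'a"
        have "(\<lambda>n. G n t \<omega>) \<longlonglongrightarrow> (\<Prod>s\<in>J. indicator (A s) (\<omega> (t + s))) * indicator B \<omega>"
          unfolding G_def by (intro tendsto_mult tendsto_prod tendsto_const open_approx_LIMSEQ A)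
        also have "(\<Prod>s\<in>J. indicator (A s) (\<omega> (t + s))) = (indicator (path_shift t -` cylinder J A) \<omega> :: real)"
          using J by (auto simp: indicator_def cylinder_def path_shift_def prod_zero_iff)
        finally show "(\<lambda>n. G n t \<omega>) \<longlonglongrightarrow> indicator (path_shift t -` cylinder J A \<inter> B) \<omega>"
          by (simp add: indicator_inter_arith)
      qed
    qed (use S Gb in auto)
    then show "(\<lambda>n. \<integral>\<omega>. G n t \<omega> \<partial>path_law \<mu>) \<longlonglongrightarrow> measure (path_law \<mu>) (path_shift t -` cylinder J A \<inter> B)"
      using S by simp
  qed
qed

end

section \<open>From mean convergence to mixing\<close>

context
  fixes \<mu> :: "'a measure" and \<tau> :: real
  assumes \<mu>: "invariant_measure P \<mu>" and \<tau>: "0 < \<tau>"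
begin

definition time_mean :: "nat \<Rightarrow> ('a \<Rightarrow> real) \<Rightarrow> 'a \<Rightarrow> real" where
  "time_mean N g x = (1 / (real N * \<tau>)) * (LBINT t:{0..real N * \<tau>}. \<integral>y. g y \<partial>P (max 0 t) x)"

lemma transition_time_measurable:
  fixes g :: "'a \<Rightarrow> real"
  assumes "g \<in> borel_measurable borel"
  shows "(\<lambda>t. \<integral>y. g y \<partial>P (max 0 t) x) \<in> borel_measurable borel"
  using measurable_compose[OF _ transition_pair_measurable[OF assms], of "\<lambda>t. (t, x)" borel] by simp

lemma transition_time_bound:
  fixes g :: "'a \<Rightarrow> real"
  assumes "g \<in> borel_measurable borel" "\<And>x. \<bar>g x\<bar> \<le> C"
  shows "\<bar>\<integral>y. g y \<partial>P (max 0 t) x\<bar> \<le> C"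
  by (rule transition_bound[OF _ assms]) simp

lemma time_mean_measurable:
  assumes "g \<in> borel_measurable borel"
  shows "time_mean N g \<in> borel_measurable borel"
proof -
  have [measurable]: "(\<lambda>x. LBINT t:{0..real N * \<tau>}. \<integral>y. g y \<partial>P (max 0 t) x) \<in> borel_measurable borel"
    by (rule measurable_time_integral[OF transition_pair_measurable[OF assms]])
  show ?thesis unfolding time_mean_def[abs_def] by measurable
qed

lemma time_mean_bound:
  assumes "g \<in> borel_measurable borel" "\<And>x. \<bar>g x\<bar> \<le> C"
  shows "\<bar>time_mean N g x\<bar> \<le> C"
proof (cases "N = 0")
  case True
  then show ?thesis using order_trans[OF abs_ge_zero assms(2)] by (simp add: time_mean_def)
next
  case False
  then have N: "0 < real N * \<tau>" using \<tau> by simp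
  have "\<bar>LBINT t:{0..real N * \<tau>}. \<integral>y. g y \<partial>P (max 0 t) x\<bar> \<le> C * (real N * \<tau> - 0)"
    using N by (intro set_integral_Icc_bound transition_time_measurable transition_time_bound assms) simp
  moreover have "\<bar>time_mean N g x\<bar> = \<bar>LBINT t:{0..real N * \<tau>}. \<integral>y. g y \<partial>P (max 0 t) x\<bar> / (real N * \<tau>)"
    using N unfolding time_mean_def abs_mult by simp
  ultimately show ?thesis using N by (simp add: pos_divide_le_eq)
qed

lemma time_mean_add_mult:
  fixes f g :: "'a \<Rightarrow> real"
  assumes f: "f \<in> borel_measurable borel" "\<And>x. \<bar>f x\<bar> \<le> C" and g: "g \<in> borel_measurable borel" "\<And>x. \<bar>g x\<bar> \<le> D"
  shows "time_mean N (\<lambda>x. f x + c * g x) x = time_mean N f x + c * time_mean N g x"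
proof -
  have "(\<integral>y. f y + c * g y \<partial>P (max 0 t) x) = (\<integral>y. f y \<partial>P (max 0 t) x) + c * (\<integral>y. g y \<partial>P (max 0 t) x)" for t
  proof -
    interpret K: prob_space "P (max 0 t) x" by (rule prob_space_kernel) simp
    have "integrable (P (max 0 t) x) f" "integrable (P (max 0 t) x) g"
      using f g by (auto intro!: K.integral_abs_le(1) simp: measurable_cong_sets[OF sets_kernel refl])
    then show ?thesis by simp
  qed
  moreover have "(LBINT t:{0..T}. (\<integral>y. f y \<partial>P (max 0 t) x) + c * (\<integral>y. g y \<partial>P (max 0 t) x))
    = (LBINT t:{0..T}. \<integral>y. f y \<partial>P (max 0 t) x) + c * (LBINT t:{0..T}. \<integral>y. g y \<partial>P (max 0 t) x)" for T
    using bounded_set_integrable[OF transition_time_measurable[OF f(1)] transition_time_bound[OF f], of 0 T x]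
      bounded_set_integrable[OF transition_time_measurable[OF g(1)] transition_time_bound[OF g], of 0 T x]
    by (subst set_integral_add(2)) auto
  ultimately show ?thesis by (simp add: time_mean_def distrib_left)
qed

lemma mean_deviation_integrable:
  fixes g :: "'a \<Rightarrow> real"
  assumes "g \<in> borel_measurable borel" "\<And>x. \<bar>g x\<bar> \<le> C"
  shows "integrable \<mu> (\<lambda>x. \<bar>time_mean N g x - (\<integral>y. g y \<partial>\<mu>)\<bar>)"
proof -
  interpret prob_space \<mu> by (rule prob_space_invariant[OF \<mu>])
  note [measurable_cong] = sets_invariant[OF \<mu>]
  note [measurable] = assms(1) time_mean_measurable[OF assms(1), of N]
  have "\<bar>\<integral>y. g y \<partial>\<mu>\<bar> \<le> C" by (rule integral_abs_le(2)[OF _ assms(2)]) measurable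
  then have "\<bar>\<bar>time_mean N g x - (\<integral>y. g y \<partial>\<mu>)\<bar>\<bar> \<le> 2 * C" for x
    using time_mean_bound[OF assms, of N x] by linarith
  then show ?thesis by (intro integral_abs_le(1)[where C="2 * C"]) measurable
qed

text \<open>Given the present, a cylinder has a probability that is a bounded function of the state
  and in general not that of a single set. The L1 distance to the mean passes to sums by the
  triangle inequality and to uniform limits by an error estimate.\<close>

lemma mean_convergence_bounded:
  fixes g :: "'a \<Rightarrow> real"
  assumes ind: "\<And>\<Gamma>. \<Gamma> \<in> sets borel \<Longrightarrow>
      (\<lambda>N. \<integral>x. \<bar>(1 / (real N * \<tau>)) * (LBINT t:{0..real N * \<tau>}. measure (P (max 0 t) x) \<Gamma>) - measure \<mu> \<Gamma>\<bar> \<partial>\<mu>) \<longlonglongrightarrow> 0"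
    and g: "g \<in> borel_measurable borel" "\<And>x. \<bar>g x\<bar> \<le> C"
  shows "(\<lambda>N. \<integral>x. \<bar>time_mean N g x - (\<integral>y. g y \<partial>\<mu>)\<bar> \<partial>\<mu>) \<longlonglongrightarrow> 0"
  using g
proof (induction g rule: bounded_measurable_induct)
  case (indicator A)
  then have "A \<in> sets (P (max 0 t) x)" "A \<in> sets \<mu>" for t x
    by (simp_all add: sets_kernel sets_invariant[OF \<mu>])
  then show ?case using ind[OF indicator] by (simp add: time_mean_def)
next
  case (add f g c C D)
  interpret prob_space \<mu> by (rule prob_space_invariant[OF \<mu>])
  note [measurable_cong] = sets_invariant[OF \<mu>]
  note [measurable] = add(1,3)
  note i = mean_deviation_integrable[OF add(1,2)] mean_deviation_integrable[OF add(3,4)]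
  let ?d = "\<lambda>g N x. \<bar>time_mean N g x - (\<integral>y. g y \<partial>\<mu>)\<bar>"
  have "integrable \<mu> f" "integrable \<mu> g" by (auto intro!: integral_abs_le(1) add(2,4))
  then have int: "(\<integral>y. f y + c * g y \<partial>\<mu>) = (\<integral>y. f y \<partial>\<mu>) + c * (\<integral>y. g y \<partial>\<mu>)" by simp
  have b: "\<bar>f x + c * g x\<bar> \<le> C + \<bar>c\<bar> * D" for x
    using add(2)[of x] mult_left_mono[OF add(4)[of x], of "\<bar>c\<bar>"] abs_triangle_ineq[of "f x" "c * g x"]
    by (simp add: abs_mult)
  have m: "(\<lambda>x. f x + c * g x) \<in> borel_measurable borel" by measurable
  have le: "(\<integral>x. ?d (\<lambda>x. f x + c * g x) N x \<partial>\<mu>) \<le> (\<integral>x. ?d f N x \<partial>\<mu>) + \<bar>c\<bar> * (\<integral>x. ?d g N x \<partial>\<mu>)" for N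
  proof -
    have "(\<integral>x. ?d (\<lambda>x. f x + c * g x) N x \<partial>\<mu>) \<le> (\<integral>x. ?d f N x + \<bar>c\<bar> * ?d g N x \<partial>\<mu>)"
    proof (rule integral_mono)
      fix x
      have "time_mean N (\<lambda>x. f x + c * g x) x - (\<integral>y. f y + c * g y \<partial>\<mu>)
        = (time_mean N f x - (\<integral>y. f y \<partial>\<mu>)) + c * (time_mean N g x - (\<integral>y. g y \<partial>\<mu>))"
        unfolding time_mean_add_mult[OF add(1-4)] int by (simp add: algebra_simps)
      then show "?d (\<lambda>x. f x + c * g x) N x \<le> ?d f N x + \<bar>c\<bar> * ?d g N x"
        using abs_triangle_ineq by (simp add: abs_mult[symmetric])
    qed (use i mean_deviation_integrable[OF m b] in auto)
    then show ?thesis using i by simp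
  qed
  have lim: "(\<lambda>N. (\<integral>x. ?d f N x \<partial>\<mu>) + \<bar>c\<bar> * (\<integral>x. ?d g N x \<partial>\<mu>)) \<longlonglongrightarrow> 0"
    using tendsto_add[OF add(5) tendsto_mult_left[OF add(6), of "\<bar>c\<bar>"]] by simp
  show ?case
    by (rule tendsto_sandwich[OF _ _ tendsto_const lim])
       (auto intro!: always_eventually le Bochner_Integration.integral_nonneg)
next
  case (uniform g C)
  interpret prob_space \<mu> by (rule prob_space_invariant[OF \<mu>])
  note [measurable_cong] = sets_invariant[OF \<mu>]
  let ?d = "\<lambda>g N x. \<bar>time_mean N g x - (\<integral>y. g y \<partial>\<mu>)\<bar>"
  show ?case
  proof (rule LIMSEQ_I)
    fix e :: real assume e: "0 < e"
    then obtain f D where f: "f \<in> borel_measurable borel" "\<And>x. \<bar>f x\<bar> \<le> D"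
      "(\<lambda>N. \<integral>x. ?d f N x \<partial>\<mu>) \<longlonglongrightarrow> 0" and gf: "\<And>x. \<bar>g x - f x\<bar> \<le> e / 4"
      using uniform(3)[of "e / 4"] by auto
    note [measurable] = f(1) uniform(1)
    \<comment> \<open>The coefficient \<open>- 1\<close> puts the difference in the form of
      \<open>time_mean_add_mult\<close>. The error \<open>e / 4\<close> enters twice, through the
      time mean and through the space mean.\<close>
    define r where "r x = g x + (- 1) * f x" for x
    have r: "r \<in> borel_measurable borel" "\<And>x. \<bar>r x\<bar> \<le> e / 4"
      using gf by (auto simp: r_def[abs_def])
    have "integrable \<mu> f" "integrable \<mu> g" by (auto intro!: integral_abs_le(1) f(2) uniform(2))
    then have int: "(\<integral>y. r y \<partial>\<mu>) = (\<integral>y. g y \<partial>\<mu>) - (\<integral>y. f y \<partial>\<mu>)" by (simp add: r_def)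
    have "\<bar>\<integral>y. r y \<partial>\<mu>\<bar> \<le> e / 4"
      by (rule integral_abs_le(2)[OF _ r(2)]) (use r(1) in measurable)
    moreover have td: "time_mean N r x = time_mean N g x - time_mean N f x" for N x
      using time_mean_add_mult[OF uniform(1,2) f(1,2), of N "- 1" x] unfolding r_def[symmetric] by simp
    ultimately have "?d g N x \<le> e / 2 + ?d f N x" for N x
      using time_mean_bound[OF r, of N x] td[of N x] unfolding int by linarith
    then have "(\<integral>x. ?d g N x \<partial>\<mu>) \<le> (\<integral>x. e / 2 + ?d f N x \<partial>\<mu>)" for N
      using mean_deviation_integrable[OF f(1,2)] mean_deviation_integrable[OF uniform(1,2)]
      by (intro integral_mono) auto
    then have le: "(\<integral>x. ?d g N x \<partial>\<mu>) \<le> e / 2 + (\<integral>x. ?d f N x \<partial>\<mu>)" for N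
      using mean_deviation_integrable[OF f(1,2)] by (simp add: prob_space)
    from LIMSEQ_D[OF f(3), of "e / 2"] e obtain K
      where K: "\<And>N. K \<le> N \<Longrightarrow> \<bar>\<integral>x. ?d f N x \<partial>\<mu>\<bar> < e / 2" by auto
    have "norm ((\<integral>x. ?d g N x \<partial>\<mu>) - 0) < e" if "K \<le> N" for N
    proof -
      have "0 \<le> (\<integral>x. ?d g N x \<partial>\<mu>)" by simp
      then show ?thesis using le[of N] K[OF that] unfolding real_norm_def by linarith
    qed
    then show "\<exists>K. \<forall>N\<ge>K. norm ((\<integral>x. ?d g N x \<partial>\<mu>) - 0) < e" by blast
  qed
qed

text \<open>
  Once the shifted cylinder lies in the future of \<open>r\<close>, the Markov property turns its probability
  given the past into a transition operator applied to a fixed bounded function.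
\<close>

lemma cesaro_cylinder:
  assumes mean: "\<And>\<Gamma>. \<Gamma> \<in> sets borel \<Longrightarrow>
      (\<lambda>N. \<integral>x. \<bar>(1 / (real N * \<tau>)) * (LBINT t:{0..real N * \<tau>}. measure (P (max 0 t) x) \<Gamma>) - measure \<mu> \<Gamma>\<bar> \<partial>\<mu>) \<longlonglongrightarrow> 0"
    and J: "finite J" and A: "\<And>t. open (A t)" and B: "B \<in> sets (past r)" and r: "start J \<le> r"
  shows "cesaro (\<lambda>t. measure (path_law \<mu>) (path_shift t -` cylinder J A \<inter> B))
    (measure (path_law \<mu>) B * measure (path_law \<mu>) (cylinder J A))"
proof -
  interpret L: prob_space "path_law \<mu>" by (rule prob_space_path_law[OF \<mu>])
  note [measurable_cong] = sets_path_law[OF \<mu>]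
  have BL: "B \<in> sets path_space" using B sets_past_path_space by blast
  note [measurable] = BL
  have A': "A t \<in> sets borel" for t using A by simp
  define ts where "ts = sorted_list_of_set J"
  define s where "s = start J"
  have s: "sorted (s # ts)" unfolding s_def ts_def by (rule sorted_start[OF J])
  \<comment> \<open>\<open>g x\<close> is the probability that the process started in
    \<open>x\<close> at time \<open>s\<close> runs through the cylinder; being at most 1, it loses
    nothing when made real.\<close>
  define g where "g x = enn2real (cyl_int (\<lambda>t. indicator (A t)) s ts x)" for x
  have cm: "cyl_int (\<lambda>t. indicator (A t)) s ts \<in> borel_measurable borel"
    using A' by (intro cyl_int_measurable s) simp
  have c1: "cyl_int (\<lambda>t. indicator (A t)) s ts x \<le> 1" for x
    by (rule cyl_int_le_1[OF _ s]) (simp add: indicator_def)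
  have gm[measurable]: "g \<in> borel_measurable borel" unfolding g_def[abs_def] using cm by measurable
  have g0: "0 \<le> g x" and eg: "ennreal (g x) = cyl_int (\<lambda>t. indicator (A t)) s ts x" for x
    using le_less_trans[OF c1[of x] ennreal_one_less_top] by (auto simp: g_def)
  have g1: "\<bar>g x\<bar> \<le> 1" for x
    using c1[of x] g0[of x] unfolding eg[symmetric] by simp
  have mA: "measure (path_law \<mu>) (cylinder J A) = (\<integral>x. g x \<partial>\<mu>)"
  proof -
    note [measurable_cong] = sets_invariant[OF \<mu>]
    have "emeasure (path_law \<mu>) (cylinder J A) = (\<integral>\<^sup>+x. ennreal (g x) \<partial>\<mu>)"
      unfolding eg ts_def by (rule emeasure_path_law_cylinder[OF \<mu> J A' s[unfolded ts_def]])
    then have "measure (path_law \<mu>) (cylinder J A) = enn2real (\<integral>\<^sup>+x. ennreal (g x) \<partial>\<mu>)"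
      by (simp add: measure_def)
    also have "\<dots> = (\<integral>x. g x \<partial>\<mu>)" using g0 by (intro integral_eq_nn_integral[symmetric]) auto
    finally show ?thesis .
  qed
  \<comment> \<open>The delay after which all times of the shifted cylinder are at least
    \<open>r\<close>.\<close>
  define c where "c = r - s"
  have c0: "0 \<le> c" using r by (simp add: c_def s_def)
  have shifted: "measure (path_law \<mu>) (path_shift (t + c) -` cylinder J A \<inter> B)
    = (\<integral>\<omega>. indicator B \<omega> * (\<integral>y. g y \<partial>P (max 0 t) (\<omega> r)) \<partial>path_law \<mu>)" if t: "0 \<le> t" for t
  proof -
    let ?ts = "map ((+) (t + c)) ts"
    let ?A = "\<lambda>u. A (u - (t + c))"
    have Pm[measurable]: "(\<lambda>x. \<integral>y. g y \<partial>P t x) \<in> borel_measurable borel"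
      by (rule transition_measurable[OF t gm])
    have sm: "sorted ((t + c + s) # ?ts)"
      using sorted_map_add[OF s, of "t + c"] by simp
    then have sm': "sorted (r # ?ts)" using t by (auto simp: c_def)
    have set_ts: "set ts = J" using J by (simp add: ts_def)
    have "path_shift (t + c) -` cylinder J A \<inter> B = B \<inter> {\<omega>. \<forall>u\<in>set ?ts. \<omega> u \<in> ?A u}"
      by (auto simp: cylinder_def path_shift_def set_ts)
    then have "emeasure (path_law \<mu>) (path_shift (t + c) -` cylinder J A \<inter> B)
      = (\<integral>\<^sup>+\<omega>. indicator B \<omega> * cyl_int (\<lambda>u. indicator (?A u)) r ?ts (\<omega> r) \<partial>path_law \<mu>)"
      using markov_path_list[OF path_law_markov_path[OF \<mu>] sm' B, of ?A] A' by simp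
    also have "\<dots> = (\<integral>\<^sup>+\<omega>. ennreal (indicator B \<omega> * (\<integral>y. g y \<partial>P t (\<omega> r))) \<partial>path_law \<mu>)"
    proof (rule nn_integral_cong)
      fix \<omega> :: "real \<Rightarrow> 'a"
      \<comment> \<open>Seen from \<open>r\<close>, the chain first runs for time \<open>t\<close>
        and then goes through the cylinder in its original position, by translation of all
        times.\<close>
      have "cyl_int (\<lambda>u. indicator (?A u)) r ?ts (\<omega> r)
        = (\<integral>\<^sup>+y. cyl_int (\<lambda>u. indicator (?A u)) (t + c + s) ?ts y \<partial>P (t + c + s - r) (\<omega> r))"
        using A' t by (intro cyl_int_kernel[symmetric] sm) (auto simp: c_def)
      also have "\<dots> = (\<integral>\<^sup>+y. ennreal (g y) \<partial>P t (\<omega> r))"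
        using cyl_int_shift[of "\<lambda>t. indicator (A t)" "t + c" s ts] by (simp add: eg c_def)
      also have "\<dots> = ennreal (\<integral>y. g y \<partial>P t (\<omega> r))"
        by (intro nn_integral_eq_integral prob_space.integral_abs_le(1)[where C=1] prob_space_kernel)
           (use g0 g1 t in \<open>auto simp: measurable_cong_sets[OF sets_kernel refl]\<close>)
      finally show "indicator B \<omega> * cyl_int (\<lambda>u. indicator (?A u)) r ?ts (\<omega> r)
        = ennreal (indicator B \<omega> * (\<integral>y. g y \<partial>P t (\<omega> r)))"
        by (simp split: split_indicator)
    qed
    finally have "measure (path_law \<mu>) (path_shift (t + c) -` cylinder J A \<inter> B)
      = enn2real (\<integral>\<^sup>+\<omega>. ennreal (indicator B \<omega> * (\<integral>y. g y \<partial>P t (\<omega> r))) \<partial>path_law \<mu>)"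
      by (simp add: measure_def)
    also have "\<dots> = (\<integral>\<omega>. indicator B \<omega> * (\<integral>y. g y \<partial>P t (\<omega> r)) \<partial>path_law \<mu>)"
      using g0 by (intro integral_eq_nn_integral[symmetric]) auto
    finally show ?thesis using t by simp
  qed
  let ?u = "\<lambda>t \<omega>. indicator B \<omega> * (\<integral>y. g y \<partial>P (max 0 t) (\<omega> r))"
  have um: "(\<lambda>(t, \<omega>). ?u t \<omega>) \<in> borel_measurable (borel \<Otimes>\<^sub>M path_law \<mu>)"
  proof -
    have "(\<lambda>p. (fst p, snd p r)) \<in> borel \<Otimes>\<^sub>M path_law \<mu> \<rightarrow>\<^sub>M borel \<Otimes>\<^sub>M (borel :: 'a measure)" by measurable
    from measurable_compose[OF this transition_pair_measurable[OF gm]]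
    have [measurable]: "(\<lambda>p. \<integral>y. g y \<partial>P (max 0 (fst p)) (snd p r)) \<in> borel_measurable (borel \<Otimes>\<^sub>M path_law \<mu>)"
      by simp
    show ?thesis unfolding case_prod_beta' by measurable
  qed
  have ub: "\<bar>?u t \<omega>\<bar> \<le> 1" for t \<omega>
    using transition_time_bound[OF gm g1, of t "\<omega> r"] by (simp split: split_indicator)
  let ?U = "\<lambda>t. \<integral>\<omega>. ?u t \<omega> \<partial>path_law \<mu>"
  have Um: "?U \<in> borel_measurable borel"
    by (rule L.borel_measurable_lebesgue_integral) (use um in simp)
  have uL: "?u t \<in> borel_measurable (path_law \<mu>)" for t
    using measurable_compose[OF _ um, of "\<lambda>\<omega>. (t, \<omega>)" "path_law \<mu>"] by simp
  have Ub: "\<bar>?U t\<bar> \<le> 1" for t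
    by (rule L.integral_abs_le(2)[OF uL ub])
  \<comment> \<open>\<open>B\<close> enters only through an indicator, so the error is at most the
    L1 distance of the time mean of \<open>g\<close> from its integral, whichever past event
    \<open>B\<close> is.\<close>
  have "cesaro ?U (measure (path_law \<mu>) B * (\<integral>x. g x \<partial>\<mu>))"
    unfolding cesaro_sequence[OF Um Ub \<tau>]
  proof (rule LIM_zero_cancel, rule tendsto_0_le[OF mean_convergence_bounded[OF mean gm g1], where K=1])
    show "\<forall>\<^sub>F N in sequentially. norm ((1 / (real N * \<tau>)) * (LBINT t:{0..real N * \<tau>}. ?U t) - measure (path_law \<mu>) B * (\<integral>x. g x \<partial>\<mu>))
      \<le> norm (\<integral>x. \<bar>time_mean N g x - (\<integral>y. g y \<partial>\<mu>)\<bar> \<partial>\<mu>) * 1"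
    proof (intro always_eventually allI)
      fix N
      note [measurable] = time_mean_measurable[OF gm, of N]
      have tb: "\<bar>time_mean N g x\<bar> \<le> 1" for x by (rule time_mean_bound[OF gm g1])
      have "(LBINT t:{0..real N * \<tau>}. ?U t) = (\<integral>\<omega>. (LBINT t:{0..real N * \<tau>}. ?u t \<omega>) \<partial>path_law \<mu>)"
        by (rule Fubini_time[OF prob_space_path_law[OF \<mu>] um ub])
      then have "(1 / (real N * \<tau>)) * (LBINT t:{0..real N * \<tau>}. ?U t)
        = (\<integral>\<omega>. indicator B \<omega> * time_mean N g (\<omega> r) \<partial>path_law \<mu>)"
        by (simp add: time_mean_def)
      moreover have i1: "integrable (path_law \<mu>) (\<lambda>\<omega>. indicator B \<omega> * time_mean N g (\<omega> r))"
        by (rule L.integral_abs_le(1)[where C=1]) (use tb in \<open>auto split: split_indicator\<close>)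
      have i2: "integrable (path_law \<mu>) (\<lambda>\<omega>. indicator B \<omega> * (\<integral>x. g x \<partial>\<mu>))"
        using BL by (intro integrable_mult_left) (auto simp: sets_path_law[OF \<mu>] less_top[symmetric])
      have "(\<integral>\<omega>. indicator B \<omega> * (time_mean N g (\<omega> r) - (\<integral>x. g x \<partial>\<mu>)) \<partial>path_law \<mu>)
        = (\<integral>\<omega>. indicator B \<omega> * time_mean N g (\<omega> r) \<partial>path_law \<mu>) - measure (path_law \<mu>) B * (\<integral>x. g x \<partial>\<mu>)"
        unfolding right_diff_distrib using i1 i2 BL by (simp add: sets_path_law[OF \<mu>])
      ultimately have "(1 / (real N * \<tau>)) * (LBINT t:{0..real N * \<tau>}. ?U t) - measure (path_law \<mu>) B * (\<integral>x. g x \<partial>\<mu>)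
        = (\<integral>\<omega>. indicator B \<omega> * (time_mean N g (\<omega> r) - (\<integral>x. g x \<partial>\<mu>)) \<partial>path_law \<mu>)"
        by simp
      also have "\<bar>\<dots>\<bar> \<le> (\<integral>\<omega>. \<bar>indicator B \<omega> * (time_mean N g (\<omega> r) - (\<integral>x. g x \<partial>\<mu>))\<bar> \<partial>path_law \<mu>)"
        by (rule integral_abs_bound)
      also have "\<dots> \<le> (\<integral>\<omega>. \<bar>time_mean N g (\<omega> r) - (\<integral>x. g x \<partial>\<mu>)\<bar> \<partial>path_law \<mu>)"
      proof (rule integral_mono)
        show "integrable (path_law \<mu>) (\<lambda>\<omega>. \<bar>indicator B \<omega> * (time_mean N g (\<omega> r) - (\<integral>x. g x \<partial>\<mu>))\<bar>)"
          using i1 i2 by (intro integrable_abs) (simp add: right_diff_distrib)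
        have "\<bar>\<integral>x. g x \<partial>\<mu>\<bar> \<le> 1"
          by (rule prob_space.integral_abs_le(2)[OF prob_space_invariant[OF \<mu>] _ g1])
             (simp add: measurable_cong_sets[OF sets_invariant[OF \<mu>] refl])
        then have "\<bar>\<bar>time_mean N g x - (\<integral>x. g x \<partial>\<mu>)\<bar>\<bar> \<le> 2" for x
          using tb[of x] by linarith
        then show "integrable (path_law \<mu>) (\<lambda>\<omega>. \<bar>time_mean N g (\<omega> r) - (\<integral>x. g x \<partial>\<mu>)\<bar>)"
          by (intro L.integral_abs_le(1)[where C=2]) measurable
      qed (simp split: split_indicator)
      also have "\<dots> = (\<integral>x. \<bar>time_mean N g x - (\<integral>y. g y \<partial>\<mu>)\<bar> \<partial>\<mu>)"
        by (rule integral_path_law_coordinate[OF \<mu>]) measurable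
      finally show "norm ((1 / (real N * \<tau>)) * (LBINT t:{0..real N * \<tau>}. ?U t) - measure (path_law \<mu>) B * (\<integral>x. g x \<partial>\<mu>))
        \<le> norm (\<integral>x. \<bar>time_mean N g x - (\<integral>y. g y \<partial>\<mu>)\<bar> \<partial>\<mu>) * 1" by simp
    qed
  qed
  then have "cesaro (\<lambda>t. measure (path_law \<mu>) (path_shift (t + c) -` cylinder J A \<inter> B))
    (measure (path_law \<mu>) B * measure (path_law \<mu>) (cylinder J A))"
    unfolding mA by (subst cesaro_cong[OF shifted])
  \<comment> \<open>The delay \<open>c\<close> is undone; it changes the time integral by a bounded
    amount only.\<close>
  then show ?thesis
    by (intro cesaro_shift[OF shift_cylinder_measurable[OF \<mu> J A BL] _ c0, where C=1]) auto
qed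

lemma mean_convergence_imp_ergodic:
  assumes mean: "\<And>\<Gamma>. \<Gamma> \<in> sets borel \<Longrightarrow>
      (\<lambda>N. \<integral>x. \<bar>(1 / (real N * \<tau>)) * (LBINT t:{0..real N * \<tau>}. measure (P (max 0 t) x) \<Gamma>) - measure \<mu> \<Gamma>\<bar> \<partial>\<mu>) \<longlonglongrightarrow> 0"
  shows "ergodic_measure P \<mu>"
proof -
  interpret L: prob_space "path_law \<mu>" by (rule prob_space_path_law[OF \<mu>])
  note sL = sets_path_law[OF \<mu>]
  let ?\<psi> = "\<lambda>A B t. measure (path_law \<mu>) (path_shift t -` A \<inter> B)"
  have SA: "path_shift t -` A \<in> sets path_space" if "A \<in> sets path_space" for A :: "(real \<Rightarrow> 'a) set" and t
    using measurable_sets[OF path_shift_measurable that, of t] by (simp add: space_path_space)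
  have mS: "measure (path_law \<mu>) (path_shift t -` A) = measure (path_law \<mu>) A" if "A \<in> sets path_space" for A t
  proof -
    have "measure (distr (path_law \<mu>) path_space (path_shift t)) A = measure (path_law \<mu>) (path_shift t -` A)"
      using that by (subst measure_distr) (auto simp: space_path_law[OF \<mu>] measurable_cong_sets[OF sL refl])
    then show ?thesis by (simp add: path_law_shift[OF \<mu>])
  qed
  have gen: "sets (path_law \<mu>) = sigma_sets (space (path_law \<mu>)) (open_cylinders UNIV)"
    by (simp add: sL sets_path_space space_path_law[OF \<mu>])
  \<comment> \<open>The shifted event is extended first, against an open cylinder \<open>B\<close>.
    The dominating measure is the law itself because the shift preserves it, and the total mass is
    that of \<open>B\<close>.\<close>
  have step1: "(\<lambda>t. ?\<psi> A B t) \<in> borel_measurable borel \<and> cesaro (?\<psi> A B) (measure (path_law \<mu>) B * measure (path_law \<mu>) A)"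
    if A: "A \<in> sets path_space" and B: "B \<in> open_cylinders UNIV" for A B
  proof -
    obtain K C where K: "B = cylinder K C" "finite K" "\<And>t. open (C t)"
      using B unfolding open_cylinders_def by blast
    have BL: "B \<in> sets path_space" using B by (simp add: sets_path_space)
    show ?thesis
    proof (rule cesaro_sigma_sets[OF prob_space_path_law[OF \<mu>] Int_stable_open_cylinders _ gen])
      show "open_cylinders UNIV \<subseteq> Pow (space (path_law \<mu>))" by (simp add: space_path_law[OF \<mu>])
      show "A \<in> sets (path_law \<mu>)" using A sL by simp
      show "measure (path_law \<mu>) (path_shift t -` space (path_law \<mu>) \<inter> B) = measure (path_law \<mu>) B" for t
        by (simp add: space_path_law[OF \<mu>])
      show "measure (path_law \<mu>) (path_shift t -` A \<inter> B) \<le> measure (path_law \<mu>) A" if "A \<in> sets (path_law \<mu>)" for t A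
        using that SA[of A t] mS[of A t] L.finite_measure_mono[of "path_shift t -` A \<inter> B" "path_shift t -` A"]
        by (simp add: sL)
    next
      fix t and A :: "nat \<Rightarrow> (real \<Rightarrow> 'a) set" assume "range A \<subseteq> sets (path_law \<mu>)" and d: "disjoint_family A"
      then have "range (\<lambda>i. path_shift t -` A i \<inter> B) \<subseteq> sets (path_law \<mu>)"
        using SA BL by (auto simp: sL)
      moreover have "disjoint_family (\<lambda>i. path_shift t -` A i \<inter> B)"
        using d by (auto simp: disjoint_family_on_def)
      ultimately have "(\<lambda>i. measure (path_law \<mu>) (path_shift t -` A i \<inter> B)) sums measure (path_law \<mu>) (\<Union>i. path_shift t -` A i \<inter> B)"
        by (rule L.finite_measure_UNION)
      also have "(\<Union>i. path_shift t -` A i \<inter> B) = path_shift t -` (\<Union>i. A i) \<inter> B" by auto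
      finally show "(\<lambda>i. measure (path_law \<mu>) (path_shift t -` A i \<inter> B)) sums measure (path_law \<mu>) (path_shift t -` (\<Union>i. A i) \<inter> B)" .
    next
      fix A :: "(real \<Rightarrow> 'a) set" assume "A \<in> open_cylinders UNIV"
      then obtain J D where J: "A = cylinder J D" "finite J" "\<And>t. open (D t)"
        unfolding open_cylinders_def by blast
      \<comment> \<open>All times of \<open>B\<close> are at most \<open>r\<close>, which makes
        \<open>B\<close> a past event, and \<open>start J\<close> is too, which makes the delay
        nonnegative.\<close>
      define r where "r = Max (insert (start J) K)"
      have r: "start J \<le> r" "K \<subseteq> {..r}" using K(2) by (auto simp: r_def)
      have "B \<in> open_cylinders {..r}" using K r(2) unfolding open_cylinders_def by blast
      then have "B \<in> sets (past r)" by (simp add: sets_past)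
      then show "(\<lambda>t. measure (path_law \<mu>) (path_shift t -` A \<inter> B)) \<in> borel_measurable borel \<and>
        cesaro (\<lambda>t. measure (path_law \<mu>) (path_shift t -` A \<inter> B)) (measure (path_law \<mu>) B * measure (path_law \<mu>) A)"
        unfolding J(1)
        by (intro conjI shift_cylinder_measurable[OF \<mu> J(2,3) BL] cesaro_cylinder[OF mean J(2,3) _ r(1)])
    qed simp
  qed
  \<comment> \<open>Now the second event is extended, with \<open>A\<close> fixed. Domination is
    monotonicity, and the total mass is the probability of the shifted \<open>A\<close>, constant in
    time by stationarity.\<close>
  have step2: "cesaro (?\<psi> A B) (measure (path_law \<mu>) A * measure (path_law \<mu>) B)"
    if A: "A \<in> sets path_space" and B: "B \<in> sets path_space" for A B
  proof -
    have "(\<lambda>t. ?\<psi> A B t) \<in> borel_measurable borel \<and> cesaro (?\<psi> A B) (measure (path_law \<mu>) A * measure (path_law \<mu>) B)"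
    proof (rule cesaro_sigma_sets[OF prob_space_path_law[OF \<mu>] Int_stable_open_cylinders _ gen])
      show "open_cylinders UNIV \<subseteq> Pow (space (path_law \<mu>))" by (simp add: space_path_law[OF \<mu>])
      show "B \<in> sets (path_law \<mu>)" using B sL by simp
      show "measure (path_law \<mu>) (path_shift t -` A \<inter> space (path_law \<mu>)) = measure (path_law \<mu>) A" for t
        using mS[OF A] by (simp add: space_path_law[OF \<mu>])
      show "measure (path_law \<mu>) (path_shift t -` A \<inter> B) \<le> measure (path_law \<mu>) B" if "B \<in> sets (path_law \<mu>)" for t B
        using that by (intro L.finite_measure_mono) auto
    next
      fix t and B :: "nat \<Rightarrow> (real \<Rightarrow> 'a) set" assume "range B \<subseteq> sets (path_law \<mu>)" and d: "disjoint_family B"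
      then have "range (\<lambda>i. path_shift t -` A \<inter> B i) \<subseteq> sets (path_law \<mu>)"
        using SA[OF A] by (auto simp: sL)
      moreover have "disjoint_family (\<lambda>i. path_shift t -` A \<inter> B i)"
        using d by (auto simp: disjoint_family_on_def)
      ultimately have "(\<lambda>i. measure (path_law \<mu>) (path_shift t -` A \<inter> B i)) sums measure (path_law \<mu>) (\<Union>i. path_shift t -` A \<inter> B i)"
        by (rule L.finite_measure_UNION)
      also have "(\<Union>i. path_shift t -` A \<inter> B i) = path_shift t -` A \<inter> (\<Union>i. B i)" by auto
      finally show "(\<lambda>i. measure (path_law \<mu>) (path_shift t -` A \<inter> B i)) sums measure (path_law \<mu>) (path_shift t -` A \<inter> (\<Union>i. B i))" .
    next
      fix B :: "(real \<Rightarrow> 'a) set" assume "B \<in> open_cylinders UNIV"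
      from step1[OF A this] show "(\<lambda>t. measure (path_law \<mu>) (path_shift t -` A \<inter> B)) \<in> borel_measurable borel \<and>
        cesaro (\<lambda>t. measure (path_law \<mu>) (path_shift t -` A \<inter> B)) (measure (path_law \<mu>) A * measure (path_law \<mu>) B)"
        by (simp add: mult.commute)
    qed simp
    then show ?thesis by simp
  qed
  show ?thesis
    unfolding ergodic_measure_def canonical_law_eq[OF \<mu>] path_shift_image
    using \<mu> step2 by (auto simp: cesaro_def)
qed

end

end

section \<open>Periodic measures\<close>

text \<open>Periodicity reduces the shift to a remainder \<open>r\<close> within one period; the
  part hanging over beyond \<open>\<tau>\<close> is moved back to fill the gap
  \<open>{0..r}\<close>.\<close>

lemma set_integral_periodic:
  fixes \<phi> :: "real \<Rightarrow> real"
  assumes \<phi>: "\<phi> \<in> borel_measurable borel" "\<And>t. \<bar>\<phi> t\<bar> \<le> C" and \<tau>: "0 < \<tau>"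
    and per: "\<And>s. \<phi> (s + \<tau>) = \<phi> s" and t: "0 \<le> t"
  shows "(LBINT s:{0..\<tau>}. \<phi> (s + t)) = (LBINT s:{0..\<tau>}. \<phi> s)"
proof -
  define n where "n = nat \<lfloor>t / \<tau>\<rfloor>"
  define r where "r = t - real n * \<tau>"
  have "real n = of_int \<lfloor>t / \<tau>\<rfloor>" using t \<tau> by (simp add: n_def)
  then have "real n \<le> t / \<tau>" "t / \<tau> < real n + 1" by linarith+
  then have r: "0 \<le> r" "r \<le> \<tau>" using \<tau> by (auto simp: r_def field_simps)
  have pern: "\<phi> (s + real n * \<tau>) = \<phi> s" for s n
  proof (induction n)
    case (Suc n)
    then show ?case using per[of "s + real n * \<tau>"] by (simp add: algebra_simps)
  qed simp
  have "(LBINT s:{0..\<tau>}. \<phi> (s + t)) = (LBINT s:{0..\<tau>}. \<phi> (s + r))"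
    using pern[of "_ + r" n] by (simp add: r_def algebra_simps)
  also have "\<dots> = (LBINT s:{r..\<tau> + r}. \<phi> s)"
    using set_integral_Icc_shift[of 0 \<tau> \<phi> r] by simp
  also have "\<dots> = (LBINT s:{r..\<tau>}. \<phi> s) + (LBINT s:{\<tau>..\<tau> + r}. \<phi> s)"
    using r by (intro set_integral_Icc_add[OF \<phi>]) auto
  also have "(LBINT s:{\<tau>..\<tau> + r}. \<phi> s) = (LBINT s:{0..r}. \<phi> s)"
    using set_integral_Icc_shift[of 0 r \<phi> \<tau>] per by (simp add: add.commute)
  also have "(LBINT s:{r..\<tau>}. \<phi> s) + (LBINT s:{0..r}. \<phi> s) = (LBINT s:{0..\<tau>}. \<phi> s)"
    using r by (subst set_integral_Icc_add[OF \<phi>, of 0 r \<tau>]) auto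
  finally show ?thesis .
qed

text \<open>\<open>L - B\<close> lies in the null set complementary to \<open>B\<close>, so
  completeness makes \<open>L\<close> measurable.\<close>

lemma completion_superset_full_measure:
  assumes N: "prob_space N" and B: "B \<in> sets N" "measure N B = 1" "B \<subseteq> L" and L: "L \<subseteq> space N"
  shows "L \<in> sets (completion N)" "measure (completion N) L = 1"
proof -
  interpret prob_space N by fact
  interpret C: prob_space "completion N"
    by (rule prob_spaceI) (simp add: emeasure_space_1)
  have null: "space N - B \<in> null_sets N"
    using B prob_compl[of B] by (auto simp: null_sets_def emeasure_eq_measure)
  show *: "L \<in> sets (completion N)"
    by (rule sets_completionI[of L B "L - B" "space N - B"]) (use B L null in auto)
  have "measure (completion N) B = 1"
    using B by (simp add: measure_def emeasure_completion)
  then have "1 \<le> measure (completion N) L"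
    using C.finite_measure_mono[OF B(3) *] by simp
  then show "measure (completion N) L = 1" using C.prob_le_1[of L] by simp
qed

text \<open>With a countable basis, membership in the support becomes a countable conjunction, hence
  a measurable condition on time and state jointly.\<close>

lemma measure_support_basis:
  assumes \<B>: "topological_basis \<B>" and M: "sets M = sets borel"
  shows "measure_support M = {x. \<forall>U\<in>\<B>. x \<in> U \<longrightarrow> 0 < emeasure M U}"
proof (intro equalityI subsetI CollectI ballI impI)
  fix x U assume "x \<in> measure_support M" "U \<in> \<B>" "x \<in> U"
  then show "0 < emeasure M U"
    using topological_basis_open[OF \<B>] by (auto simp: measure_support_def)
next
  fix x assume x: "x \<in> {x. \<forall>U\<in>\<B>. x \<in> U \<longrightarrow> 0 < emeasure M U}"
  have "0 < emeasure M V" if V: "open V" "x \<in> V" for V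
  proof -
    obtain U where U: "U \<in> \<B>" "x \<in> U" "U \<subseteq> V"
      using topological_basisE[OF \<B> V] by blast
    then have "0 < emeasure M U" using x by blast
    also have "emeasure M U \<le> emeasure M V"
      using U V M by (intro emeasure_mono) auto
    finally show ?thesis .
  qed
  then show "x \<in> measure_support M" by (auto simp: measure_support_def)
qed

text \<open>Inner regularity by compact sets will be applied on the product of time and
  state.\<close>

instance prod :: (polish_space, polish_space) polish_space ..

context stochastically_continuous_transition
begin

context
  fixes \<rho> :: "real \<Rightarrow> 'a measure" and \<tau> :: real
  assumes periodic: "periodic_measure P \<tau> \<rho>"
begin

lemma period_pos: "0 < \<tau>"
  using periodic by (simp add: periodic_measure_def)

lemma periodic_in_prob_algebra: "\<rho> s \<in> space (prob_algebra borel)"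
  using periodic by (simp add: periodic_measure_def)

lemma periodic_bind:
  assumes "0 \<le> t"
  shows "\<rho> (t + s) = \<rho> s \<bind> P t"
proof (rule prob_measure_eqI)
  note K = periodic_in_prob_algebra[of s] kernel_measurable[OF assms]
  show "prob_space (\<rho> (t + s))" by (rule prob_algebra_borelD(1)[OF periodic_in_prob_algebra])
  show "prob_space (\<rho> s \<bind> P t)" by (rule prob_space_bind'[OF K])
  show "sets (\<rho> (t + s)) = sets (\<rho> s \<bind> P t)"
    using sets_bind'[OF K] prob_algebra_borelD(2)[OF periodic_in_prob_algebra] by simp
  fix B assume "B \<in> sets (\<rho> (t + s))"
  then have B: "B \<in> sets borel" using prob_algebra_borelD(2)[OF periodic_in_prob_algebra] by simp
  then show "measure (\<rho> (t + s)) B = measure (\<rho> s \<bind> P t) B"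
    using periodic assms by (simp add: periodic_measure_def measure_bind_prob_algebra[OF K B])
qed

text \<open>\<open>\<rho> (s + h)\<close> is \<open>\<rho> s\<close> pushed by \<open>P h\<close>,
  so integrals of continuous functions are right continuous in \<open>s\<close>; this is the source
  of measurability in \<open>s\<close>.\<close>

lemma periodic_measurable[measurable]: "\<rho> \<in> borel \<rightarrow>\<^sub>M prob_algebra borel"
proof (rule kernel_measurable_continuousI)
  show "\<rho> s \<in> space (prob_algebra borel)" for s by (rule periodic_in_prob_algebra)
  fix f :: "'a \<Rightarrow> real" assume f: "continuous_on UNIV f" "\<And>x. 0 \<le> f x \<and> f x \<le> 1"
  have "(\<lambda>(s, x::unit). \<integral>y. f y \<partial>\<rho> s) \<in> borel_measurable (borel \<Otimes>\<^sub>M count_space UNIV)"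
  proof (rule borel_measurable_right_continuous)
    fix s :: real and h :: "nat \<Rightarrow> real" assume h: "\<And>n. 0 < h n" "h \<longlonglongrightarrow> 0"
    have "\<rho> (s + h n) = \<rho> s \<bind> P (h n)" for n
      using periodic_bind[of "h n" s] h(1)[of n] by (simp add: add.commute)
    then show "(\<lambda>n. \<integral>y. f y \<partial>\<rho> (s + h n)) \<longlonglongrightarrow> (\<integral>y. f y \<partial>\<rho> s)"
      using bind_kernel_tendsto[OF f h periodic_in_prob_algebra] by simp
  qed simp
  from measurable_compose[OF _ this, of "\<lambda>s. (s, ())" borel]
  show "(\<lambda>s. \<integral>y. f y \<partial>\<rho> s) \<in> borel_measurable borel" by simp
qed

abbreviation period_uniform :: "real measure" where
  "period_uniform \<equiv> uniform_measure lborel {0..\<tau>}"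

lemma emeasure_period: "emeasure lborel {0..\<tau>} = ennreal \<tau>"
  using period_pos by (simp add: emeasure_lborel_Icc_eq)

lemma period_uniform_in_prob_algebra: "period_uniform \<in> space (prob_algebra borel)"
proof -
  have "prob_space period_uniform"
    using period_pos by (intro prob_space_uniform_measure) (auto simp: emeasure_period)
  then show ?thesis by (simp add: space_prob_algebra)
qed

text \<open>\<open>measure_of\<close> yields the zero measure unless the given set function is
  countably additive; agreement with a composition of kernels on all Borel sets excludes that
  default.\<close>

lemma period_average_bind: "period_average \<tau> \<rho> = period_uniform \<bind> \<rho>"
proof -
  have em: "ennreal (1 / \<tau>) * (\<integral>\<^sup>+s\<in>{0..\<tau>}. emeasure (\<rho> s) B \<partial>lborel) = emeasure (period_uniform \<bind> \<rho>) B"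
    if B: "B \<in> sets borel" for B
  proof -
    have m: "(\<lambda>s. emeasure (\<rho> s) B) \<in> borel_measurable lborel"
      using measurable_compose[OF measurable_prob_algebraD[OF periodic_measurable] measurable_emeasure_subprob_algebra[OF B]]
      by simp
    have "emeasure (period_uniform \<bind> \<rho>) B = (\<integral>\<^sup>+s. emeasure (\<rho> s) B \<partial>period_uniform)"
      by (rule emeasure_bind_prob_algebra[OF period_uniform_in_prob_algebra periodic_measurable B])
    also have "\<dots> = (\<integral>\<^sup>+s\<in>{0..\<tau>}. emeasure (\<rho> s) B \<partial>lborel) / ennreal \<tau>"
      using m by (subst nn_integral_uniform_measure) (auto simp: emeasure_period)
    also have "\<dots> = ennreal (1 / \<tau>) * (\<integral>\<^sup>+s\<in>{0..\<tau>}. emeasure (\<rho> s) B \<partial>lborel)"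
      using period_pos by (simp add: divide_ennreal_def inverse_ennreal mult.commute inverse_eq_divide)
    finally show ?thesis by simp
  qed
  have sb: "sets (period_uniform \<bind> \<rho>) = sets borel"
    by (rule sets_bind'[OF period_uniform_in_prob_algebra periodic_measurable])
  have "period_average \<tau> \<rho> = measure_of UNIV (sets borel) (emeasure (period_uniform \<bind> \<rho>))"
    unfolding period_average_def
    by (rule measure_of_eq) (use em in \<open>auto simp: sets.sigma_sets_eq[of borel, simplified]\<close>)
  also have "\<dots> = period_uniform \<bind> \<rho>"
    using measure_of_of_measure[of "period_uniform \<bind> \<rho>"] sets_eq_imp_space_eq[OF sb] sb by simp
  finally show ?thesis .
qed

lemma integral_period_uniform:
  fixes f :: "real \<Rightarrow> real"
  assumes [measurable]: "f \<in> borel_measurable borel"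
  shows "(\<integral>s. f s \<partial>period_uniform) = (1 / \<tau>) * (LBINT s:{0..\<tau>}. f s)"
proof -
  have "period_uniform = density lborel (\<lambda>s. ennreal (indicator {0..\<tau>} s / \<tau>))"
    unfolding uniform_measure_def emeasure_period using period_pos
    by (intro density_cong) (auto simp: divide_ennreal[symmetric] split: split_indicator)
  then have "(\<integral>s. f s \<partial>period_uniform) = (\<integral>s. (indicator {0..\<tau>} s / \<tau>) * f s \<partial>lborel)"
    using period_pos by (simp add: integral_density)
  also have "\<dots> = (\<integral>s. (1 / \<tau>) * (indicator {0..\<tau>} s * f s) \<partial>lborel)" by simp
  also have "\<dots> = (1 / \<tau>) * (LBINT s:{0..\<tau>}. f s)"
    unfolding set_lebesgue_integral_def by (subst integral_mult_right_zero) simp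
  finally show ?thesis .
qed

lemma measure_periodic_measurable: "B \<in> sets borel \<Longrightarrow> (\<lambda>s. measure (\<rho> s) B) \<in> borel_measurable borel"
  using measurable_compose[OF periodic_measurable measurable_measure_prob_algebra] by blast

lemma measure_periodic_bound: "\<bar>measure (\<rho> s) B\<bar> \<le> 1"
  using prob_space.prob_le_1[OF prob_algebra_borelD(1)[OF periodic_in_prob_algebra]] by simp

lemma measure_period_average:
  assumes B: "B \<in> sets borel"
  shows "measure (period_average \<tau> \<rho>) B = (1 / \<tau>) * (LBINT s:{0..\<tau>}. measure (\<rho> s) B)"
  unfolding period_average_bind
    measure_bind_prob_algebra[OF period_uniform_in_prob_algebra periodic_measurable B]
  by (rule integral_period_uniform[OF measure_periodic_measurable[OF B]])

text \<open>Under \<open>P t\<close> every \<open>\<rho> s\<close> becomes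
  \<open>\<rho> (s + t)\<close>, and the mean over a full period does not see the shift.\<close>

lemma invariant_period_average: "invariant_measure P (period_average \<tau> \<rho>)"
  unfolding invariant_measure_def
proof (intro conjI allI impI ballI)
  show "period_average \<tau> \<rho> \<in> space (prob_algebra borel)"
    unfolding period_average_bind
    using prob_space_bind'[OF period_uniform_in_prob_algebra periodic_measurable]
      sets_bind'[OF period_uniform_in_prob_algebra periodic_measurable]
    by (simp add: space_prob_algebra)
  fix t :: real and B :: "'a set" assume t: "0 \<le> t" and B: "B \<in> sets borel"
  have "(\<integral>x. measure (P t x) B \<partial>period_average \<tau> \<rho>) = (\<integral>s. \<integral>x. measure (P t x) B \<partial>\<rho> s \<partial>period_uniform)"
    unfolding period_average_bind
    by (rule integral_bind_prob_algebra[OF period_uniform_in_prob_algebra periodic_measurable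
          measure_kernel_measurable[OF t B], where C=1])
       (simp add: measure_kernel_le_1[OF t])
  also have "\<dots> = (\<integral>s. measure (\<rho> (s + t)) B \<partial>period_uniform)"
    using periodic t B by (simp add: periodic_measure_def add.commute)
  also have "\<dots> = (1 / \<tau>) * (LBINT s:{0..\<tau>}. measure (\<rho> (s + t)) B)"
    by (rule integral_period_uniform) (intro measurable_compose[OF _ measure_periodic_measurable[OF B]]; simp)
  also have "(LBINT s:{0..\<tau>}. measure (\<rho> (s + t)) B) = (LBINT s:{0..\<tau>}. measure (\<rho> s) B)"
    by (rule set_integral_periodic[OF measure_periodic_measurable[OF B] measure_periodic_bound period_pos _ t])
       (use periodic in \<open>simp add: periodic_measure_def\<close>)
  also have "(1 / \<tau>) * \<dots> = measure (period_average \<tau> \<rho>) B"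
    by (rule measure_period_average[OF B, symmetric])
  finally show "measure (period_average \<tau> \<rho>) B = (\<integral>x. measure (P t x) B \<partial>period_average \<tau> \<rho>)" by simp
qed

text \<open>The factor \<open>\<tau>\<close> appears because the criterion integrates over a period
  without dividing by its length, whereas both averages on the right are normalised.\<close>

lemma period_deviation:
  assumes \<Gamma>: "\<Gamma> \<in> sets borel" and N: "0 < N"
  shows "(LBINT s:{0..\<tau>}. (1 / real N) * (\<Sum>k<N. measure (P (s + real k * \<tau>) y) \<Gamma>) - measure (\<rho> s) \<Gamma>)
    = \<tau> * ((1 / (real N * \<tau>)) * (LBINT t:{0..real N * \<tau>}. measure (P (max 0 t) y) \<Gamma>) - measure (period_average \<tau> \<rho>) \<Gamma>)"
proof -
  let ?p = "\<lambda>t. measure (P (max 0 t) y) \<Gamma>"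
  have "(\<lambda>p. measure (case p of (t, x) \<Rightarrow> P (max 0 t) x) \<Gamma>) \<in> borel_measurable (borel \<Otimes>\<^sub>M borel)"
    by (rule measurable_compose[OF kernel_pair_measurable measurable_measure_prob_algebra[OF \<Gamma>]])
  from measurable_compose[OF _ this, of "\<lambda>t. (t, y)" borel]
  have pm[measurable]: "?p \<in> borel_measurable borel" by simp
  have pb: "\<bar>?p t\<bar> \<le> 1" for t by (simp add: measure_kernel_le_1)
  have ps: "(\<lambda>s. ?p (s + real k * \<tau>)) \<in> borel_measurable borel" for k by measurable
  have i1: "set_integrable lborel {0..\<tau>} (\<lambda>s. ?p (s + real k * \<tau>))" for k
    by (rule bounded_set_integrable[OF ps pb])
  have "(LBINT s:{0..\<tau>}. (1 / real N) * (\<Sum>k<N. measure (P (s + real k * \<tau>) y) \<Gamma>) - measure (\<rho> s) \<Gamma>)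
    = (LBINT s:{0..\<tau>}. (1 / real N) * (\<Sum>k<N. ?p (s + real k * \<tau>)) - measure (\<rho> s) \<Gamma>)"
    using period_pos by (intro set_lebesgue_integral_cong) auto
  also have "\<dots> = (1 / real N) * (LBINT s:{0..\<tau>}. (\<Sum>k<N. ?p (s + real k * \<tau>))) - (LBINT s:{0..\<tau>}. measure (\<rho> s) \<Gamma>)"
  proof -
    have "set_integrable lborel {0..\<tau>} (\<lambda>s. \<Sum>k<N. ?p (s + real k * \<tau>))"
      using i1 unfolding set_integrable_def scaleR_sum_right by (intro Bochner_Integration.integrable_sum)
    moreover have "set_integrable lborel {0..\<tau>} (\<lambda>s. measure (\<rho> s) \<Gamma>)"
      by (rule bounded_set_integrable[OF measure_periodic_measurable[OF \<Gamma>] measure_periodic_bound])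
    ultimately show ?thesis by (subst set_integral_diff(2)) auto
  qed
  also have "(LBINT s:{0..\<tau>}. (\<Sum>k<N. ?p (s + real k * \<tau>))) = (\<Sum>k<N. LBINT s:{0..\<tau>}. ?p (s + real k * \<tau>))"
    using i1 unfolding set_integrable_def set_lebesgue_integral_def scaleR_sum_right
    by (intro Bochner_Integration.integral_sum)
  also have "\<dots> = (LBINT t:{0..real N * \<tau>}. ?p t)"
    using period_pos by (intro set_integral_Icc_sum[OF pm pb, symmetric]) simp
  finally show ?thesis
    unfolding measure_period_average[OF \<Gamma>] using N period_pos by (simp add: right_diff_distrib)
qed

lemma period_deviation_LIMSEQ_iff:
  assumes \<Gamma>: "\<Gamma> \<in> sets borel"
  shows "(\<lambda>N::nat. \<integral>y. \<bar>LBINT s:{0..\<tau>}.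
        (1 / real N) * (\<Sum>k<N. measure (P (s + real k * \<tau>) y) \<Gamma>) - measure (\<rho> s) \<Gamma>\<bar> \<partial>period_average \<tau> \<rho>) \<longlonglongrightarrow> 0
    \<longleftrightarrow> (\<lambda>N. \<integral>x. \<bar>(1 / (real N * \<tau>)) * (LBINT t:{0..real N * \<tau>}. measure (P (max 0 t) x) \<Gamma>)
        - measure (period_average \<tau> \<rho>) \<Gamma>\<bar> \<partial>period_average \<tau> \<rho>) \<longlonglongrightarrow> 0"
    (is "?F \<longlonglongrightarrow> 0 \<longleftrightarrow> ?G \<longlonglongrightarrow> 0")
proof -
  have eq: "?F N = \<tau> * ?G N" if "0 < N" for N
    using period_pos unfolding period_deviation[OF \<Gamma> that] by (simp add: abs_mult)
  have "\<forall>\<^sub>F N in sequentially. ?F N = \<tau> * ?G N"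
    using eventually_gt_at_top[of 0] by eventually_elim (rule eq)
  then have "?F \<longlonglongrightarrow> 0 \<longleftrightarrow> (\<lambda>N. \<tau> * ?G N) \<longlonglongrightarrow> 0" by (rule tendsto_cong)
  also have "\<dots> \<longleftrightarrow> ?G \<longlonglongrightarrow> 0"
    using period_pos tendsto_mult_left_iff[of \<tau> ?G 0 sequentially] by simp
  finally show ?thesis .
qed

theorem ergodic_period_average_iff:
  "ergodic_measure P (period_average \<tau> \<rho>) \<longleftrightarrow>
    (\<forall>\<Gamma>\<in>sets borel.
      (\<lambda>N::nat. \<integral>y. \<bar>LBINT s:{0..\<tau>}.
        (1 / real N) * (\<Sum>k<N. measure (P (s + real k * \<tau>) y) \<Gamma>) - measure (\<rho> s) \<Gamma>\<bar> \<partial>period_average \<tau> \<rho>)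
      \<longlonglongrightarrow> 0)"
  using period_deviation_LIMSEQ_iff ergodic_imp_mean_convergence[OF invariant_period_average _ _ period_pos]
    mean_convergence_imp_ergodic[OF invariant_period_average period_pos]
  by blast

text \<open>
  The union of the supports is the projection of a Borel set of full measure in time and space.
  Exhausting that set by compact sets gives a Borel subset of the union with full measure.
\<close>

lemma ex_borel_subset_supports:
  "\<exists>B\<in>sets borel. B \<subseteq> (\<Union>s\<in>{0..<\<tau>}. measure_support (\<rho> s)) \<and> measure (period_average \<tau> \<rho>) B = 1"
proof -
  let ?\<mu> = "period_average \<tau> \<rho>"
  interpret M: prob_space ?\<mu> by (rule prob_space_invariant[OF invariant_period_average])
  obtain \<B> :: "'a set set" where \<B>: "countable \<B>" "topological_basis \<B>"
    using ex_countable_basis by blast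
  have s\<rho>: "sets (\<rho> s) = sets borel" "space (\<rho> s) = UNIV" for s
    using prob_algebra_borelD[OF periodic_in_prob_algebra] by auto
  \<comment> \<open>The graph of the supports, tested on the countable basis only, so that countably
    many measurable conditions describe it.\<close>
  define G where "G = {p. 0 \<le> fst p \<and> fst p < \<tau> \<and> (\<forall>U\<in>\<B>. snd p \<in> U \<longrightarrow> 0 < emeasure (\<rho> (fst p)) U)}"
  have G: "G \<in> sets (borel \<Otimes>\<^sub>M borel)"
  proof -
    have U: "U \<in> sets borel" if "U \<in> \<B>" for U using topological_basis_open[OF \<B>(2) that] by simp
    have em: "(\<lambda>p. emeasure (\<rho> (fst p)) U) \<in> borel_measurable (borel \<Otimes>\<^sub>M (borel :: 'a measure))" if "U \<in> \<B>" for U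
      using measurable_compose[OF measurable_compose[OF measurable_fst measurable_prob_algebraD[OF periodic_measurable]]
          measurable_emeasure_subprob_algebra[OF U[OF that]]] .
    have "{p \<in> space (borel \<Otimes>\<^sub>M borel). 0 \<le> fst p \<and> fst p < \<tau> \<and> (\<forall>U\<in>\<B>. snd p \<in> U \<longrightarrow> 0 < emeasure (\<rho> (fst p)) U)}
      \<in> sets (borel \<Otimes>\<^sub>M borel)"
      using U em \<B>(1) by measurable
    then show ?thesis by (simp add: G_def space_pair_measure)
  qed
  have GB: "G \<in> sets borel" using G unfolding borel_prod .
  \<comment> \<open>\<open>K s\<close> puts \<open>\<rho> s\<close> on the slice at time
    \<open>s\<close>, so that \<open>m\<close> below is the joint law of a uniform time in the
    period and a state drawn from \<open>\<rho>\<close> at that time.\<close>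
  define K where "K s = distr (\<rho> s) borel (\<lambda>x. (s, x))" for s
  have KM: "K \<in> borel \<rightarrow>\<^sub>M prob_algebra borel"
    unfolding K_def by (rule measurable_distr_prob_space2[OF periodic_measurable]) (simp add: borel_prod)
  define m where "m = period_uniform \<bind> K"
  have sm: "sets m = sets borel" and pm: "prob_space m"
    unfolding m_def using sets_bind'[OF period_uniform_in_prob_algebra KM]
      prob_space_bind'[OF period_uniform_in_prob_algebra KM] by auto
  interpret m: prob_space m by (rule pm)
  have em: "emeasure m E = (\<integral>\<^sup>+s. emeasure (\<rho> s) {x. (s, x) \<in> E} \<partial>period_uniform)" if E: "E \<in> sets borel" for E
  proof -
    have "emeasure m E = (\<integral>\<^sup>+s. emeasure (K s) E \<partial>period_uniform)"
      unfolding m_def by (rule emeasure_bind_prob_algebra[OF period_uniform_in_prob_algebra KM E])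
    also have "\<dots> = (\<integral>\<^sup>+s. emeasure (\<rho> s) {x. (s, x) \<in> E} \<partial>period_uniform)"
    proof (rule nn_integral_cong)
      fix s
      have "(\<lambda>x. (s, x)) \<in> \<rho> s \<rightarrow>\<^sub>M borel"
        unfolding borel_prod[symmetric] by (simp add: measurable_cong_sets[OF s\<rho>(1) refl])
      then show "emeasure (K s) E = emeasure (\<rho> s) {x. (s, x) \<in> E}"
        unfolding K_def using E by (subst emeasure_distr) (auto simp: s\<rho> vimage_def)
    qed
    finally show ?thesis .
  qed
  have supp1: "emeasure (\<rho> s) {x. (s, x) \<in> G} = 1" if s: "0 \<le> s" "s < \<tau>" for s
  proof -
    interpret R: prob_space "\<rho> s" by (rule prob_algebra_borelD(1)[OF periodic_in_prob_algebra])
    \<comment> \<open>Each basic open set of measure zero is avoided almost surely, and there are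
      only countably many of them.\<close>
    have "AE x in \<rho> s. \<forall>U\<in>\<B>. x \<in> U \<longrightarrow> 0 < emeasure (\<rho> s) U"
    proof (subst AE_ball_countable[OF \<B>(1)], rule ballI)
      fix U assume "U \<in> \<B>"
      then have "U \<in> sets (\<rho> s)" using topological_basis_open[OF \<B>(2)] by (simp add: s\<rho>)
      then show "AE x in \<rho> s. x \<in> U \<longrightarrow> 0 < emeasure (\<rho> s) U"
        by (cases "emeasure (\<rho> s) U = 0") (auto intro: AE_not_in simp: null_setsI zero_less_iff_neq_zero)
    qed
    then have "AE x in \<rho> s. x \<in> {x. (s, x) \<in> G}" using s by (simp add: G_def)
    moreover have "{x. (s, x) \<in> G} \<in> sets (\<rho> s)"
      using measurable_sets[OF measurable_Pair1' G, of s] by (simp add: s\<rho> vimage_def)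
    ultimately show ?thesis by (intro R.emeasure_eq_1_AE)
  qed
  have mG: "emeasure m G = 1"
  proof -
    interpret U: prob_space period_uniform
      using period_uniform_in_prob_algebra by (simp add: space_prob_algebra)
    have "AE s in period_uniform. emeasure (\<rho> s) {x. (s, x) \<in> G} = 1"
    proof (rule AE_uniform_measureI)
      \<comment> \<open>The endpoint \<open>\<tau>\<close> belongs to the averaging interval but not
        to the index set of the union; as a single time it is negligible.\<close>
      have "AE s in lborel. s \<noteq> \<tau>" by (rule AE_lborel_singleton)
      then show "AE s in lborel. s \<in> {0..\<tau>} \<longrightarrow> emeasure (\<rho> s) {x. (s, x) \<in> G} = 1"
        by eventually_elim (auto intro: supp1)
    qed simp
    then have "emeasure m G = (\<integral>\<^sup>+s. 1 \<partial>period_uniform)"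
      unfolding em[OF GB] by (intro nn_integral_cong_AE)
    then show ?thesis using U.emeasure_space_1 by simp
  qed
  have snd: "measure ?\<mu> B = measure m (UNIV \<times> B)" if B: "B \<in> sets borel" for B
  proof -
    have "UNIV \<times> B \<in> sets (borel :: (real \<times> 'a) measure)"
      unfolding borel_prod[symmetric] using B by auto
    then have "emeasure m (UNIV \<times> B) = (\<integral>\<^sup>+s. emeasure (\<rho> s) B \<partial>period_uniform)"
      by (subst em) auto
    also have "\<dots> = emeasure ?\<mu> B"
      unfolding period_average_bind
      by (rule emeasure_bind_prob_algebra[OF period_uniform_in_prob_algebra periodic_measurable B, symmetric])
    finally show ?thesis by (simp add: measure_def)
  qed
  have "\<exists>C. compact C \<and> C \<subseteq> G \<and> 1 - 1 / real (Suc n) < measure m C" for n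
  proof -
    have "emeasure m G = (SUP C\<in>{C. C \<subseteq> G \<and> compact C}. emeasure m C)"
      by (rule inner_regular[OF sm _ GB]) simp
    moreover have "ennreal (1 - 1 / real (Suc n)) < 1"
      by (rule ennreal_less_one_iff[THEN iffD2]) simp
    ultimately have "ennreal (1 - 1 / real (Suc n)) < (SUP C\<in>{C. C \<subseteq> G \<and> compact C}. emeasure m C)"
      using mG by simp
    then obtain C where "C \<subseteq> G" "compact C" "ennreal (1 - 1 / real (Suc n)) < emeasure m C"
      unfolding less_SUP_iff by blast
    then show ?thesis by (auto simp: m.emeasure_eq_measure ennreal_less_iff)
  qed
  then obtain C where C: "\<And>n. compact (C n)" "\<And>n. C n \<subseteq> G" "\<And>n. 1 - 1 / real (Suc n) < measure m (C n)"
    by metis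
  \<comment> \<open>Compact sets have compact, hence Borel, projections; the projection of
    \<open>G\<close> itself might fail to be Borel.\<close>
  define B where "B = (\<Union>n. snd ` C n)"
  have compact_snd: "compact (snd ` C n)" for n
    by (rule compact_continuous_image[OF continuous_on_snd[OF continuous_on_id] C(1)])
  then have sn: "snd ` C n \<in> sets borel" for n by (simp add: borel_closed compact_imp_closed)
  then have B: "B \<in> sets borel" unfolding B_def by auto
  have "B \<subseteq> (\<Union>s\<in>{0..<\<tau>}. measure_support (\<rho> s))"
  proof
    fix x assume "x \<in> B"
    then obtain s n where "(s, x) \<in> C n" by (auto simp: B_def)
    then have "(s, x) \<in> G" using C(2) by blast
    then show "x \<in> (\<Union>s\<in>{0..<\<tau>}. measure_support (\<rho> s))"
      using measure_support_basis[OF \<B>(2) s\<rho>(1), of s] by (auto simp: G_def)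
  qed
  moreover have "measure ?\<mu> B = 1"
  proof (rule antisym[OF M.prob_le_1])
    have "1 - 1 / real (Suc n) \<le> measure ?\<mu> B" for n
    proof -
      have U: "UNIV \<times> snd ` C n \<in> sets m"
        unfolding sm borel_prod[symmetric] using sn by auto
      have "1 - 1 / real (Suc n) \<le> measure m (C n)" using C(3)[of n] by simp
      also have "\<dots> \<le> measure m (UNIV \<times> snd ` C n)"
        by (rule m.finite_measure_mono[OF _ U]) force
      also have "\<dots> = measure ?\<mu> (snd ` C n)" by (rule snd[OF sn, symmetric])
      also have "\<dots> \<le> measure ?\<mu> B"
        by (rule M.finite_measure_mono) (use B in \<open>auto simp: B_def sets_invariant[OF invariant_period_average]\<close>)
      finally show ?thesis .
    qed
    moreover have "(\<lambda>n. 1 - 1 / real (Suc n)) \<longlonglongrightarrow> 1 - 0"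
      by (intro tendsto_diff tendsto_const LIMSEQ_Suc[OF lim_inverse_n'])
    ultimately show "1 \<le> measure ?\<mu> B"
      by (intro LIMSEQ_le_const2[of "\<lambda>n. 1 - 1 / real (Suc n)"]) auto
  qed
  ultimately show ?thesis using B by blast
qed

end

section \<open>Almost everywhere invariant sets\<close>

context
  fixes \<mu> :: "'a measure"
  assumes \<mu>: "invariant_measure P \<mu>"
begin

text \<open>By invariance the integral of the nonnegative function \<open>P t x N\<close> against
  \<open>\<mu>\<close> is the measure of \<open>N\<close>, hence zero.\<close>

lemma ae_kernel_null:
  assumes N: "N \<in> null_sets \<mu>" and t: "0 \<le> t"
  shows "AE x in \<mu>. N \<in> null_sets (P t x)"
proof -
  interpret prob_space \<mu> by (rule prob_space_invariant[OF \<mu>])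
  note sm = sets_invariant[OF \<mu>]
  have Nb: "N \<in> sets borel" using N sm by auto
  have "emeasure (\<mu> \<bind> P t) N = (\<integral>\<^sup>+x. emeasure (P t x) N \<partial>\<mu>)"
    using \<mu> by (intro emeasure_bind_prob_algebra[OF _ kernel_measurable[OF t] Nb]) (simp add: invariant_measure_def)
  then have "(\<integral>\<^sup>+x. emeasure (P t x) N \<partial>\<mu>) = 0"
    using N invariant_measure_bind[OF \<mu> t] by auto
  then have "AE x in \<mu>. emeasure (P t x) N = 0"
    by (subst (asm) nn_integral_0_iff_AE)
       (use emeasure_kernel_measurable[OF t Nb] in \<open>simp_all add: measurable_cong_sets[OF sm refl]\<close>)
  then show ?thesis by eventually_elim (use Nb t in \<open>auto simp: null_sets_def sets_kernel\<close>)
qed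

text \<open>The complement of \<open>B\<close> is null, hence null for \<open>P t x\<close> for
  almost every \<open>x\<close>; almost every \<open>x\<close> also lies in \<open>L\<close>, so
  both sides of the invariance equation equal 1.\<close>

lemma full_measure_ae_invariant:
  assumes B: "B \<in> sets borel" "measure \<mu> B = 1" "B \<subseteq> L"
  shows "measure (completion \<mu>) L = 1" "ae_invariant_set P \<mu> L" "AE x in \<mu>. x \<in> L"
proof -
  interpret prob_space \<mu> by (rule prob_space_invariant[OF \<mu>])
  note sm = sets_invariant[OF \<mu>] and spm = space_invariant[OF \<mu>]
  have B': "B \<in> sets \<mu>" using B sm by simp
  show "measure (completion \<mu>) L = 1"
    by (rule completion_superset_full_measure(2)[OF prob_space_invariant[OF \<mu>] B' B(2,3)]) (simp add: spm)
  have aeB: "AE x in \<mu>. x \<in> B" using B(2) prob_eq_1[OF B'] by simp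
  then show "AE x in \<mu>. x \<in> L" by eventually_elim (use B(3) in auto)
  have null: "- B \<in> null_sets \<mu>"
    using prob_compl[OF B'] B(2) sets.compl_sets[OF B'] by (auto simp: null_sets_def emeasure_eq_measure spm Compl_eq_Diff_UNIV)
  show "ae_invariant_set P \<mu> L"
    unfolding ae_invariant_set_def
  proof (intro conjI allI impI)
    show "L \<in> sets (completion \<mu>)"
      by (rule completion_superset_full_measure(1)[OF prob_space_invariant[OF \<mu>] B' B(2,3)]) (simp add: spm)
    fix t :: real assume t: "0 \<le> t"
    from ae_kernel_null[OF null t] aeB
    show "AE x in \<mu>. L \<in> sets (completion (P t x)) \<and> measure (completion (P t x)) L = indicator L x"
    proof eventually_elim
      case (elim x)
      interpret K: prob_space "P t x" by (rule prob_space_kernel[OF t])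
      have BK: "B \<in> sets (P t x)" using B by (simp add: sets_kernel[OF t])
      have "measure (P t x) (- B) = 0" using elim(1) by (auto simp: measure_def)
      then have "measure (P t x) B = 1"
        using K.prob_compl[OF BK] by (simp add: space_kernel[OF t] Compl_eq_Diff_UNIV)
      from completion_superset_full_measure[OF prob_space_kernel[OF t] BK this B(3)] elim(2) B(3)
      show ?case by (auto simp: space_kernel[OF t])
    qed
  qed
qed

text \<open>At each fixed later time a path that starts in \<open>A\<close> is almost surely in
  \<open>A\<close>, so the correlation of \<open>A\<close> with itself does not decay: its average
  is the measure of \<open>A\<close>, while ergodicity gives the square. The only positive solution
  of \<open>a = a * a\<close> is 1.\<close>

lemma ergodic_ae_invariant_full:
  assumes erg: "ergodic_measure P \<mu>" and A: "ae_invariant_set P \<mu> A" and pos: "0 < measure (completion \<mu>) A"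
  shows "AE x in \<mu>. x \<in> A"
proof -
  interpret prob_space \<mu> by (rule prob_space_invariant[OF \<mu>])
  note sm = sets_invariant[OF \<mu>] and spm = space_invariant[OF \<mu>]
  have "A \<in> sets (completion \<mu>)" using A by (simp add: ae_invariant_set_def)
  then obtain S N N' where SN: "A = S \<union> N" "N \<subseteq> N'" "N' \<in> null_sets \<mu>" "S \<in> sets \<mu>"
    by (rule sets_completionE)
  have S: "S \<in> sets borel" and N': "N' \<in> sets borel" using SN sm by auto
  \<comment> \<open>Allows \<open>A\<close> to be replaced by its Borel core \<open>S\<close> under
    \<open>\<mu>\<close> and under every kernel for which the exceptional set \<open>N'\<close> is
    still null.\<close>
  have between: "measure (completion M) A = measure M S"
    if M: "sets M = sets borel" "finite_measure M" "N' \<in> null_sets M" for M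
  proof -
    interpret M: finite_measure M by (rule M(2))
    have "emeasure (completion M) A = emeasure (completion M) S"
      using SN(1,2) S M by (intro emeasure_eq_AE) 
        (auto intro!: AE_I'[of N'] sets_completionI[of _ S N N'] null_sets_completionI)
    then show ?thesis using S M(1) by (simp add: measure_def)
  qed
  have "0 < measure \<mu> S"
    using pos between[OF sm _ SN(3)] finite_measure_axioms by simp
  have "(\<integral>x. indicator S x * measure (P t x) S \<partial>\<mu>) = measure \<mu> S" if t: "0 \<le> t" for t
  proof -
    have "AE x in \<mu>. measure (completion (P t x)) A = indicator A x"
      using A t by (auto simp: ae_invariant_set_def elim: eventually_mono)
    then have "AE x in \<mu>. indicator S x * measure (P t x) S = (indicator S x :: real)"
      using ae_kernel_null[OF SN(3) t]
    proof eventually_elim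
      case (elim x)
      have "measure (P t x) S = indicator A x"
        using between[OF sets_kernel[OF t] _ elim(2)] prob_space_kernel[OF t, of x] elim(1)
        by (simp add: prob_space_def)
      then show ?case using SN(1) by (auto split: split_indicator)
    qed
    then have "(\<integral>x. indicator S x * measure (P t x) S \<partial>\<mu>) = (\<integral>x. indicator S x \<partial>\<mu>)"
      using measure_kernel_measurable[OF t S] S
      by (intro integral_cong_AE) (auto simp: measurable_cong_sets[OF sm refl])
    then show ?thesis using SN(4) by simp
  qed
  with ergodic_two_point[OF \<mu> erg S S] have "cesaro (\<lambda>_. measure \<mu> S) (measure \<mu> S * measure \<mu> S)"
    by (subst (asm) cesaro_cong[where \<psi>="\<lambda>_. measure \<mu> S"]) auto
  with cesaro_const[of "measure \<mu> S"] have "measure \<mu> S = measure \<mu> S * measure \<mu> S"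
    unfolding cesaro_def by (rule tendsto_unique[OF trivial_limit_at_top_linorder])
  with \<open>0 < measure \<mu> S\<close> have "measure \<mu> S = 1" by simp
  then have "AE x in \<mu>. x \<in> S" using prob_eq_1[OF SN(4)] by simp
  then show ?thesis by eventually_elim (use SN(1) in auto)
qed

end

end

theorem lemma4p4:
  fixes P :: "real \<Rightarrow> 'a \<Rightarrow> 'a::polish_space measure"
    and \<rho> :: "real \<Rightarrow> 'a measure"
    and \<tau> :: real
  defines "\<rho>bar \<equiv> period_average \<tau> \<rho>"
    and "L \<equiv> (\<Union>s\<in>{0..<\<tau>}. measure_support (\<rho> s))"
  assumes "markov_semigroup P"
    and "stochastically_continuous P"
    and "periodic_measure P \<tau> \<rho>"
  shows "(ergodic_measure P \<rho>bar \<longleftrightarrow>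
            (\<forall>\<Gamma>\<in>sets borel.
              (\<lambda>N::nat. \<integral>y. \<bar>LBINT s:{0..\<tau>}.
                   (1 / real N) * (\<Sum>k<N. measure (P (s + real k * \<tau>) y) \<Gamma>) - measure (\<rho> s) \<Gamma>\<bar> \<partial>\<rho>bar)
              \<longlonglongrightarrow> 0)) \<and>
         (ergodic_measure P \<rho>bar \<longrightarrow>
            0 < measure (completion \<rho>bar) L \<and>
            ae_invariant_set P \<rho>bar L \<and>
            (\<forall>A. 0 < measure (completion \<rho>bar) A \<and> ae_invariant_set P \<rho>bar A \<longrightarrow>
                 (AE x in \<rho>bar. x \<in> A \<longleftrightarrow> x \<in> L)))"
proof -
  interpret stochastically_continuous_transition P
    by unfold_locales fact+
  note inv = invariant_period_average[OF assms(5), folded \<rho>bar_def]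
  obtain B where B: "B \<in> sets borel" "B \<subseteq> L" "measure \<rho>bar B = 1"
    using ex_borel_subset_supports[OF assms(5)] unfolding \<rho>bar_def L_def by blast
  note full = full_measure_ae_invariant[OF inv B(1,3,2)]
  \<comment> \<open>Both sets have full measure, so they coincide almost everywhere.\<close>
  have "AE x in \<rho>bar. x \<in> A \<longleftrightarrow> x \<in> L"
    if "ergodic_measure P \<rho>bar" "0 < measure (completion \<rho>bar) A" "ae_invariant_set P \<rho>bar A" for A
    using ergodic_ae_invariant_full[OF inv that(1,3,2)] full(3) by eventually_elim simp
  then show ?thesis
    using ergodic_period_average_iff[OF assms(5)] full unfolding \<rho>bar_def by auto
qed

end
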